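(* Let $K$ be a field and let $m,n\geq 2$ be integers. Let $L\subset[(0,0),(m,n)]$ be a simple planar distributive lattice such that $[(0,0),(m,n)]$ is the smallest interval of $\mathbb{N}^2$ containing $L$, and such that $L$ contains all vertices of the squares $[(0,0),(1,1)]$ and $[(m-1,n-1),(m,n)]$. Then the Hibi ideal $I_L\subset K[L]$ is linearly related if and only if the following two conditions hold: (i) at most one of the vertices $(m,0)$ and $(0,n)$ does not belong to $L$; (ii) the vertices $(1,n-1)$ and $(m-1,1)$ belong to $L$.
   Context: $\mathbb{N}=\{0,1,2,\dots\}$ and $\mathbb{N}^2$ carries the partial order $(i,j)\leq(k,\ell)$ iff $i\leq k$ and $j\leq\ell$; $[a,b]=\{c\in\mathbb{N}^2: a\leq c\leq b\}$. A planar distributive lattice is a finite sublattice $L$ of $\mathbb{N}^2$ with $(0,0)\in L$ such that for any $(i,j)\leq(k,\ell)$ in $L$ there is a chain $x_0<x_1<\cdots<x_t$ in $L$, $x_s=(i_s,j_s)$, from $x_0=(i,j)$ to $x_t=(k,\ell)$ with $i_{s+1}+j_{s+1}=i_s+j_s+1$ for all $s$. A finite distributive lattice $L$ with poset $P$ of join-irreducible elements is simple if there is no $p\in P$ comparable to every element of $P$; equivalently, there are no $\alpha<\beta$ in $L$ such that every $\gamma\in L$ satisfies $\gamma\geq\beta$ or $\gamma\leq\alpha$. $K[L]$ is the polynomial ring over $K$ in the variables $x_\alpha$, $\alpha\in L$ (standard grading), and the Hibi ideal is $I_L=(x_\alpha x_\beta-x_{\alpha\wedge\beta}x_{\alpha\vee\beta}:\alpha,\beta\in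 L\text{ incomparable})$. $\beta_{ij}(I_L)=\dim_K\operatorname{Tor}_i^{K[L]}(I_L,K)_j$ are the graded Betti numbers. $I_L$ is linearly related (has linear relations) if $\beta_{1j}(I_L)=0$ for all $j\geq4$. *)

theory Defs
  imports
    Complex_Main
    "HOL-Library.Poly_Mapping"
    "HOL-Library.Product_Order"
    "HOL-Algebra.Ideal"
begin

section \<open>Lattices\<close>

text \<open>The order, \<^const>\<open>inf\<close> and \<^const>\<open>sup\<close> on \<^typ>\<open>nat \<times> nat\<close> are the componentwise ones.\<close>

definition planar_distributive_lattice :: "(nat \<times> nat) set \<Rightarrow> bool" where
  "planar_distributive_lattice L \<longleftrightarrow>
     finite L \<and> (0, 0) \<in> L \<and>
     (\<forall>a\<in>L. \<forall>b\<in>L. inf a b \<in> L \<and> sup a b \<in> L) \<and>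
     (\<forall>a\<in>L. \<forall>b\<in>L. a \<le> b \<longrightarrow>
        (\<exists>(t::nat) (x :: nat \<Rightarrow> nat \<times> nat).
           x 0 = a \<and> x t = b \<and> (\<forall>s\<le>t. x s \<in> L) \<and>
           (\<forall>s<t. x s < x (Suc s) \<and>
                   fst (x (Suc s)) + snd (x (Suc s)) = fst (x s) + snd (x s) + 1)))"

definition join_irreducibles :: "'a::lattice set \<Rightarrow> 'a set" where
  "join_irreducibles L =
     {p\<in>L. (\<exists>a\<in>L. \<not> p \<le> a) \<and> (\<forall>a\<in>L. \<forall>b\<in>L. p = sup a b \<longrightarrow> p = a \<or> p = b)}"

definition simple_lattice :: "'a::lattice set \<Rightarrow> bool" where
  "simple_lattice L \<longleftrightarrow>
     \<not> (\<exists>p\<in>join_irreducibles L. \<forall>q\<in>join_irreducibles L. p \<le> q \<or> q \<le> p)"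


section \<open>Polynomial rings and Hibi ideals\<close>

text \<open>Monomials are finitely supported exponent functions; \<open>polys V\<close> is the set of polynomials
  that only involve the variables in \<open>V\<close>.\<close>

type_synonym ('v, 'k) mpoly = "('v \<Rightarrow>\<^sub>0 nat) \<Rightarrow>\<^sub>0 'k"

abbreviation lookup :: "('a \<Rightarrow>\<^sub>0 'b::zero) \<Rightarrow> 'a \<Rightarrow> 'b" where
  "lookup \<equiv> Poly_Mapping.lookup"

abbreviation keys :: "('a \<Rightarrow>\<^sub>0 'b::zero) \<Rightarrow> 'a set" where
  "keys \<equiv> Poly_Mapping.keys"

definition mdeg :: "('v \<Rightarrow>\<^sub>0 nat) \<Rightarrow> nat" where
  "mdeg t = (\<Sum>v\<in>keys t. lookup t v)"

definition var :: "'v \<Rightarrow> ('v, 'k::field) mpoly" where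
  "var v = Poly_Mapping.single (Poly_Mapping.single v 1) 1"

definition polys :: "'v set \<Rightarrow> ('v, 'k::field) mpoly set" where
  "polys V = {p. \<forall>t\<in>keys p. keys t \<subseteq> V}"

definition poly_ring :: "'v set \<Rightarrow> ('v, 'k::field) mpoly ring" where
  "poly_ring V = \<lparr>carrier = polys V, mult = (*), one = 1, zero = 0, add = (+)\<rparr>"

lemma polys_zero: "0 \<in> polys V" and polys_one: "1 \<in> polys V"
  by (simp_all add: polys_def)

lemma polys_add: "p \<in> polys V \<Longrightarrow> q \<in> polys V \<Longrightarrow> p + q \<in> polys V"
  unfolding polys_def using Poly_Mapping.keys_add[of p q] by blast

lemma polys_mult: "p \<in> polys V \<Longrightarrow> q \<in> polys V \<Longrightarrow> p * q \<in> polys V"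
proof -
  assume p: "p \<in> polys V" and q: "q \<in> polys V"
  have "keys t \<subseteq> V" if t: "t \<in> keys (p * q)" for t
  proof -
    obtain a b where "t = a + b" "a \<in> keys p" "b \<in> keys q"
      using t keys_mult[of p q] by blast
    then show ?thesis
      using p q Poly_Mapping.keys_add[of a b] unfolding polys_def by blast
  qed
  then show ?thesis by (simp add: polys_def)
qed

lemma polys_uminus: "p \<in> polys V \<Longrightarrow> - p \<in> polys V"
  by (simp add: polys_def Poly_Mapping.in_keys_iff)

lemma poly_ring_cring: "cring (poly_ring V :: ('v, 'k::field) mpoly ring)" (is "cring ?R")
proof (rule cringI)
  show "abelian_group ?R"
  proof (rule abelian_groupI)
    fix x
    assume "x \<in> carrier ?R"
    then show "\<exists>y\<in>carrier ?R. y \<oplus>\<^bsub>?R\<^esub> x = \<zero>\<^bsub>?R\<^esub>"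
      by (auto simp: poly_ring_def intro!: bexI[of _ "- x"] polys_uminus)
  qed (simp_all add: poly_ring_def polys_add polys_zero add_ac)
  show "comm_monoid ?R"
    by (rule comm_monoidI) (simp_all add: poly_ring_def polys_mult polys_one mult_ac)
qed (simp add: poly_ring_def distrib_right)

definition hibi_ideal :: "'a::lattice set \<Rightarrow> ('a, 'k::field) mpoly set" where
  "hibi_ideal L = Idl\<^bsub>poly_ring L\<^esub>
     {var a * var b - var (inf a b) * var (sup a b) | a b.
        a \<in> L \<and> b \<in> L \<and> \<not> a \<le> b \<and> \<not> b \<le> a}"


section \<open>Graded Betti numbers\<close>

text \<open>A free \<open>R\<close>-module with basis \<open>B \<subseteq> nat\<close> consists of the finitely supported functions
  \<^typ>\<open>nat \<Rightarrow>\<^sub>0 'r\<close> with support in \<open>B\<close>. A linear map out of it is given by the images \<open>f b\<close>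
  of the basis elements; \<open>lin_ext f\<close> is its linear extension.\<close>

definition scal :: "'r::semiring_0 \<Rightarrow> (nat \<Rightarrow>\<^sub>0 'r) \<Rightarrow> (nat \<Rightarrow>\<^sub>0 'r)" where
  "scal r u = Poly_Mapping.map (\<lambda>x. r * x) u"

definition lin_ext :: "(nat \<Rightarrow> (nat \<Rightarrow>\<^sub>0 'r::semiring_0)) \<Rightarrow> (nat \<Rightarrow>\<^sub>0 'r) \<Rightarrow> (nat \<Rightarrow>\<^sub>0 'r)" where
  "lin_ext f u = (\<Sum>b\<in>keys u. scal (lookup u b) (f b))"

definition free_mod :: "'v set \<Rightarrow> nat set \<Rightarrow> (nat \<Rightarrow>\<^sub>0 ('v, 'k::field) mpoly) set" where
  "free_mod V B = {u. keys u \<subseteq> B \<and> (\<forall>b. lookup u b \<in> polys V)}"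

text \<open>Data of a graded complex \<open>\<dots> \<rightarrow> F 2 \<rightarrow> F 1 \<rightarrow> F 0 \<rightarrow> I\<close> of free modules: \<open>F i\<close> has basis
  \<open>basis F i\<close>, where the basis element \<open>b\<close> lives in degree \<open>bdeg F i b\<close> and is mapped to
  \<open>bdry F (i - 1) b\<close> in \<open>F (i - 1)\<close> if \<open>i > 0\<close>, and to \<open>aug F b\<close> in \<open>I\<close> if \<open>i = 0\<close>.\<close>

record (overloaded) ('v, 'k) free_complex =
  basis :: "nat \<Rightarrow> nat set"
  bdeg :: "nat \<Rightarrow> nat \<Rightarrow> nat"
  aug :: "nat \<Rightarrow> ('v, 'k) mpoly"
  bdry :: "nat \<Rightarrow> nat \<Rightarrow> (nat \<Rightarrow>\<^sub>0 ('v, 'k) mpoly)"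

definition aug_map :: "('v, 'k::field) free_complex \<Rightarrow> (nat \<Rightarrow>\<^sub>0 ('v, 'k) mpoly) \<Rightarrow> ('v, 'k) mpoly" where
  "aug_map F u = (\<Sum>b\<in>keys u. lookup u b * aug F b)"

text \<open>The modules are only required to have finitely many basis elements in each degree, so that
  all graded components are finite-dimensional if \<open>V\<close> is finite. The maps have degree 0.\<close>

definition graded_free_resolution ::
  "'v set \<Rightarrow> ('v, 'k::field) mpoly set \<Rightarrow> ('v, 'k) free_complex \<Rightarrow> bool" where
  "graded_free_resolution V I F \<longleftrightarrow>
     (\<forall>i j. finite {b\<in>basis F i. bdeg F i b = j}) \<and>
     (\<forall>b\<in>basis F 0. aug F b \<in> I \<and> (\<forall>t\<in>keys (aug F b). mdeg t = bdeg F 0 b)) \<and>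
     (\<forall>i. \<forall>b\<in>basis F (Suc i).
        bdry F i b \<in> free_mod V (basis F i) \<and>
        (\<forall>c. \<forall>t\<in>keys (lookup (bdry F i b) c). mdeg t + bdeg F i c = bdeg F (Suc i) b)) \<and>
     aug_map F ` free_mod V (basis F 0) = I \<and>
     lin_ext (bdry F 0) ` free_mod V (basis F 1) =
       {u\<in>free_mod V (basis F 0). aug_map F u = 0} \<and>
     (\<forall>i. lin_ext (bdry F (Suc i)) ` free_mod V (basis F (Suc (Suc i))) =
       {u\<in>free_mod V (basis F (Suc i)). lin_ext (bdry F i) u = 0})"

text \<open>The complex \<open>F \<otimes> K\<close>, where \<open>K\<close> is the residue field of the polynomial ring modulo its
  variables: \<open>F i \<otimes> K\<close> is the vector space on \<open>basis F i\<close>, and the differential is obtained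
  by replacing the matrix entries with their constant coefficients.\<close>

definition tensor_comp :: "('v, 'k::field) free_complex \<Rightarrow> nat \<Rightarrow> nat \<Rightarrow> (nat \<Rightarrow>\<^sub>0 'k) set" where
  "tensor_comp F i j = {v. keys v \<subseteq> {b\<in>basis F i. bdeg F i b = j}}"

definition tensor_bdry :: "('v, 'k::field) free_complex \<Rightarrow> nat \<Rightarrow> (nat \<Rightarrow>\<^sub>0 'k) \<Rightarrow> (nat \<Rightarrow>\<^sub>0 'k)" where
  "tensor_bdry F i = lin_ext (\<lambda>b. Poly_Mapping.map (\<lambda>p. lookup p 0) (bdry F i b))"

fun tensor_cycles :: "('v, 'k::field) free_complex \<Rightarrow> nat \<Rightarrow> nat \<Rightarrow> (nat \<Rightarrow>\<^sub>0 'k) set" where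
  "tensor_cycles F 0 j = tensor_comp F 0 j"
| "tensor_cycles F (Suc i) j = {v\<in>tensor_comp F (Suc i) j. tensor_bdry F i v = 0}"

definition tensor_boundaries :: "('v, 'k::field) free_complex \<Rightarrow> nat \<Rightarrow> nat \<Rightarrow> (nat \<Rightarrow>\<^sub>0 'k) set" where
  "tensor_boundaries F i j = tensor_bdry F i ` tensor_comp F (Suc i) j"

lemma lookup_scal [simp]: "lookup (scal r u) b = r * lookup u b"
  by (simp add: scal_def Poly_Mapping.map.rep_eq when_def)

interpretation scal: vector_space "scal :: 'k::field \<Rightarrow> _"
  by unfold_locales (auto intro!: poly_mapping_eqI simp: lookup_add algebra_simps)

text \<open>\<open>betti V I i j\<close> is the dimension of \<open>Tor\<^sub>i(I, K)\<^sub>j\<close> over the polynomial ring \<open>K[V]\<close>, for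
  finite \<open>V\<close> and a homogeneous ideal \<open>I\<close>. As usual, \<open>Tor\<close> does not depend on the resolution.\<close>

definition betti :: "'v set \<Rightarrow> ('v, 'k::field) mpoly set \<Rightarrow> nat \<Rightarrow> nat \<Rightarrow> nat" where
  "betti V I i j =
     (let F = (SOME F. graded_free_resolution V I F)
      in scal.dim (tensor_cycles F i j) - scal.dim (tensor_boundaries F i j))"

definition linearly_related :: "'v set \<Rightarrow> ('v, 'k::field) mpoly set \<Rightarrow> bool" where
  "linearly_related V I \<longleftrightarrow> (\<forall>j\<ge>4. betti V I 1 j = 0)"

end

theory Submission
  imports Defs "HOL-Library.Nat_Bijection"
begin

text \<open>The Hibi ideal of a sublattice of \<open>\<nat> \<times> \<nat>\<close> is the toric ideal of the map
  \<open>x (i, j) \<mapsto> s i * t j\<close>: two monomials are congruent iff they have the same multisets of rows and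
  columns, and every monomial straightens to a unique one that is supported on a chain.

  \<open>Tor\<^sub>1 (I, K)\<^sub>j\<close> vanishes iff every \<open>K\<close>-linear family \<open>h v : I \<rightarrow> K\<close> with
  \<open>h v (x w * g) = h w (x v * g)\<close> kills all homogeneous \<open>f v \<in> I\<close> of degree \<open>j - 1\<close> with
  \<open>\<Sum> x v * f v = 0\<close>. Such a family assigns a number to every pair of monomials in a common fibre that
  share a variable; it kills all \<open>f\<close> if these numbers are differences of a potential. The potential is
  obtained by summing along straightenings. This is well defined by Newman's lemma: local confluence
  can only fail in degree 4, for two incomparable pairs with disjoint supports, and conditions (i) and
  (ii) provide a variable over which the resulting square is a cone.

  If (i) or (ii) fails, the monomials in the fibre of the product of the two corner squares avoid
  \<open>(m, 0)\<close> and \<open>(0, n)\<close>. This makes it possible to define a family that detects the Koszul relation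
  of the two corner squares.\<close>

section \<open>Weighted degrees and evaluation on monomials\<close>

text \<open>Tensoring \<open>0 \<rightarrow> m \<rightarrow> K[L] \<rightarrow> K \<rightarrow>
  0\<close> with \<open>I\<close> identifies the first \<open>Tor\<close> with the kernel of
  \<open>m \<otimes> I \<rightarrow> I\<close>. As the ideal \<open>m\<close> of the variables is
  presented by Koszul relations, the families \<open>h\<close> are exactly the linear functionals on
  \<open>m \<otimes> I\<close>. The resulting criterion mentions no resolution, whereas
  \<open>betti\<close> picks an unknown one.

  A fibre contains only one chain, so straightening itself is confluent. The obstacle is that the
  numbers collected on the way add up only among monomials with a variable common to all of them.
  Two steps touch at most four factors, so beyond degree 4 some variable stays untouched by both.

  For the converse, call a monomial of the corner fibre inner if it avoids \<open>(0, 0)\<close> and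
  \<open>(m, n)\<close>. Without \<open>(m, 0)\<close> and \<open>(0, n)\<close>, an inner and a
  non-inner monomial share only variables with a coordinate 0 or only variables without one.
  Counting the passages of the first kind gives the detecting family: the Koszul square has exactly
  one.\<close>

definition wt :: "('v \<Rightarrow> nat) \<Rightarrow> ('v \<Rightarrow>\<^sub>0 nat) \<Rightarrow> nat" where
  "wt w t = (\<Sum>v\<in>keys t. lookup t v * w v)"

lemma wt_superset:
  assumes "finite A" "keys t \<subseteq> A"
  shows "wt w t = (\<Sum>v\<in>A. lookup t v * w v)"
  unfolding wt_def by (rule sum.mono_neutral_left) (use assms in \<open>auto simp: in_keys_iff\<close>)

lemma wt_zero [simp]: "wt w 0 = 0"
  by (simp add: wt_def)

lemma wt_single [simp]: "wt w (Poly_Mapping.single v c) = c * w v"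
  by (cases "c = 0") (simp_all add: wt_def)

lemma wt_add: "wt w (s + t) = wt w s + wt w t"
proof -
  let ?A = "keys s \<union> keys t"
  have "wt w (s + t) = (\<Sum>v\<in>?A. lookup (s + t) v * w v)"
    by (rule wt_superset) (use Poly_Mapping.keys_add[of s t] in auto)
  then show ?thesis
    by (simp add: lookup_add distrib_right sum.distrib wt_superset[of ?A])
qed

text \<open>Besides the degree, \<open>wt\<close> yields the coordinate counts of
  \<open>same_fibre\<close> from indicator weights and the termination measure \<open>spread\<close>
  from squared distances to the diagonal; all are additive by \<open>wt_add\<close>.\<close>

lemma mdeg_wt: "mdeg t = wt (\<lambda>_. 1) t"
  by (simp add: mdeg_def wt_def)

lemma mdeg_add: "mdeg (s + t) = mdeg s + mdeg t"
  by (simp add: mdeg_wt wt_add)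

lemma mdeg_single [simp]: "mdeg (Poly_Mapping.single v c) = c"
  by (simp add: mdeg_wt)

lemma mdeg_zero [simp]: "mdeg 0 = 0"
  by (simp add: mdeg_wt)

lemma mdeg_eq_0_iff: "mdeg t = 0 \<longleftrightarrow> t = 0"
proof
  assume "mdeg t = 0"
  then have "\<forall>v\<in>keys t. lookup t v = 0"
    by (simp add: mdeg_def)
  then show "t = 0"
    by (metis in_keys_iff poly_mapping_eqI lookup_zero)
qed simp

lemma keys_add_nat: "keys (s + t :: 'v \<Rightarrow>\<^sub>0 nat) = keys s \<union> keys t"
  by (auto simp: in_keys_iff lookup_add)

section \<open>Polynomials as combinations of monomials, and functionals on them\<close>

definition monom :: "('v \<Rightarrow>\<^sub>0 nat) \<Rightarrow> 'k \<Rightarrow> ('v, 'k::field) mpoly" where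
  "monom t c = Poly_Mapping.single t c"

lemma lookup_monom: "lookup (monom t c) s = (c when t = s)"
  by (simp add: monom_def lookup_single)

lemma monom_mult: "monom s a * monom t b = monom (s + t) (a * b)"
  by (simp add: monom_def mult_single)

lemma monom_add: "monom s (a + b) = monom s a + monom s b"
  by (simp add: monom_def single_add)

lemma monom_zero [simp]: "monom s 0 = 0"
  by (simp add: monom_def)

lemma monom_one: "monom 0 1 = 1"
  by (simp add: monom_def)

lemma var_monom: "var v = monom (Poly_Mapping.single v 1) 1"
  by (simp add: monom_def var_def)

lemma single_expand:
  "p = (\<Sum>t\<in>keys p. Poly_Mapping.single t (lookup p t :: 'b::comm_monoid_add))"
proof (rule poly_mapping_eqI)
  fix s
  have "lookup (\<Sum>t\<in>keys p. Poly_Mapping.single t (lookup p t)) s =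
      (\<Sum>t\<in>keys p. if t = s then lookup p t else 0)"
    by (simp add: lookup_sum lookup_single when_def)
  also have "\<dots> = lookup p s"
    by (auto simp: sum.delta in_keys_iff)
  finally show "lookup p s = lookup (\<Sum>t\<in>keys p. Poly_Mapping.single t (lookup p t)) s" by simp
qed

lemma monom_expand: "p = (\<Sum>t\<in>keys p. monom t (lookup p t))"
  unfolding monom_def by (rule single_expand)

lemma mpoly_induct [case_names zero monom_add]:
  assumes "P 0" and "\<And>p t c. P p \<Longrightarrow> t \<in> keys q \<Longrightarrow> c = lookup q t \<Longrightarrow> P (monom t c + p)"
  shows "P q"
proof -
  have "P (\<Sum>t\<in>A. monom t (lookup q t))" if "finite A" "A \<subseteq> keys q" for A
    using that by (induction A rule: finite_induct) (auto intro: assms)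
  from this[of "keys q"] show ?thesis
    using monom_expand[of q] by simp
qed

text \<open>The monomials form a basis, so every linear functional on polynomials is
  \<open>ev \<psi>\<close> for a unique \<psi>. Fibre sums, the potential and the detecting family
  are all given in this way.\<close>

definition ev :: "(('v \<Rightarrow>\<^sub>0 nat) \<Rightarrow> 'k) \<Rightarrow> ('v, 'k::field) mpoly \<Rightarrow> 'k" where
  "ev \<psi> p = (\<Sum>t\<in>keys p. lookup p t * \<psi> t)"

lemma ev_superset:
  assumes "finite A" "keys p \<subseteq> A"
  shows "ev \<psi> p = (\<Sum>t\<in>A. lookup p t * \<psi> t)"
  unfolding ev_def by (rule sum.mono_neutral_left) (use assms in \<open>auto simp: in_keys_iff\<close>)

lemma ev_zero [simp]: "ev \<psi> 0 = 0"
  by (simp add: ev_def)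

lemma ev_add: "ev \<psi> (p + q) = ev \<psi> p + ev \<psi> q"
proof -
  let ?A = "keys p \<union> keys q"
  have "ev \<psi> (p + q) = (\<Sum>t\<in>?A. lookup (p + q) t * \<psi> t)"
    by (rule ev_superset) (use Poly_Mapping.keys_add[of p q] in auto)
  then show ?thesis
    by (simp add: lookup_add distrib_right sum.distrib ev_superset[of ?A])
qed

lemma ev_uminus: "ev \<psi> (- p) = - ev \<psi> p"
  by (simp add: ev_def sum_negf)

lemma ev_diff: "ev \<psi> (p - q) = ev \<psi> p - ev \<psi> q"
  using ev_add[of \<psi> p "- q"] by (simp add: ev_uminus)

lemma ev_sum: "ev \<psi> (\<Sum>x\<in>A. p x) = (\<Sum>x\<in>A. ev \<psi> (p x))"
  by (induction A rule: infinite_finite_induct) (simp_all add: ev_add)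

lemma ev_monom [simp]: "ev \<psi> (monom t c) = c * \<psi> t"
  by (cases "c = 0") (simp_all add: ev_def monom_def)

lemma ev_monom_mult: "ev \<psi> (monom s c * p) = c * ev (\<lambda>t. \<psi> (s + t)) p"
  by (induction p rule: mpoly_induct) (simp_all add: distrib_left monom_mult ev_add)

lemma ev_mult: "ev \<psi> (r * p) = (\<Sum>s\<in>keys r. lookup r s * ev (\<lambda>t. \<psi> (s + t)) p)"
  by (subst monom_expand[of r]) (simp add: sum_distrib_right ev_sum ev_monom_mult)

lemma ev_cong: "(\<And>t. t \<in> keys p \<Longrightarrow> \<psi> t = \<chi> t) \<Longrightarrow> ev \<psi> p = ev \<chi> p"
  by (simp add: ev_def)

lemma ev_fun_diff: "ev (\<lambda>t. \<psi> t - \<chi> t) p = ev \<psi> p - ev \<chi> p"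
  by (simp add: ev_def right_diff_distrib sum_subtractf)

lemma lookup_ev: "lookup p t = ev (\<lambda>s. if s = t then 1 else 0) p"
  by (auto simp: ev_def in_keys_iff if_distrib cong: if_cong)

section \<open>Graded free modules\<close>

definition filt :: "('a \<Rightarrow> bool) \<Rightarrow> ('a \<Rightarrow>\<^sub>0 'b) \<Rightarrow> ('a \<Rightarrow>\<^sub>0 'b::zero)" where
  "filt P p = Poly_Mapping.mapp (\<lambda>t c. c when P t) p"

lemma lookup_filt: "lookup (filt P p) t = (lookup p t when P t)"
  by (simp add: filt_def lookup_mapp when_def in_keys_iff)

lemma keys_filt: "keys (filt P p) = {t\<in>keys p. P t}"
  by (auto simp: in_keys_iff lookup_filt when_def split: if_splits)

lemma filt_zero [simp]: "filt P 0 = 0"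
  by (rule poly_mapping_eqI) (simp add: lookup_filt)

lemma filt_add: "filt P (p + q) = filt P p + filt P (q :: 'a \<Rightarrow>\<^sub>0 'b::comm_monoid_add)"
  by (rule poly_mapping_eqI) (simp add: lookup_filt lookup_add when_add_distrib)

lemma filt_sum: "filt P (\<Sum>x\<in>A. p x :: 'a \<Rightarrow>\<^sub>0 'b::comm_monoid_add) = (\<Sum>x\<in>A. filt P (p x))"
  by (induction A rule: infinite_finite_induct) (simp_all add: filt_add)

lemma filt_monom: "filt P (monom t c) = (monom t c when P t)"
  by (rule poly_mapping_eqI) (auto simp: lookup_filt lookup_monom when_def)

lemma filt_polys: "p \<in> polys V \<Longrightarrow> filt P p \<in> polys V"
  by (simp add: polys_def keys_filt)

text \<open>Meant for homogeneous \<open>q\<close>: the degree of a product term is then decided by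
  its factor from \<open>p\<close>, so cutting a component out of \<open>p * q\<close> is the same
  as cutting it out of \<open>p\<close>.\<close>

lemma filt_mult:
  assumes "\<And>s t. s \<in> keys q \<Longrightarrow> P t \<longleftrightarrow> Q (t + s)"
  shows "filt Q (p * q) = filt P p * (q :: ('v, 'k::field) mpoly)"
proof (induction p rule: mpoly_induct)
  case zero
  show ?case by simp
next
  case (monom_add p t c)
  have "filt Q (monom t c * q) = filt P (monom t c) * q"
  proof -
    have "filt Q (monom t c * q) = (\<Sum>s\<in>keys q. filt Q (monom (t + s) (c * lookup q s)))"
      by (subst monom_expand[of q]) (simp add: sum_distrib_left monom_mult filt_sum)
    also have "\<dots> = (\<Sum>s\<in>keys q. monom t c * monom s (lookup q s) when P t)"
      by (rule sum.cong) (use assms in \<open>auto simp: filt_monom monom_mult\<close>)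
    also have "\<dots> = filt P (monom t c) * q"
      by (subst (3) monom_expand[of q])
        (simp add: filt_monom sum_distrib_left when_def)
    finally show ?thesis .
  qed
  with monom_add show ?case by (simp add: distrib_right filt_add)
qed

lemma monom_polys: "keys t \<subseteq> V \<Longrightarrow> monom t c \<in> polys V"
  by (auto simp: polys_def monom_def dest: subsetD[OF Poly_Mapping.keys_single[THEN equalityD1]]
      split: if_splits)

lemma var_polys: "v \<in> V \<Longrightarrow> var v \<in> polys V"
  by (simp add: var_monom monom_polys)

lemma polys_diff: "p \<in> polys V \<Longrightarrow> q \<in> polys V \<Longrightarrow> p - q \<in> polys V"
  using polys_add[of p V "- q"] by (simp add: polys_uminus)

subsection \<open>Linear extensions\<close>

lemma lin_ext_superset:
  assumes "finite A" "keys u \<subseteq> A"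
  shows "lin_ext f u = (\<Sum>b\<in>A. scal (lookup u b) (f b))"
  unfolding lin_ext_def
  by (rule sum.mono_neutral_left) (use assms in \<open>auto simp: in_keys_iff intro!: poly_mapping_eqI\<close>)

lemma lookup_lin_ext: "lookup (lin_ext f u) c = (\<Sum>b\<in>keys u. lookup u b * lookup (f b) c)"
  by (simp add: lin_ext_def lookup_sum)

lemma lookup_lin_ext_superset:
  assumes "finite A" "keys u \<subseteq> A"
  shows "lookup (lin_ext f u) c = (\<Sum>b\<in>A. lookup u b * lookup (f b) c)"
  by (simp add: lin_ext_superset[OF assms] lookup_sum)

lemma lin_ext_zero [simp]: "lin_ext f 0 = 0"
  by (simp add: lin_ext_def)

lemma lin_ext_add: "lin_ext f (u + v) = lin_ext f u + lin_ext f v"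
proof (rule poly_mapping_eqI)
  fix c
  let ?A = "keys u \<union> keys v"
  show "lookup (lin_ext f (u + v)) c = lookup (lin_ext f u + lin_ext f v) c"
    using Poly_Mapping.keys_add[of u v]
    by (simp add: lookup_lin_ext_superset[of ?A] lookup_add distrib_right sum.distrib)
qed

lemma keys_scal: "keys (scal r u) \<subseteq> keys u"
  by (auto simp: in_keys_iff)

lemma lin_ext_scal: "lin_ext f (scal r u) = scal r (lin_ext f u)"
  by (rule poly_mapping_eqI)
    (simp add: lookup_lin_ext_superset[of "keys u"] keys_scal sum_distrib_left mult.assoc)

lemma lin_ext_uminus: "lin_ext f (- u) = - lin_ext f (u :: nat \<Rightarrow>\<^sub>0 'r::ring)"
  by (rule poly_mapping_eqI) (simp add: lookup_lin_ext sum_negf)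

lemma lin_ext_diff: "lin_ext f (u - v) = lin_ext f u - lin_ext f (v :: nat \<Rightarrow>\<^sub>0 'r::ring)"
  using lin_ext_add[of f u "- v"] by (simp add: lin_ext_uminus)

lemma lin_ext_sum: "lin_ext f (\<Sum>x\<in>A. u x) = (\<Sum>x\<in>A. lin_ext f (u x))"
  by (induction A rule: infinite_finite_induct) (simp_all add: lin_ext_add)

lemma lin_ext_single: "lin_ext f (Poly_Mapping.single b r) = scal r (f b)"
  by (cases "r = 0") (auto simp: lin_ext_def intro!: poly_mapping_eqI)

lemma free_mod_zero: "0 \<in> free_mod V B"
  by (simp add: free_mod_def polys_zero)

lemma free_mod_add: "u \<in> free_mod V B \<Longrightarrow> v \<in> free_mod V B \<Longrightarrow> u + v \<in> free_mod V B"
  unfolding free_mod_def using Poly_Mapping.keys_add[of u v] by (auto simp: lookup_add polys_add)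

lemma free_mod_uminus: "u \<in> free_mod V B \<Longrightarrow> - u \<in> free_mod V B"
  by (simp add: free_mod_def polys_uminus)

lemma free_mod_diff: "u \<in> free_mod V B \<Longrightarrow> v \<in> free_mod V B \<Longrightarrow> u - v \<in> free_mod V B"
  using free_mod_add[of u V B "- v"] by (simp add: free_mod_uminus)

lemma free_mod_scal: "r \<in> polys V \<Longrightarrow> u \<in> free_mod V B \<Longrightarrow> scal r u \<in> free_mod V B"
  unfolding free_mod_def using keys_scal[of r u] by (auto simp: polys_mult)

lemma free_mod_sum: "(\<And>x. x \<in> A \<Longrightarrow> u x \<in> free_mod V B) \<Longrightarrow> (\<Sum>x\<in>A. u x) \<in> free_mod V B"
  by (induction A rule: infinite_finite_induct) (auto simp: free_mod_zero free_mod_add)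

lemma free_mod_single: "b \<in> B \<Longrightarrow> r \<in> polys V \<Longrightarrow> Poly_Mapping.single b r \<in> free_mod V B"
  by (auto simp: free_mod_def lookup_single when_def polys_zero)

subsection \<open>Homogeneous components\<close>

definition hcomp :: "(nat \<Rightarrow> nat) \<Rightarrow> nat \<Rightarrow> (nat \<Rightarrow>\<^sub>0 ('v, 'k::field) mpoly) \<Rightarrow> (nat \<Rightarrow>\<^sub>0 ('v, 'k) mpoly)"
  where "hcomp \<delta> j u = Poly_Mapping.mapp (\<lambda>b p. filt (\<lambda>t. mdeg t + \<delta> b = j) p) u"

lemma lookup_hcomp: "lookup (hcomp \<delta> j u) b = filt (\<lambda>t. mdeg t + \<delta> b = j) (lookup u b)"
  by (cases "lookup u b = 0") (simp_all add: hcomp_def lookup_mapp in_keys_iff)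

lemma hcomp_free_mod: "u \<in> free_mod V B \<Longrightarrow> hcomp \<delta> j u \<in> free_mod V B"
  unfolding free_mod_def hcomp_def
  using keys_mapp_subset[of _ u] by (fastforce simp: lookup_mapp when_def polys_zero filt_polys)

definition homog :: "(nat \<Rightarrow> nat) \<Rightarrow> nat \<Rightarrow> (nat \<Rightarrow>\<^sub>0 ('v, 'k::field) mpoly) \<Rightarrow> bool" where
  "homog \<delta> j u \<longleftrightarrow> (\<forall>b. \<forall>t\<in>keys (lookup u b). mdeg t + \<delta> b = j)"

lemma homog_hcomp: "homog \<delta> j (hcomp \<delta> j u)"
  by (simp add: homog_def lookup_hcomp keys_filt)

lemma filt_id: "(\<And>t. t \<in> keys p \<Longrightarrow> P t) \<Longrightarrow> filt P p = p"
  by (rule poly_mapping_eqI) (auto simp: lookup_filt when_def in_keys_iff)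

lemma hcomp_homog: "homog \<delta> j u \<Longrightarrow> hcomp \<delta> j u = u"
  by (rule poly_mapping_eqI) (auto simp: lookup_hcomp homog_def intro: filt_id)

lemma homog_zero: "homog \<delta> j 0"
  by (simp add: homog_def)

lemma homog_add: "homog \<delta> j u \<Longrightarrow> homog \<delta> j v \<Longrightarrow> homog \<delta> j (u + v)"
  unfolding homog_def lookup_add by (meson Poly_Mapping.keys_add UnE subsetD)

lemma homog_sum: "(\<And>x. x \<in> A \<Longrightarrow> homog \<delta> j (u x)) \<Longrightarrow> homog \<delta> j (\<Sum>x\<in>A. u x)"
  by (induction A rule: infinite_finite_induct) (auto simp: homog_zero homog_add)

lemma homog_scal:
  assumes "homog \<delta> j u" "\<And>t. t \<in> keys r \<Longrightarrow> mdeg t + j = k"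
  shows "homog \<delta> k (scal r u)"
proof -
  have "mdeg t + \<delta> b = k" if t: "t \<in> keys (r * lookup u b)" for t b
  proof -
    obtain x y where "t = x + y" "x \<in> keys r" "y \<in> keys (lookup u b)"
      using t keys_mult[of r "lookup u b"] by blast
    then show ?thesis
      using assms(1) assms(2)[of x] unfolding homog_def by (auto simp: mdeg_add)
  qed
  then show ?thesis by (simp add: homog_def)
qed

text \<open>The second hypothesis says that \<open>f\<close> defines a graded map, since it
  preserves the degree of every basis element. Entry by entry the claim is then
  \<open>filt_mult\<close>.\<close>

lemma hcomp_lin_ext:
  assumes "keys u \<subseteq> B" "\<And>b. b \<in> B \<Longrightarrow> homog \<delta> (\<delta>' b) (f b)"
  shows "hcomp \<delta> j (lin_ext f u) = lin_ext f (hcomp \<delta>' j u)"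
proof (rule poly_mapping_eqI)
  fix c
  have "keys (hcomp \<delta>' j u) \<subseteq> keys u"
    by (auto simp: in_keys_iff lookup_hcomp)
  then have "lookup (lin_ext f (hcomp \<delta>' j u)) c =
      (\<Sum>b\<in>keys u. filt (\<lambda>t. mdeg t + \<delta>' b = j) (lookup u b) * lookup (f b) c)"
    by (simp add: lookup_lin_ext_superset[of "keys u"] lookup_hcomp)
  also have "\<dots> = (\<Sum>b\<in>keys u. filt (\<lambda>t. mdeg t + \<delta> c = j) (lookup u b * lookup (f b) c))"
  proof (intro sum.cong refl filt_mult[symmetric])
    fix b s and t :: "'a \<Rightarrow>\<^sub>0 nat"
    assume "b \<in> keys u" "s \<in> keys (lookup (f b) c)"
    then have "mdeg s + \<delta> c = \<delta>' b"
      using assms unfolding homog_def by blast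
    then show "mdeg t + \<delta>' b = j \<longleftrightarrow> mdeg (t + s) + \<delta> c = j"
      by (auto simp: mdeg_add)
  qed
  finally show "lookup (hcomp \<delta> j (lin_ext f u)) c = lookup (lin_ext f (hcomp \<delta>' j u)) c"
    by (simp add: lookup_hcomp lookup_lin_ext filt_sum)
qed

lemma hcomp_decomp:
  fixes u :: "nat \<Rightarrow>\<^sub>0 ('v, 'k::field) mpoly"
  shows "\<exists>J. finite J \<and> u = (\<Sum>j\<in>J. hcomp \<delta> j u)"
proof (intro exI conjI)
  define J where "J = (\<Union>b\<in>keys u. (\<lambda>t. mdeg t + \<delta> b) ` keys (lookup u b))"
  show fin: "finite J" by (simp add: J_def)
  show "u = (\<Sum>j\<in>J. hcomp \<delta> j u)"
  proof (intro poly_mapping_eqI)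
    fix b t
    have "lookup (lookup (\<Sum>j\<in>J. hcomp \<delta> j u) b) t = (\<Sum>j\<in>J. if j = mdeg t + \<delta> b then lookup (lookup u b) t else 0)"
      unfolding lookup_sum by (intro sum.cong refl) (auto simp: lookup_hcomp lookup_filt when_def)
    also have "\<dots> = lookup (lookup u b) t"
    proof (cases "lookup (lookup u b) t = 0")
      case False
      then have "b \<in> keys u" "t \<in> keys (lookup u b)"
        by (auto simp: in_keys_iff)
      then have "mdeg t + \<delta> b \<in> J" unfolding J_def by blast
      with fin show ?thesis by (simp add: sum.delta)
    qed (simp cong: if_cong)
    finally show "lookup (lookup u b) t = lookup (lookup (\<Sum>j\<in>J. hcomp \<delta> j u) b) t" by simp
  qed
qed

section \<open>Existence of graded free resolutions\<close>

text \<open>\<open>scal\<close> multiplies by polynomials; restricting it to constants gives a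
  vector space over the field, which makes bases, spans and extension of linear maps
  available.\<close>

definition kscal :: "'k \<Rightarrow> (nat \<Rightarrow>\<^sub>0 ('v, 'k::field) mpoly) \<Rightarrow> (nat \<Rightarrow>\<^sub>0 ('v, 'k) mpoly)" where
  "kscal c u = scal (monom 0 c) u"

lemma lookup_kscal: "lookup (kscal c u) b = monom 0 c * lookup u b"
  by (simp add: kscal_def)

interpretation kscal: vector_space "kscal :: 'k::field \<Rightarrow> (nat \<Rightarrow>\<^sub>0 ('v, 'k) mpoly) \<Rightarrow> _"
proof
  fix a b :: 'k and x y :: "nat \<Rightarrow>\<^sub>0 ('v, 'k) mpoly"
  show "kscal a (x + y) = kscal a x + kscal a y"
    by (rule poly_mapping_eqI) (simp add: lookup_kscal lookup_add distrib_left)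
  show "kscal (a + b) x = kscal a x + kscal b x"
    by (rule poly_mapping_eqI) (simp add: lookup_kscal lookup_add monom_add distrib_right)
  show "kscal a (kscal b x) = kscal (a * b) x"
    by (rule poly_mapping_eqI) (simp add: lookup_kscal monom_mult mult.assoc[symmetric])
  show "kscal 1 x = x"
    by (rule poly_mapping_eqI) (simp add: lookup_kscal monom_one)
qed

text \<open>Adding \<open>z\<close> to a basis of \<open>U\<close> keeps it independent, so a linear
  map can be prescribed as 0 on the basis and 1 at \<open>z\<close>. In
  \<open>vanishing_imp_boundary\<close> it supplies the family that detects a nonzero class of
  \<open>Tor\<close>.\<close>

lemma separating_functional:
  fixes U :: "(nat \<Rightarrow>\<^sub>0 ('v, 'k::field) mpoly) set"
  assumes "kscal.subspace U" "z \<notin> U"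
  obtains h where "\<And>u v. h (u + v) = h u + h v" "\<And>c u. h (kscal c u) = c * (h u :: 'k)"
    "\<And>u. u \<in> U \<Longrightarrow> h u = 0" "h z = 1"
proof -
  interpret P: vector_space_pair kscal "(*) :: 'k \<Rightarrow> 'k \<Rightarrow> 'k"
    by (intro vector_space_pair.intro kscal.vector_space_axioms vector_space.intro)
      (simp_all add: algebra_simps)
  obtain B where B: "B \<subseteq> U" "kscal.independent B" "U \<subseteq> kscal.span B"
    using kscal.maximal_independent_subset[of U] by blast
  have span: "kscal.span B = U"
    using B assms(1) by (simp add: kscal.span_subspace)
  then have "kscal.independent (insert z B)"
    using assms(2) B(2) by (simp add: kscal.independent_insertI)
  from P.linear_independent_extend[OF this, of "\<lambda>x. if x = z then 1 else 0"]
  obtain h where h: "Vector_Spaces.linear kscal (*) h" "\<forall>x\<in>insert z B. h x = (if x = z then 1 else 0)"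
    by blast
  show thesis
  proof
    show "h (u + v) = h u + h v" for u v using h(1) by (rule P.linear_add)
    show "h (kscal c u) = c * h u" for c u using h(1) by (rule P.linear_scale)
    show "h z = 1" using h(2) by simp
    have "h x = 0" if "x \<in> B" for x
      using that h(2) B(1) assms(2) by auto
    then show "h u = 0" if "u \<in> U" for u
      using P.linear_eq_0_on_span[OF h(1), of B u] that span by blast
  qed
qed

lemma finite_monomials:
  assumes "finite V"
  shows "finite {t :: 'v \<Rightarrow>\<^sub>0 nat. keys t \<subseteq> V \<and> mdeg t \<le> j}"
proof (rule inj_on_finite)
  show "inj_on lookup {t :: 'v \<Rightarrow>\<^sub>0 nat. keys t \<subseteq> V \<and> mdeg t \<le> j}"
    by (rule inj_onI) (simp only: lookup_inject)
  have "lookup t v \<le> mdeg t" for t :: "'v \<Rightarrow>\<^sub>0 nat" and v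
  proof (cases "v \<in> keys t")
    case True
    then show ?thesis unfolding mdeg_def by (intro member_le_sum) simp_all
  qed (simp add: in_keys_iff)
  then have le: "lookup t v \<le> j" if "mdeg t \<le> j" for t :: "'v \<Rightarrow>\<^sub>0 nat" and v
    using that le_trans by blast
  show "lookup ` {t :: 'v \<Rightarrow>\<^sub>0 nat. keys t \<subseteq> V \<and> mdeg t \<le> j}
      \<subseteq> {f. \<forall>v. (v \<in> V \<longrightarrow> f v \<in> {..j}) \<and> (v \<notin> V \<longrightarrow> f v = 0)}"
    by (auto simp: le in_keys_iff)
  show "finite {f :: 'v \<Rightarrow> nat. \<forall>v. (v \<in> V \<longrightarrow> f v \<in> {..j}) \<and> (v \<notin> V \<longrightarrow> f v = 0)}"
    using assms by (rule finite_set_of_finite_funs) simp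
qed

text \<open>An element of degree \<open>j\<close> involves only basis elements of degree at most
  \<open>j\<close> and monomials of degree at most \<open>j\<close>, finitely many of each. So
  graded components are finite-dimensional without any Noetherian argument.\<close>

lemma homog_span:
  fixes V :: "'v set"
  assumes "finite V" "\<And>j. finite {b\<in>B. \<delta> b = j}"
  obtains E :: "(nat \<Rightarrow>\<^sub>0 ('v, 'k::field) mpoly) set"
  where "finite E" "{u\<in>free_mod V B. homog \<delta> j u} \<subseteq> kscal.span E"
proof
  let ?e = "\<lambda>(b, t). Poly_Mapping.single b (monom t 1) :: nat \<Rightarrow>\<^sub>0 ('v, 'k::field) mpoly"
  define E where "E = ?e ` ((\<Union>i\<le>j. {b\<in>B. \<delta> b = i}) \<times> {t. keys t \<subseteq> V \<and> mdeg t \<le> j})"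
  show "finite E"
    unfolding E_def using assms by (intro finite_imageI finite_cartesian_product finite_UN_I finite_monomials) auto
  show "{u\<in>free_mod V B. homog \<delta> j u} \<subseteq> kscal.span E"
  proof clarify
    fix u :: "nat \<Rightarrow>\<^sub>0 ('v, 'k) mpoly"
    assume u: "u \<in> free_mod V B" "homog \<delta> j u"
    have single_sum: "Poly_Mapping.single b (\<Sum>x\<in>A. g x) = (\<Sum>x\<in>A. Poly_Mapping.single b (g x))"
      for b :: nat and A and g :: "('v \<Rightarrow>\<^sub>0 nat) \<Rightarrow> ('v, 'k) mpoly"
      by (induction A rule: infinite_finite_induct) (simp_all add: single_add)
    have single_monom: "Poly_Mapping.single b (monom t c) = kscal c (?e (b, t))" for b t c
      by (rule poly_mapping_eqI) (simp add: lookup_kscal lookup_single when_def monom_mult)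
    have "u = (\<Sum>b\<in>keys u. Poly_Mapping.single b (\<Sum>t\<in>keys (lookup u b). monom t (lookup (lookup u b) t)))"
      by (simp only: monom_expand[symmetric] single_expand[symmetric])
    also have "\<dots> = (\<Sum>b\<in>keys u. \<Sum>t\<in>keys (lookup u b). kscal (lookup (lookup u b) t) (?e (b, t)))"
      by (intro sum.cong refl, subst single_sum) (intro sum.cong refl single_monom)
    also have "\<dots> \<in> kscal.span E"
    proof (intro kscal.span_sum kscal.span_scale kscal.span_base)
      fix b t
      assume "b \<in> keys u" "t \<in> keys (lookup u b)"
      with u have "b \<in> B" "keys t \<subseteq> V" "mdeg t + \<delta> b = j"
        by (auto simp: free_mod_def polys_def homog_def)
      then show "?e (b, t) \<in> E"
        unfolding E_def by (intro imageI) auto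
    qed
    finally show "u \<in> kscal.span E" .
  qed
qed

definition graded_submodule ::
  "'v set \<Rightarrow> nat set \<Rightarrow> (nat \<Rightarrow> nat) \<Rightarrow> (nat \<Rightarrow>\<^sub>0 ('v, 'k::field) mpoly) set \<Rightarrow> bool" where
  "graded_submodule V B \<delta> Z \<longleftrightarrow>
     Z \<subseteq> free_mod V B \<and> 0 \<in> Z \<and> (\<forall>u\<in>Z. \<forall>v\<in>Z. u + v \<in> Z) \<and>
     (\<forall>r\<in>polys V. \<forall>u\<in>Z. scal r u \<in> Z) \<and> (\<forall>u\<in>Z. \<forall>j. hcomp \<delta> j u \<in> Z)"

lemma graded_submodule_kernel:
  assumes "\<And>b. b \<in> B \<Longrightarrow> homog \<delta>' (\<delta> b) (f b)"
  shows "graded_submodule V B \<delta> {u\<in>free_mod V B. lin_ext f u = 0}"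
  unfolding graded_submodule_def
proof (intro conjI ballI allI)
  fix u and j
  assume u: "u \<in> {u\<in>free_mod V B. lin_ext f u = 0}"
  then have "lin_ext f (hcomp \<delta> j u) = hcomp \<delta>' j (lin_ext f u)"
    by (intro hcomp_lin_ext[symmetric, of u B]) (auto simp: free_mod_def assms)
  also have "\<dots> = 0"
    using u by (simp add: hcomp_homog homog_zero)
  finally show "hcomp \<delta> j u \<in> {u\<in>free_mod V B. lin_ext f u = 0}"
    using u by (simp add: hcomp_free_mod)
qed (auto simp: free_mod_zero free_mod_add free_mod_scal lin_ext_add lin_ext_scal intro!: poly_mapping_eqI)

text \<open>The generators are a \<open>K\<close>-basis of every graded component of
  \<open>Z\<close>. This is far from minimal and usually infinite, but finite in each degree, as a
  graded resolution is required to be.\<close>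

lemma graded_generators:
  fixes Z :: "(nat \<Rightarrow>\<^sub>0 ('v, 'k::field) mpoly) set"
  assumes "finite V" "\<And>j. finite {b\<in>B. \<delta> b = j}" "graded_submodule V B \<delta> Z"
  obtains B' \<delta>' f where "\<And>j. finite {b\<in>B'. \<delta>' b = j}"
    "\<And>b. b \<in> B' \<Longrightarrow> f b \<in> Z \<and> homog \<delta> (\<delta>' b) (f b)" "lin_ext f ` free_mod V B' = Z"
proof -
  have "\<exists>G. finite G \<and> G \<subseteq> {u\<in>Z. homog \<delta> j u} \<and> {u\<in>Z. homog \<delta> j u} \<subseteq> kscal.span G" for j
  proof -
    let ?Z = "{u\<in>Z. homog \<delta> j u}"
    obtain E :: "(nat \<Rightarrow>\<^sub>0 ('v, 'k::field) mpoly) set"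
      where E: "finite E" "{u\<in>free_mod V B. homog \<delta> j u} \<subseteq> kscal.span E"
      using homog_span[of V B \<delta> j] assms(1,2) by blast
    obtain G where G: "G \<subseteq> ?Z" "kscal.independent G" "?Z \<subseteq> kscal.span G"
      using kscal.maximal_independent_subset[of ?Z] by blast
    have "Z \<subseteq> free_mod V B"
      using assms(3) by (simp add: graded_submodule_def)
    then have "G \<subseteq> kscal.span E"
      using G(1) E(2) by blast
    then have "finite G"
      using kscal.independent_span_bound[OF E(1) G(2)] by simp
    with G show ?thesis by blast
  qed
  then have "\<exists>G. \<forall>j. finite (G j) \<and> G j \<subseteq> {u\<in>Z. homog \<delta> j u} \<and>
      {u\<in>Z. homog \<delta> j u} \<subseteq> kscal.span (G j)"
    by (intro choice allI)
  then obtain G where G: "\<And>j. finite (G j)" "\<And>j. G j \<subseteq> {u\<in>Z. homog \<delta> j u}"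
    "\<And>j. {u\<in>Z. homog \<delta> j u} \<subseteq> kscal.span (G j)"
    by blast
  have "\<exists>g. bij_betw g {0..<card (G j)} (G j)" for j
    using G(1) by (rule ex_bij_betw_nat_finite)
  then have "\<exists>g. \<forall>j. bij_betw (g j) {0..<card (G j)} (G j)"
    by (intro choice allI)
  then obtain g where g: "\<And>j. bij_betw (g j) {0..<card (G j)} (G j)"
    by blast
  \<comment> \<open>\<open>prod_encode (j, k)\<close> names the \<open>k\<close>-th basis vector of
    degree \<open>j\<close>, so the generators of all degrees are indexed by one set of naturals and
    degrees are read off from the names.\<close>
  define \<delta>' :: "nat \<Rightarrow> nat" where "\<delta>' = (\<lambda>b. fst (prod_decode b))"
  define f where "f = (\<lambda>b. g (\<delta>' b) (snd (prod_decode b)))"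
  define B' where "B' = {b. snd (prod_decode b) < card (G (\<delta>' b))}"
  have fin: "finite {b\<in>B'. \<delta>' b = j}" for j
  proof (rule finite_subset)
    show "{b\<in>B'. \<delta>' b = j} \<subseteq> (\<lambda>k. prod_encode (j, k)) ` {..<card (G j)}"
    proof
      fix b
      assume "b \<in> {b\<in>B'. \<delta>' b = j}"
      then have "b = prod_encode (j, snd (prod_decode b))" "snd (prod_decode b) < card (G j)"
        by (auto simp: B'_def \<delta>'_def)
      then show "b \<in> (\<lambda>k. prod_encode (j, k)) ` {..<card (G j)}"
        by blast
    qed
  qed simp
  have fG: "f b \<in> G (\<delta>' b)" if "b \<in> B'" for b
    using that g[of "\<delta>' b"] unfolding f_def B'_def by (auto simp: bij_betw_def)
  then have f: "f b \<in> Z \<and> homog \<delta> (\<delta>' b) (f b)" if "b \<in> B'" for b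
    using that G(2) by blast
  have add: "u + v \<in> Z" and smult: "r \<in> polys V \<Longrightarrow> scal r u \<in> Z" and hc: "hcomp \<delta> j u \<in> Z" and zero: "0 \<in> Z"
    if "u \<in> Z" "v \<in> Z" for u v r j
    using assms(3) that by (auto simp: graded_submodule_def)
  have "lin_ext f ` free_mod V B' = Z"
  proof (intro equalityI subsetI; (elim imageE)?)
    fix u w
    assume u: "u = lin_ext f w" "w \<in> free_mod V B'"
    have "(\<Sum>b\<in>A. scal (lookup w b) (f b)) \<in> Z" if "finite A" "A \<subseteq> B'" for A
      using that by (induction A rule: finite_induct)
        (use assms(3) u(2) in \<open>auto intro!: add smult simp: f free_mod_def graded_submodule_def\<close>)
    from this[of "keys w"] show "u \<in> Z"
      using u unfolding lin_ext_def by (auto simp: free_mod_def)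
  next
    fix u
    assume u: "u \<in> Z"
    let ?M = "lin_ext f ` free_mod V B'"
    have sub: "kscal.subspace ?M"
    proof (rule kscal.subspaceI)
      show "0 \<in> ?M"
        by (rule image_eqI[of _ _ 0]) (simp_all add: free_mod_zero)
      show "x + y \<in> ?M" if "x \<in> ?M" "y \<in> ?M" for x y
        using that by (auto simp: lin_ext_add[symmetric] intro!: imageI free_mod_add)
      show "kscal c x \<in> ?M" if "x \<in> ?M" for c x
        using that by (auto simp: kscal_def lin_ext_scal[symmetric] intro!: imageI free_mod_scal monom_polys)
    qed
    have "G j \<subseteq> ?M" for j
    proof
      fix x assume "x \<in> G j"
      then obtain k where k: "k < card (G j)" "x = g j k"
        by (metis g bij_betw_imp_surj_on atLeastLessThan_iff imageE)
      then have "prod_encode (j, k) \<in> B'" "f (prod_encode (j, k)) = x"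
        by (simp_all add: B'_def f_def \<delta>'_def)
      moreover have "lin_ext f (Poly_Mapping.single b 1) = f b" for b
        by (simp add: lin_ext_single) (rule poly_mapping_eqI, simp)
      ultimately show "x \<in> ?M"
        by (intro image_eqI[of _ _ "Poly_Mapping.single (prod_encode (j, k)) 1"])
          (simp_all add: free_mod_single polys_one)
    qed
    then have span: "kscal.span (G j) \<subseteq> ?M" for j
      using sub by (simp add: kscal.span_minimal)
    obtain J where "finite J" "u = (\<Sum>j\<in>J. hcomp \<delta> j u)"
      using hcomp_decomp by blast
    moreover have "hcomp \<delta> j u \<in> ?M" for j
      using hc[OF u u] homog_hcomp[of \<delta> j u] G(3)[of j] span[of j] by blast
    then have "(\<Sum>j\<in>J. hcomp \<delta> j u) \<in> ?M"
      by (intro kscal.subspace_sum[OF sub])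
    ultimately show "u \<in> ?M" by simp
  qed
  with fin f show thesis by (rule that)
qed

definition homogeneous_ideal :: "'v set \<Rightarrow> ('v, 'k::field) mpoly set \<Rightarrow> bool" where
  "homogeneous_ideal V I \<longleftrightarrow>
     I \<subseteq> polys V \<and> 0 \<in> I \<and> (\<forall>p\<in>I. \<forall>q\<in>I. p + q \<in> I) \<and>
     (\<forall>r\<in>polys V. \<forall>p\<in>I. r * p \<in> I) \<and> (\<forall>p\<in>I. \<forall>d. filt (\<lambda>t. mdeg t = d) p \<in> I)"

lemma aug_map_lin_ext:
  assumes "\<And>b. b \<in> keys u \<Longrightarrow> aug F b = lookup (f b) 0"
  shows "aug_map F u = lookup (lin_ext f u) 0"
  by (simp add: aug_map_def lookup_lin_ext assms)

text \<open>The kernel of a graded map is a graded submodule, so \<open>graded_generators\<close>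
  applies to it again; dependent choice carries out the infinite iteration.\<close>

theorem graded_free_resolution_exists:
  fixes I :: "('v, 'k::field) mpoly set"
  assumes V: "finite V" and I: "homogeneous_ideal V I"
  shows "\<exists>F. graded_free_resolution V I F"
proof -
  let ?ker = "\<lambda>(B, \<delta>, f). {u\<in>free_mod V B. lin_ext f u = (0 :: nat \<Rightarrow>\<^sub>0 ('v, 'k) mpoly)}"
  let ?fin = "\<lambda>(B :: nat set, \<delta> :: nat \<Rightarrow> nat, f :: nat \<Rightarrow> nat \<Rightarrow>\<^sub>0 ('v, 'k) mpoly). \<forall>j. finite {b\<in>B. \<delta> b = j}"
  \<comment> \<open>The ideal as a submodule of the free module on one basis element 0 of degree 0,
    so that its generators come from the same lemma as the syzygies.\<close>
  define I0 where "I0 = {u\<in>free_mod V {0}. lookup u 0 \<in> I}"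
  \<comment> \<open>A stage is a triple of basis, degrees and images of the basis elements.
    \<open>P\<close> ensures that its kernel can be covered by a next stage, \<open>Q\<close> says
    that the next stage does cover it; stage 0 covers \<open>I0\<close>.\<close>
  define P where "P i x \<longleftrightarrow> ?fin x \<and> graded_submodule V (fst x) (fst (snd x)) (?ker x) \<and>
      (i = (0::nat) \<longrightarrow> (\<forall>b\<in>fst x. snd (snd x) b \<in> I0 \<and> homog (\<lambda>_. 0) (fst (snd x) b) (snd (snd x) b)) \<and>
         lin_ext (snd (snd x)) ` free_mod V (fst x) = I0)" for i x
  define Q where "Q i x y \<longleftrightarrow>
      (\<forall>b\<in>fst y. snd (snd y) b \<in> ?ker x \<and> homog (fst (snd x)) (fst (snd y) b) (snd (snd y) b)) \<and>
      lin_ext (snd (snd y)) ` free_mod V (fst y) = ?ker x" for i :: nat and x y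
  have gs: "graded_submodule V {0} (\<lambda>_. 0) I0"
    using I unfolding graded_submodule_def I0_def homogeneous_ideal_def
    by (auto simp: free_mod_zero free_mod_add free_mod_scal hcomp_free_mod lookup_add lookup_hcomp)
  obtain B \<delta> f where "\<And>j. finite {b\<in>B. \<delta> b = j}"
    "\<And>b. b \<in> B \<Longrightarrow> f b \<in> I0 \<and> homog (\<lambda>_. 0) (\<delta> b) (f b)" "lin_ext f ` free_mod V B = I0"
    by (rule graded_generators[OF V _ gs], simp, rule that)
  then have "P 0 (B, \<delta>, f)"
    unfolding P_def by (auto intro!: graded_submodule_kernel)
  then have base: "\<exists>x. P 0 x" ..
  have step: "\<exists>y. P (Suc i) y \<and> Q i x y" if "P i x" for i x
  proof -
    obtain C \<epsilon> g where x: "x = (C, \<epsilon>, g)" by (cases x)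
    then have *: "graded_submodule V C \<epsilon> (?ker x)" "\<And>j. finite {b\<in>C. \<epsilon> b = j}"
      using that by (auto simp: P_def)
    obtain B \<delta> f where "\<And>j. finite {b\<in>B. \<delta> b = j}"
      "\<And>b. b \<in> B \<Longrightarrow> f b \<in> ?ker x \<and> homog \<epsilon> (\<delta> b) (f b)" "lin_ext f ` free_mod V B = ?ker x"
      by (rule graded_generators[OF V *(2) *(1)]) (rule that)
    then have "P (Suc i) (B, \<delta>, f) \<and> Q i x (B, \<delta>, f)"
      unfolding P_def Q_def by (auto simp: x intro!: graded_submodule_kernel)
    then show ?thesis ..
  qed
  obtain X where X: "\<And>i. P i (X i)" "\<And>i. Q i (X i) (X (Suc i))"
    using dependent_nat_choice[of P Q, OF base step] by blast
  define F where "F = \<lparr>basis = (\<lambda>i. fst (X i)), bdeg = (\<lambda>i. fst (snd (X i))),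
     aug = (\<lambda>b. lookup (snd (snd (X 0)) b) 0), bdry = (\<lambda>i. snd (snd (X (Suc i))))\<rparr>"
  have F: "basis F i = fst (X i)" "bdeg F i = fst (snd (X i))"
    "aug F b = lookup (snd (snd (X 0)) b) 0" "bdry F i = snd (snd (X (Suc i)))" for i b
    by (simp_all add: F_def)
  have aug: "aug_map F u = lookup (lin_ext (snd (snd (X 0))) u) 0" for u
    by (rule aug_map_lin_ext) (simp add: F)
  have ker: "?ker (X i) = {u\<in>free_mod V (basis F i). lin_ext (snd (snd (X i))) u = 0}" for i
    by (simp add: F case_prod_beta)
  have P: "finite {b\<in>basis F i. bdeg F i b = j}" for i j
    using X(1)[of i] by (simp add: P_def F case_prod_beta)
  have P0: "snd (snd (X 0)) b \<in> I0" "homog (\<lambda>_. 0) (bdeg F 0 b) (snd (snd (X 0)) b)" if "b \<in> basis F 0" for b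
    using X(1)[of 0] that by (simp_all add: P_def F)
  have P0': "lin_ext (snd (snd (X 0))) ` free_mod V (basis F 0) = I0"
    using X(1)[of 0] by (simp add: P_def F)
  have Q: "bdry F i b \<in> ?ker (X i)" "homog (bdeg F i) (bdeg F (Suc i) b) (bdry F i b)"
    if "b \<in> basis F (Suc i)" for i b
    using X(2)[of i] that by (auto simp: Q_def F)
  have Q': "lin_ext (bdry F i) ` free_mod V (basis F (Suc i)) = ?ker (X i)" for i
    using X(2)[of i] by (simp add: Q_def F)
  have I0_eq: "(\<lambda>u. lookup u 0) ` I0 = I"
  proof (intro equalityI subsetI)
    fix p assume "p \<in> I"
    then have "Poly_Mapping.single 0 p \<in> I0"
      using I by (auto simp: I0_def homogeneous_ideal_def intro!: free_mod_single)
    then show "p \<in> (\<lambda>u. lookup u 0) ` I0"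
      by (intro image_eqI[of _ _ "Poly_Mapping.single 0 p"]) simp_all
  qed (auto simp: I0_def)
  have aug_image: "aug_map F ` free_mod V (basis F 0) = I"
    using arg_cong[OF P0', of "(`) (\<lambda>u. lookup u 0)"] by (simp add: aug image_image I0_eq)
  \<comment> \<open>The image lies in \<open>I0\<close>, where every coordinate except 0 vanishes,
    so it is zero as soon as its coordinate \<open>aug_map F u\<close> is.\<close>
  have aug_ker: "aug_map F u = 0 \<longleftrightarrow> lin_ext (snd (snd (X 0))) u = 0" if "u \<in> free_mod V (basis F 0)" for u
  proof -
    let ?w = "lin_ext (snd (snd (X 0))) u"
    have "?w \<in> I0" using P0' that by blast
    then have "k \<notin> keys ?w" if "k \<noteq> 0" for k using that by (auto simp: I0_def free_mod_def)
    then have "lookup ?w k = 0" if "lookup ?w 0 = 0" for k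
      using that by (cases "k = 0") (simp_all add: in_keys_iff)
    then show ?thesis
      unfolding aug by (auto intro: poly_mapping_eqI[of ?w 0])
  qed
  have "graded_free_resolution V I F"
    unfolding graded_free_resolution_def
  proof (intro conjI allI ballI)
    show "finite {b\<in>basis F i. bdeg F i b = j}" for i j by (rule P)
    show "aug_map F ` free_mod V (basis F 0) = I" by (rule aug_image)
    show "lin_ext (bdry F 0) ` free_mod V (basis F 1) = {u\<in>free_mod V (basis F 0). aug_map F u = 0}"
      using Q'[of 0] aug_ker by (auto simp: ker)
    show "lin_ext (bdry F (Suc i)) ` free_mod V (basis F (Suc (Suc i))) =
       {u\<in>free_mod V (basis F (Suc i)). lin_ext (bdry F i) u = 0}" for i
      using Q'[of "Suc i"] by (simp add: ker F)
    show "aug F b \<in> I" if "b \<in> basis F 0" for b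
      using P0(1)[OF that] by (simp add: F I0_def)
    show "mdeg t = bdeg F 0 b" if "b \<in> basis F 0" "t \<in> keys (aug F b)" for b t
      using P0(2)[OF that(1)] that(2) by (simp add: F homog_def)
    show "bdry F i b \<in> free_mod V (basis F i)" if "b \<in> basis F (Suc i)" for i b
      using Q(1)[OF that] by (simp add: ker)
    show "mdeg t + bdeg F i c = bdeg F (Suc i) b"
      if "b \<in> basis F (Suc i)" "t \<in> keys (lookup (bdry F i b) c)" for i b c t
      using Q(2)[OF that(1)] that(2) by (simp add: homog_def)
  qed
  then show ?thesis ..
qed

section \<open>A criterion for the vanishing of the first graded Betti numbers\<close>

declare One_nat_def [simp del]

text \<open>Exponents do not cancel, so only constant terms contribute to the constant term of a
  product. Hence reduction modulo the variables commutes with the differentials, see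
  \<open>const_part_lin_ext\<close>.\<close>

lemma lookup_mult_0: "lookup (p * q) 0 = lookup p 0 * lookup (q :: ('v, 'k::field) mpoly) 0"
proof (induction p rule: mpoly_induct)
  case (monom_add p t c)
  have sum_0: "t + s = 0 \<longleftrightarrow> t = 0 \<and> s = 0" for s
    by (metis add_eq_0_iff_both_eq_0 mdeg_add mdeg_eq_0_iff)
  then have "lookup (monom t c * q) 0 = c * ev (\<lambda>s. if t = 0 \<and> s = 0 then 1 else 0) q"
    by (simp only: lookup_ev[of "monom t c * q"] ev_monom_mult sum_0)
  also have "\<dots> = lookup (monom t c) 0 * lookup q 0"
  proof (cases "t = 0")
    case True
    then show ?thesis by (simp add: lookup_ev[of q 0] lookup_monom)
  next
    case False
    then show ?thesis by (simp add: lookup_monom ev_def)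
  qed
  finally show ?case
    using monom_add by (simp add: distrib_right lookup_add)
qed simp

definition const_part :: "(nat \<Rightarrow>\<^sub>0 ('v, 'k::field) mpoly) \<Rightarrow> (nat \<Rightarrow>\<^sub>0 'k)" where
  "const_part u = Poly_Mapping.map (\<lambda>p. lookup p 0) u"

text \<open>A \<open>K\<close>-linear section of \<open>const_part\<close>, used to lift chains of
  the tensored complex to the resolution.\<close>

definition const_emb :: "(nat \<Rightarrow>\<^sub>0 'k) \<Rightarrow> (nat \<Rightarrow>\<^sub>0 ('v, 'k::field) mpoly)" where
  "const_emb v = Poly_Mapping.map (monom 0) v"

lemma lookup_const_part: "lookup (const_part u) b = lookup (lookup u b) 0"
  by (simp add: const_part_def Poly_Mapping.map.rep_eq when_def)

lemma lookup_const_emb: "lookup (const_emb v) b = monom 0 (lookup v b)"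
  by (simp add: const_emb_def Poly_Mapping.map.rep_eq when_def)

lemma keys_const_emb: "keys (const_emb v) \<subseteq> keys v"
  by (auto simp: in_keys_iff lookup_const_emb)

lemma const_part_emb: "const_part (const_emb v) = v"
  by (rule poly_mapping_eqI) (simp add: lookup_const_part lookup_const_emb lookup_monom)

lemma const_emb_free_mod: "keys v \<subseteq> B \<Longrightarrow> const_emb v \<in> free_mod V B"
  using keys_const_emb[of v] by (auto simp: free_mod_def lookup_const_emb monom_polys)

lemma const_part_add: "const_part (u + v) = const_part u + const_part v"
  by (rule poly_mapping_eqI) (simp add: lookup_const_part lookup_add)

lemma const_part_diff: "const_part (u - v) = const_part u - const_part v"
  by (rule poly_mapping_eqI) (simp add: lookup_const_part lookup_minus)

lemma const_part_zero [simp]: "const_part 0 = 0"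
  by (rule poly_mapping_eqI) (simp add: lookup_const_part)

lemma const_part_sum: "const_part (\<Sum>x\<in>A. u x) = (\<Sum>x\<in>A. const_part (u x))"
  by (induction A rule: infinite_finite_induct) (simp_all add: const_part_add)

lemma scal_zero: "scal r 0 = 0"
  by (rule poly_mapping_eqI) simp

lemma const_part_scal_var: "const_part (scal (var v) u) = 0"
proof -
  have "Poly_Mapping.single v (1::nat) \<noteq> 0"
    by (metis lookup_single_eq lookup_zero one_neq_zero)
  then show ?thesis
    by (intro poly_mapping_eqI) (simp add: lookup_const_part lookup_mult_0 var_monom lookup_monom)
qed

lemma keys_const_part: "keys (const_part u) \<subseteq> keys u"
  by (auto simp: in_keys_iff lookup_const_part)

lemma const_part_lin_ext:
  "const_part (lin_ext f u) = lin_ext (\<lambda>b. const_part (f b)) (const_part u)"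
proof (rule poly_mapping_eqI)
  fix c
  show "lookup (const_part (lin_ext f u)) c = lookup (lin_ext (\<lambda>b. const_part (f b)) (const_part u)) c"
    by (simp add: lookup_lin_ext_superset[of "keys u"] keys_const_part lookup_const_part lookup_sum lookup_mult_0)
qed

lemma tensor_bdry_const: "tensor_bdry F i v = lin_ext (\<lambda>b. const_part (bdry F i b)) v"
  by (simp add: tensor_bdry_def const_part_def)

lemma tensor_bdry_const_part:
  "tensor_bdry F i (const_part u) = const_part (lin_ext (bdry F i) u)"
  by (simp add: tensor_bdry_const const_part_lin_ext)

subsection \<open>Extracting variables\<close>

text \<open>Every nonconstant monomial is charged to one chosen variable dividing it. Charging it
  only once is what makes the sum in \<open>var_quot_decomp\<close> reproduce
  \<open>p\<close>.\<close>

definition var_quot :: "'v \<Rightarrow> ('v, 'k::field) mpoly \<Rightarrow> ('v, 'k) mpoly" where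
  "var_quot v p = (\<Sum>t\<in>{t\<in>keys p. t \<noteq> 0 \<and> (SOME w. w \<in> keys t) = v}.
     monom (t - Poly_Mapping.single v 1) (lookup p t))"

lemma some_key: "t \<noteq> 0 \<Longrightarrow> (SOME w. w \<in> keys t) \<in> keys (t :: 'v \<Rightarrow>\<^sub>0 nat)"
  by (rule someI_ex) (metis all_not_in_conv keys_eq_empty)

lemma minus_single_add:
  "v \<in> keys t \<Longrightarrow> t - Poly_Mapping.single v 1 + Poly_Mapping.single v 1 = (t :: 'v \<Rightarrow>\<^sub>0 nat)"
  by (rule poly_mapping_eqI) (auto simp: lookup_add lookup_minus lookup_single when_def in_keys_iff)

lemma single_add_minus:
  "v \<in> keys t \<Longrightarrow> Poly_Mapping.single v 1 + (t - Poly_Mapping.single v 1) = (t :: 'v \<Rightarrow>\<^sub>0 nat)"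
  using minus_single_add by (simp only: add.commute)

lemma keys_sum_monom: "keys (\<Sum>x\<in>A. monom (g x) (c x)) \<subseteq> g ` A"
  by (rule order_trans[OF Poly_Mapping.keys_sum]) (auto simp: monom_def)

lemma keys_var_quot:
  assumes "s \<in> keys (var_quot v p)"
  shows "s + Poly_Mapping.single v 1 \<in> keys p"
proof -
  obtain t where t: "t \<in> keys p" "t \<noteq> 0" "(SOME w. w \<in> keys t) = v" "s = t - Poly_Mapping.single v 1"
    using assms subsetD[OF keys_sum_monom] unfolding var_quot_def by fastforce
  then show ?thesis
    using some_key[OF t(2)] by (simp add: minus_single_add)
qed

lemma var_quot_zero [simp]: "var_quot v 0 = 0"
  by (simp add: var_quot_def)

lemma var_quot_polys: "p \<in> polys V \<Longrightarrow> var_quot v p \<in> polys V"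
  unfolding polys_def using keys_var_quot by (fastforce simp: keys_add_nat)

lemma var_quot_decomp:
  fixes p :: "('v, 'k::field) mpoly"
  assumes "finite V" "p \<in> polys V" "lookup p 0 = 0"
  shows "p = (\<Sum>v\<in>V. var v * var_quot v p)"
proof -
  let ?S = "\<lambda>v. {t\<in>keys p. t \<noteq> 0 \<and> (SOME w. w \<in> keys t) = v}"
  have nz: "t \<noteq> 0" if "t \<in> keys p" for t
    using that assms(3) by (metis in_keys_iff)
  have "var v * var_quot v p = (\<Sum>t\<in>?S v. monom t (lookup p t))" for v
    unfolding var_quot_def sum_distrib_left
  proof (intro sum.cong refl)
    fix t assume "t \<in> ?S v"
    then have "v \<in> keys t" using some_key by blast
    then show "var v * monom (t - Poly_Mapping.single v 1) (lookup p t) = monom t (lookup p t)"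
      by (simp add: var_monom monom_mult single_add_minus)
  qed
  then have "(\<Sum>v\<in>V. var v * var_quot v p) = (\<Sum>v\<in>V. \<Sum>t\<in>?S v. monom t (lookup p t))"
    by simp
  also have "\<dots> = (\<Sum>t\<in>(\<Union>v\<in>V. ?S v). monom t (lookup p t))"
    using assms(1) by (intro sum.UNION_disjoint[symmetric]) auto
  also have "(\<Union>v\<in>V. ?S v) = keys p"
    using assms(2) nz some_key by (fastforce simp: polys_def)
  finally show ?thesis
    using monom_expand[of p] by simp
qed

text \<open>Zero constant part means that \<open>u\<close> lies in the ideal of the variables times
  the free module. Division by a variable lowers all degrees by one, so the pieces stay
  homogeneous.\<close>

lemma free_mod_var_decomp:
  fixes u :: "nat \<Rightarrow>\<^sub>0 ('v, 'k::field) mpoly"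
  assumes "finite V" "u \<in> free_mod V B" "const_part u = 0"
  obtains q where "\<And>v. q v \<in> free_mod V B" "u = (\<Sum>v\<in>V. scal (var v) (q v))"
    "\<And>\<delta> j v. homog \<delta> (Suc j) u \<Longrightarrow> homog \<delta> j (q v)"
proof
  define q where "q v = Poly_Mapping.mapp (\<lambda>_. var_quot v) u" for v
  have q: "lookup (q v) b = var_quot v (lookup u b)" for v b
    by (cases "lookup u b = 0") (simp_all add: q_def lookup_mapp in_keys_iff)
  show "q v \<in> free_mod V B" for v
    using assms(2) keys_mapp_subset[of "\<lambda>_. var_quot v" u] by (auto simp: free_mod_def q var_quot_polys q_def[symmetric])
  show "u = (\<Sum>v\<in>V. scal (var v) (q v))"
  proof (rule poly_mapping_eqI)
    fix b
    have "lookup (lookup u b) 0 = 0"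
      using assms(3) by (metis lookup_const_part lookup_zero)
    then have "lookup u b = (\<Sum>v\<in>V. var v * var_quot v (lookup u b))"
      using assms(1,2) by (intro var_quot_decomp) (simp_all add: free_mod_def)
    also have "\<dots> = lookup (\<Sum>v\<in>V. scal (var v) (q v)) b"
      by (simp add: lookup_sum q)
    finally show "lookup u b = lookup (\<Sum>v\<in>V. scal (var v) (q v)) b" .
  qed
  show "homog \<delta> j (q v)" if "homog \<delta> (Suc j) u" for \<delta> j v
    unfolding homog_def q
  proof (intro allI ballI)
    fix b t assume "t \<in> keys (var_quot v (lookup u b))"
    then have "t + Poly_Mapping.single v 1 \<in> keys (lookup u b)"
      by (rule keys_var_quot)
    with that have "mdeg (t + Poly_Mapping.single v 1) + \<delta> b = Suc j"
      by (simp add: homog_def)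
    then show "mdeg t + \<delta> b = j" by (simp add: mdeg_add)
  qed
qed

subsection \<open>Symmetric families of functionals\<close>

text \<open>The linear functionals on \<open>m \<otimes> I\<close> for the ideal \<open>m\<close> of
  the variables: \<open>h v f\<close> is the value at \<open>var v \<otimes> f\<close>, and the last
  clause is the Koszul relation between \<open>v\<close> and \<open>w\<close>.\<close>

definition symmetric_family :: "'v set \<Rightarrow> ('v, 'k::field) mpoly set \<Rightarrow> ('v \<Rightarrow> ('v, 'k) mpoly \<Rightarrow> 'k) \<Rightarrow> bool" where
  "symmetric_family V I h \<longleftrightarrow>
     (\<forall>v\<in>V. \<forall>f\<in>I. \<forall>g\<in>I. h v (f + g) = h v f + h v g) \<and>
     (\<forall>v\<in>V. \<forall>c. \<forall>f\<in>I. h v (monom 0 c * f) = c * h v f) \<and>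
     (\<forall>v\<in>V. \<forall>w\<in>V. \<forall>g\<in>I. h v (var w * g) = h w (var v * g))"

lemma symmetric_family_sum:
  assumes "symmetric_family V I h" "homogeneous_ideal V I" "v \<in> V" "\<And>x. x \<in> A \<Longrightarrow> f x \<in> I"
  shows "h v (\<Sum>x\<in>A. f x) = (\<Sum>x\<in>A. h v (f x)) \<and> (\<Sum>x\<in>A. f x) \<in> I"
  using assms(4)
proof (induction A rule: infinite_finite_induct)
  have "h v 0 = 0"
    using assms(1-3) unfolding symmetric_family_def homogeneous_ideal_def
    by (metis add_cancel_right_right)
  moreover have "0 \<in> I"
    using assms(2) by (simp add: homogeneous_ideal_def)
  ultimately show "infinite A \<Longrightarrow> h v (sum f A) = (\<Sum>x\<in>A. h v (f x)) \<and> sum f A \<in> I"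
    and "h v (sum f {}) = (\<Sum>x\<in>{}. h v (f x)) \<and> sum f {} \<in> I" for A
    by simp_all
next
  case (insert x A)
  then show ?case
    using assms(1-3) by (simp add: symmetric_family_def homogeneous_ideal_def)
qed

lemma symmetric_family_mult:
  assumes h: "symmetric_family V I h" and I: "homogeneous_ideal V I"
    and v: "v \<in> V" and p: "p \<in> polys V" and g: "g \<in> I"
  shows "h v (p * g) = ev (\<lambda>s. h v (monom s 1 * g)) p"
proof -
  have mI: "monom t c * g \<in> I" if "t \<in> keys p" for t c
  proof -
    have "monom t c \<in> polys V"
      using that p by (intro monom_polys) (auto simp: polys_def)
    then show ?thesis
      using g I by (simp add: homogeneous_ideal_def)
  qed
  have "p * g = (\<Sum>t\<in>keys p. monom t (lookup p t) * g)"
    by (subst monom_expand[of p]) (simp add: sum_distrib_right)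
  then have "h v (p * g) = (\<Sum>t\<in>keys p. h v (monom t (lookup p t) * g))"
    using symmetric_family_sum[OF h I v, of "keys p" "\<lambda>t. monom t (lookup p t) * g"] mI by simp
  also have "\<dots> = (\<Sum>t\<in>keys p. lookup p t * h v (monom t 1 * g))"
  proof (intro sum.cong refl)
    fix t assume "t \<in> keys p"
    then have "h v (monom 0 (lookup p t) * (monom t 1 * g)) = lookup p t * h v (monom t 1 * g)"
      using h v mI unfolding symmetric_family_def by blast
    then show "h v (monom t (lookup p t) * g) = lookup p t * h v (monom t 1 * g)"
      by (simp add: mult.assoc[symmetric] monom_mult)
  qed
  finally show ?thesis by (simp add: ev_def)
qed

text \<open>By symmetry the functional \<open>p \<mapsto> h v (p * g)\<close> only depends on \<open>var v * p\<close>, so the sum below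
  is a single functional applied to \<open>\<Sum>v\<in>V. var v * p v\<close>.\<close>

lemma symmetric_family_contract:
  assumes h: "symmetric_family V I h" and I: "homogeneous_ideal V I"
    and p: "\<And>v. v \<in> V \<Longrightarrow> p v \<in> polys V" and g: "g \<in> I" and zero: "(\<Sum>v\<in>V. var v * p v) = 0"
  shows "(\<Sum>v\<in>V. h v (p v * g)) = 0"
proof -
  let ?e = "\<lambda>v. Poly_Mapping.single v (1::nat)"
  \<comment> \<open>The variable is picked arbitrarily; the next claim shows that every variable of
    \<open>V\<close> dividing the monomial leads to the same value.\<close>
  define \<Psi> where "\<Psi> t = (let w = (SOME w. w \<in> keys t) in h w (monom (t - ?e w) 1 * g))" for t
  have \<Psi>: "h v (monom s 1 * g) = \<Psi> (?e v + s)" if v: "v \<in> V" and s: "keys s \<subseteq> V" for v s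
  proof -
    define w where "w = (SOME w. w \<in> keys (?e v + s))"
    have w: "w \<in> keys (?e v + s)"
      unfolding w_def by (rule someI[of _ v]) (simp add: keys_add_nat)
    have "h v (monom s 1 * g) = h w (monom (?e v + s - ?e w) 1 * g)"
    proof (cases "w = v")
      case False
      then have ws: "w \<in> keys s" "w \<in> V"
        using w s by (auto simp: keys_add_nat)
      let ?s = "s - ?e w"
      have "keys ?s \<subseteq> V"
        using s by (auto simp: in_keys_iff lookup_minus)
      then have m: "monom ?s 1 * g \<in> I"
        using g I by (simp add: homogeneous_ideal_def monom_polys)
      have "h v (var w * (monom ?s 1 * g)) = h w (var v * (monom ?s 1 * g))"
        using h v ws m unfolding symmetric_family_def by blast
      moreover have "var w * (monom ?s 1 * g) = monom s 1 * g"
        using ws by (simp add: var_monom mult.assoc[symmetric] monom_mult single_add_minus)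
      moreover have "?e v + s - ?e w = ?e v + ?s"
        using minus_single_add[OF ws(1)] by (metis add.assoc add_diff_cancel_right')
      ultimately show ?thesis
        by (simp add: var_monom mult.assoc[symmetric] monom_mult)
    qed simp
    then show ?thesis by (simp add: \<Psi>_def w_def Let_def)
  qed
  have "(\<Sum>v\<in>V. h v (p v * g)) = (\<Sum>v\<in>V. ev (\<lambda>s. \<Psi> (?e v + s)) (p v))"
  proof (intro sum.cong refl)
    fix v assume v: "v \<in> V"
    have "h v (p v * g) = ev (\<lambda>s. h v (monom s 1 * g)) (p v)"
      by (rule symmetric_family_mult[OF h I v p[OF v] g])
    also have "\<dots> = ev (\<lambda>s. \<Psi> (?e v + s)) (p v)"
      using p[OF v] by (intro ev_cong \<Psi>[OF v]) (auto simp: polys_def)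
    finally show "h v (p v * g) = ev (\<lambda>s. \<Psi> (?e v + s)) (p v)" .
  qed
  also have "\<dots> = ev \<Psi> (\<Sum>v\<in>V. var v * p v)"
    by (simp add: ev_sum var_monom ev_monom_mult)
  finally show ?thesis by (simp add: zero)
qed

subsection \<open>Tor in terms of an arbitrary resolution\<close>

text \<open>Subtraction on naturals is truncated, so the left side only says that the dimension of
  \<open>W\<close> is at most that of \<open>U\<close>. With \<open>U\<close> inside the
  finite-dimensional \<open>W\<close> this forces equality.\<close>

lemma scal_dim_diff_zero_iff:
  fixes U W :: "(nat \<Rightarrow>\<^sub>0 'k::field) set"
  assumes "scal.subspace U" "U \<subseteq> W" "finite S" "\<And>v. v \<in> W \<Longrightarrow> keys v \<subseteq> S"
  shows "scal.dim W - scal.dim U = 0 \<longleftrightarrow> W \<subseteq> U"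
proof
  assume "W \<subseteq> U"
  then show "scal.dim W - scal.dim U = 0"
    using assms(2) by simp
next
  assume dim: "scal.dim W - scal.dim U = 0"
  let ?E = "(\<lambda>b. Poly_Mapping.single b (1::'k)) ` S"
  have "v \<in> scal.span ?E" if "v \<in> W" for v
  proof -
    have "v = (\<Sum>b\<in>keys v. scal (lookup v b) (Poly_Mapping.single b 1))"
      by (subst single_expand) (intro sum.cong refl poly_mapping_eqI, simp add: lookup_single when_def)
    also have "\<dots> \<in> scal.span ?E"
      using assms(4)[OF that] by (intro scal.span_sum scal.span_scale scal.span_base) auto
    finally show ?thesis .
  qed
  then have span: "W \<subseteq> scal.span ?E" ..
  have fin: "finite B" if "scal.independent B" "B \<subseteq> W" for B
    using scal.independent_span_bound[of ?E B] assms(3) that span by auto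
  obtain B where B: "B \<subseteq> U" "scal.independent B" "U \<subseteq> scal.span B" "card B = scal.dim U"
    using scal.basis_exists by blast
  obtain C where C: "C \<subseteq> W" "scal.independent C" "W \<subseteq> scal.span C" "card C = scal.dim W"
    using scal.basis_exists by blast
  have "scal.span B = U"
    using B assms(1) by (simp add: scal.span_subspace)
  show "W \<subseteq> U"
  proof (rule ccontr)
    assume "\<not> W \<subseteq> U"
    then obtain v where v: "v \<in> W" "v \<notin> U" by blast
    then have "scal.independent (insert v B)"
      using \<open>scal.span B = U\<close> B(2) by (simp add: scal.independent_insertI)
    moreover have "insert v B \<subseteq> scal.span C"
      using v B(1) C(3) assms(2) by blast
    ultimately have "card (insert v B) \<le> card C"
      using scal.independent_span_bound[of C "insert v B"] fin[OF C(2,1)] by blast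
    moreover have "card (insert v B) = Suc (card B)"
      using fin[OF B(2)] B(1) v(2) assms(2) by (subst card_insert_disjoint) auto
    ultimately show False
      using dim B(4) C(4) by simp
  qed
qed

context
  fixes V :: "'v set" and I :: "('v, 'k::field) mpoly set" and F :: "('v, 'k) free_complex"
  assumes V: "finite V" and I: "homogeneous_ideal V I" and F: "graded_free_resolution V I F"
begin

private lemma bdry_mod: "b \<in> basis F (Suc i) \<Longrightarrow> bdry F i b \<in> free_mod V (basis F i)"
  and bdry_homog: "b \<in> basis F (Suc i) \<Longrightarrow> homog (bdeg F i) (bdeg F (Suc i) b) (bdry F i b)"
  and exact0: "lin_ext (bdry F 0) ` free_mod V (basis F 1) = {u\<in>free_mod V (basis F 0). aug_map F u = 0}"
  and aug_image: "aug_map F ` free_mod V (basis F 0) = I"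
  and aug_mem: "b \<in> basis F 0 \<Longrightarrow> aug F b \<in> I"
  and aug_homog: "b \<in> basis F 0 \<Longrightarrow> t \<in> keys (aug F b) \<Longrightarrow> mdeg t = bdeg F 0 b"
  and fin_basis: "finite {b\<in>basis F i. bdeg F i b = j}"
  using F unfolding graded_free_resolution_def homog_def by simp_all

private lemma bdry_homog_0: "b \<in> basis F 1 \<Longrightarrow> homog (bdeg F 0) (bdeg F 1 b) (bdry F 0 b)"
  using bdry_homog[of b 0] by (simp add: One_nat_def)

private lemma tensor_cycles_1:
  "tensor_cycles F 1 j = {v\<in>tensor_comp F 1 j. tensor_bdry F 0 v = 0}"
  by (simp add: One_nat_def)

private lemma exact1:
  "lin_ext (bdry F 1) ` free_mod V (basis F 2) = {u\<in>free_mod V (basis F 1). lin_ext (bdry F 0) u = 0}"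
proof -
  have "lin_ext (bdry F (Suc 0)) ` free_mod V (basis F (Suc (Suc 0))) =
      {u\<in>free_mod V (basis F (Suc 0)). lin_ext (bdry F 0) u = 0}"
    using F unfolding graded_free_resolution_def by blast
  then show ?thesis by (simp add: numeral_2_eq_2 One_nat_def)
qed

text \<open>A nonzero constant entry of a differential has degree 0 and so joins basis elements of
  equal degree. Hence the tensored complex splits into its degrees.\<close>

private lemma tensor_bdry_lookup:
  assumes "keys v \<subseteq> basis F (Suc i)" "c \<notin> basis F i \<or> (\<forall>b\<in>keys v. bdeg F (Suc i) b \<noteq> bdeg F i c)"
  shows "lookup (tensor_bdry F i v) c = 0"
proof -
  have "lookup (lookup (bdry F i b) c) 0 = 0" if b: "b \<in> keys v" for b
  proof (rule ccontr)
    assume nz: "lookup (lookup (bdry F i b) c) 0 \<noteq> 0"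
    then have "0 \<in> keys (lookup (bdry F i b) c)" "c \<in> keys (bdry F i b)"
      by (auto simp: in_keys_iff)
    then have "bdeg F i c = bdeg F (Suc i) b" "c \<in> basis F i"
      using b assms(1) bdry_homog[of b i] bdry_mod[of b i] unfolding homog_def free_mod_def by fastforce+
    with assms(2) b show False by auto
  qed
  then show ?thesis
    by (simp add: tensor_bdry_const lookup_lin_ext lookup_const_part)
qed

private lemma tensor_cycles_iff_boundaries:
  "scal.dim (tensor_cycles F 1 j) - scal.dim (tensor_boundaries F 1 j) = 0 \<longleftrightarrow>
     tensor_cycles F 1 j \<subseteq> tensor_boundaries F 1 j"
proof (rule scal_dim_diff_zero_iff)
  show "finite {b\<in>basis F 1. bdeg F 1 b = j}" by (rule fin_basis)
  show "keys v \<subseteq> {b\<in>basis F 1. bdeg F 1 b = j}" if "v \<in> tensor_cycles F 1 j" for v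
    using that by (simp add: tensor_cycles_1 tensor_comp_def)
  have comp: "scal.subspace (tensor_comp F 2 j)"
  proof (rule scal.subspaceI)
    fix x y :: "nat \<Rightarrow>\<^sub>0 'k" and c
    assume x: "x \<in> tensor_comp F 2 j"
    then show "scal c x \<in> tensor_comp F 2 j"
      using keys_scal[of c x] unfolding tensor_comp_def by blast
    assume "y \<in> tensor_comp F 2 j"
    with x show "x + y \<in> tensor_comp F 2 j"
      using Poly_Mapping.keys_add[of x y] unfolding tensor_comp_def by blast
  qed (simp add: tensor_comp_def)
  show "scal.subspace (tensor_boundaries F 1 j)"
    unfolding tensor_boundaries_def
  proof (rule scal.subspaceI)
    show "0 \<in> tensor_bdry F 1 ` tensor_comp F (Suc 1) j"
      by (rule image_eqI[of _ _ 0]) (simp_all add: tensor_bdry_const tensor_comp_def)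
    fix x y c
    assume x: "x \<in> tensor_bdry F 1 ` tensor_comp F (Suc 1) j"
    then show "scal c x \<in> tensor_bdry F 1 ` tensor_comp F (Suc 1) j"
      using scal.subspace_scale[OF comp]
      by (auto simp: tensor_bdry_const lin_ext_scal[symmetric] numeral_2_eq_2)
    assume "y \<in> tensor_bdry F 1 ` tensor_comp F (Suc 1) j"
    with x show "x + y \<in> tensor_bdry F 1 ` tensor_comp F (Suc 1) j"
      using scal.subspace_add[OF comp]
      by (auto simp: tensor_bdry_const lin_ext_add[symmetric] numeral_2_eq_2)
  qed
  show "tensor_boundaries F 1 j \<subseteq> tensor_cycles F 1 j"
  proof
    fix v assume "v \<in> tensor_boundaries F 1 j"
    then obtain w where w: "keys w \<subseteq> basis F 2" "\<forall>b\<in>keys w. bdeg F 2 b = j" "v = tensor_bdry F 1 w"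
      by (auto simp: tensor_boundaries_def tensor_comp_def numeral_2_eq_2)
    have "keys v \<subseteq> {b\<in>basis F 1. bdeg F 1 b = j}"
    proof
      fix c assume "c \<in> keys v"
      then have nz: "lookup (tensor_bdry F 1 w) c \<noteq> 0"
        using w(3) by (simp add: in_keys_iff)
      show "c \<in> {b\<in>basis F 1. bdeg F 1 b = j}"
      proof (rule ccontr)
        assume "c \<notin> {b\<in>basis F 1. bdeg F 1 b = j}"
        then have "c \<notin> basis F 1 \<or> (\<forall>b\<in>keys w. bdeg F (Suc 1) b \<noteq> bdeg F 1 c)"
          using w(2) by auto
        with tensor_bdry_lookup[of w 1 c] w(1) nz show False by simp
      qed
    qed
    moreover have "tensor_bdry F 0 v = 0"
    proof -
      have "lin_ext (bdry F 1) (const_emb w) \<in> lin_ext (bdry F 1) ` free_mod V (basis F 2)"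
        using w(1) const_emb_free_mod by blast
      then have "lin_ext (bdry F 0) (lin_ext (bdry F 1) (const_emb w)) = 0"
        using exact1 by blast
      moreover have "v = const_part (lin_ext (bdry F 1) (const_emb w))"
        using w(3) tensor_bdry_const_part[of F 1 "const_emb w"] by (simp add: const_part_emb)
      ultimately show ?thesis
        by (simp add: tensor_bdry_const_part)
    qed
    ultimately show "v \<in> tensor_cycles F 1 j"
      by (simp add: tensor_cycles_1 tensor_comp_def)
  qed
qed

text \<open>Viewing the augmentation as a map into the free module on the basis element 0 lets it
  inherit the lemmas on \<open>lin_ext\<close>.\<close>

private lemma aug_map_as_lin_ext: "aug_map F u = lookup (lin_ext (\<lambda>b. Poly_Mapping.single 0 (aug F b)) u) 0"
  by (rule aug_map_lin_ext) simp

private lemma aug_map_add: "aug_map F (u + v) = aug_map F u + aug_map F v"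
  by (simp add: aug_map_as_lin_ext lin_ext_add lookup_add)

private lemma aug_map_diff: "aug_map F (u - v) = aug_map F u - aug_map F v"
  by (simp add: aug_map_as_lin_ext lin_ext_diff lookup_minus)

private lemma aug_map_scal: "aug_map F (scal r u) = r * aug_map F u"
  by (simp add: aug_map_as_lin_ext lin_ext_scal)

private lemma aug_map_zero [simp]: "aug_map F 0 = 0"
  by (simp add: aug_map_def)

private lemma aug_map_sum: "aug_map F (\<Sum>x\<in>A. u x) = (\<Sum>x\<in>A. aug_map F (u x))"
  by (induction A rule: infinite_finite_induct) (simp_all add: aug_map_add)

private lemma aug_map_hcomp:
  assumes "u \<in> free_mod V (basis F 0)"
  shows "aug_map F (hcomp (bdeg F 0) j u) = filt (\<lambda>t. mdeg t = j) (aug_map F u)"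
proof -
  have "hcomp (\<lambda>_. 0) j (lin_ext (\<lambda>b. Poly_Mapping.single 0 (aug F b)) u) =
      lin_ext (\<lambda>b. Poly_Mapping.single 0 (aug F b)) (hcomp (bdeg F 0) j u)"
    using assms by (intro hcomp_lin_ext[of u "basis F 0"])
      (auto simp: free_mod_def homog_def lookup_single when_def aug_homog)
  from arg_cong[OF this, of "\<lambda>u. lookup u 0"] show ?thesis
    by (simp add: aug_map_as_lin_ext lookup_hcomp)
qed

private lemma aug_lift: "\<forall>f\<in>I. \<exists>u. u \<in> free_mod V (basis F 0) \<and> aug_map F u = f"
proof
  fix f assume "f \<in> I"
  then have "f \<in> aug_map F ` free_mod V (basis F 0)"
    by (simp only: aug_image)
  then show "\<exists>u. u \<in> free_mod V (basis F 0) \<and> aug_map F u = f"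
    by (elim imageE) auto
qed

text \<open>Lift the cycle \<open>a\<close> to \<open>F 1\<close>; the boundary \<open>z\<close> of
  the lift has zero constant part. If \<open>z\<close> lies in \<open>mZ\<close>, subtracting
  multiples of variables from the lift gives a genuine cycle with the same constant part, and
  exactness makes \<open>a\<close> a boundary. Otherwise a functional that kills \<open>mZ\<close>
  but not \<open>z\<close> induces a symmetric family on \<open>I\<close>, against the
  criterion.\<close>

private lemma vanishing_imp_boundary:
  assumes crit: "\<And>h f. symmetric_family V I h \<Longrightarrow> (\<And>v. v \<in> V \<Longrightarrow> f v \<in> I) \<Longrightarrow>
      (\<And>v t. v \<in> V \<Longrightarrow> t \<in> keys (f v) \<Longrightarrow> mdeg t = j) \<Longrightarrow>
      (\<Sum>v\<in>V. var v * f v) = 0 \<Longrightarrow> (\<Sum>v\<in>V. h v (f v)) = 0"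
  shows "tensor_cycles F 1 (Suc j) \<subseteq> tensor_boundaries F 1 (Suc j)"
proof
  fix a assume "a \<in> tensor_cycles F 1 (Suc j)"
  then have a: "keys a \<subseteq> basis F 1" "\<forall>b\<in>keys a. bdeg F 1 b = Suc j" "tensor_bdry F 0 a = 0"
    by (auto simp: tensor_cycles_1 tensor_comp_def)
  define y where "y = (const_emb a :: nat \<Rightarrow>\<^sub>0 ('v, 'k) mpoly)"
  define z where "z = lin_ext (bdry F 0) y"
  define Z where "Z = {u\<in>free_mod V (basis F 0). aug_map F u = 0}"
  define mZ where "mZ = {\<Sum>v\<in>V. scal (var v) (q v) | q. \<forall>v\<in>V. q v \<in> Z}"
  have y: "y \<in> free_mod V (basis F 1)" "const_part y = a"
    using a(1) by (simp_all add: y_def const_emb_free_mod const_part_emb)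
  have "homog (bdeg F 1) (Suc j) y"
    using a(2) by (auto simp: homog_def y_def lookup_const_emb monom_def in_keys_iff lookup_single when_def split: if_splits)
  then have hz: "homog (bdeg F 0) (Suc j) z"
    using hcomp_lin_ext[of y "basis F 1" "bdeg F 0" "bdeg F 1" "bdry F 0" "Suc j"] y(1) bdry_homog_0
      homog_hcomp[of "bdeg F 0" "Suc j" z]
    by (simp add: hcomp_homog z_def free_mod_def)
  have zZ: "z \<in> Z"
    using exact0 y(1) by (auto simp: Z_def z_def)
  have cz: "const_part z = 0"
    using a(3) y(2) by (simp add: z_def tensor_bdry_const_part[symmetric])
  have Z: "kscal.subspace Z" "\<And>u v. u \<in> Z \<Longrightarrow> v \<in> Z \<Longrightarrow> u + v \<in> Z" "0 \<in> Z" "\<And>r u. r \<in> polys V \<Longrightarrow> u \<in> Z \<Longrightarrow> scal r u \<in> Z"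
    unfolding Z_def kscal.subspace_def kscal_def
    by (auto simp: free_mod_zero free_mod_add free_mod_scal aug_map_add aug_map_scal monom_polys)
  have mZ_sum: "(\<Sum>v\<in>V. scal (var v) (q v)) \<in> mZ" if "\<And>v. v \<in> V \<Longrightarrow> q v \<in> Z" for q
    using that by (auto simp: mZ_def)
  have mZ_I: "scal (var v) u \<in> mZ" if "v \<in> V" "u \<in> Z" for v u
  proof -
    have "scal (var v) u = (\<Sum>w\<in>V. scal (var w) (if w = v then u else 0))"
      using V that by (intro poly_mapping_eqI) (simp add: lookup_sum if_distrib if_distribR cong: if_cong)
    then show ?thesis
      using mZ_sum[of "\<lambda>w. if w = v then u else 0"] that(2) Z(3) by simp
  qed
  have "kscal.subspace mZ"
  proof (rule kscal.subspaceI)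
    show "0 \<in> mZ"
      using mZ_sum[of "\<lambda>_. 0"] Z(3) by (simp add: scal_zero)
    show "x + y \<in> mZ" if xy: "x \<in> mZ" "y \<in> mZ" for x y
    proof -
      obtain q r where q: "x = (\<Sum>v\<in>V. scal (var v) (q v))" "\<forall>v\<in>V. q v \<in> Z"
        and r: "y = (\<Sum>v\<in>V. scal (var v) (r v))" "\<forall>v\<in>V. r v \<in> Z"
        using xy unfolding mZ_def by blast
      have "x + y = (\<Sum>v\<in>V. scal (var v) (q v + r v))"
        unfolding q r by (intro poly_mapping_eqI) (simp add: lookup_sum lookup_add distrib_left sum.distrib)
      moreover have "(\<Sum>v\<in>V. scal (var v) (q v + r v)) \<in> mZ"
        using q(2) r(2) by (intro mZ_sum Z(2)) auto
      ultimately show ?thesis by simp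
    qed
    show "kscal c x \<in> mZ" if x: "x \<in> mZ" for c x
    proof -
      obtain q where q: "x = (\<Sum>v\<in>V. scal (var v) (q v))" "\<forall>v\<in>V. q v \<in> Z"
        using x unfolding mZ_def by blast
      have "kscal c x = (\<Sum>v\<in>V. scal (var v) (kscal c (q v)))"
        unfolding q by (intro poly_mapping_eqI) (simp add: lookup_sum lookup_kscal sum_distrib_left mult_ac)
      moreover have "(\<Sum>v\<in>V. scal (var v) (kscal c (q v))) \<in> mZ"
        using q(2) by (intro mZ_sum kscal.subspace_scale[OF Z(1)]) auto
      ultimately show ?thesis by simp
    qed
  qed
  note subspace = this
  have "z \<in> mZ"
  proof (rule ccontr)
    assume "z \<notin> mZ"
    then obtain h :: "(nat \<Rightarrow>\<^sub>0 ('v, 'k) mpoly) \<Rightarrow> 'k" where h: "\<And>u v. h (u + v) = h u + h v" "\<And>c u. h (kscal c u) = c * h u"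
      "\<And>u. u \<in> mZ \<Longrightarrow> h u = 0" "h z = 1"
      using separating_functional[OF subspace] by metis
    have h_diff: "h (u - v) = h u - h v" for u v
      using h(1)[of "u - v" v] by simp
    have h_sum: "h (\<Sum>x\<in>A. u x) = (\<Sum>x\<in>A. h (u x))" for A :: "'v set" and u
      by (induction A rule: infinite_finite_induct)
        (use h(1) h(3)[of 0] kscal.subspace_0[OF subspace] in auto)
    from bchoice[OF aug_lift] obtain lift
      where lift: "\<And>f. f \<in> I \<Longrightarrow> lift f \<in> free_mod V (basis F 0) \<and> aug_map F (lift f) = f"
      by blast
    \<comment> \<open>The choice of \<open>lift f\<close> is irrelevant: two preimages differ by an
      element of \<open>Z\<close>, and \<open>h\<close> kills its multiples by variables.\<close>
    define k where "k v f = h (scal (var v) (lift f))" for v f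
    have k: "k v (aug_map F u) = h (scal (var v) u)" if "v \<in> V" "u \<in> free_mod V (basis F 0)" for v u
    proof -
      have "aug_map F u \<in> I" using that aug_image by blast
      then have "u - lift (aug_map F u) \<in> Z"
        using lift that by (simp add: Z_def free_mod_diff aug_map_diff)
      then have "h (scal (var v) (u - lift (aug_map F u))) = 0"
        using mZ_I that h(3) by blast
      moreover have "scal (var v) (u - lift (aug_map F u)) = scal (var v) u - scal (var v) (lift (aug_map F u))"
        by (rule poly_mapping_eqI) (simp add: lookup_minus right_diff_distrib)
      ultimately show ?thesis by (simp add: k_def h_diff)
    qed
    have sym: "symmetric_family V I k"
      unfolding symmetric_family_def
    proof (intro conjI ballI allI)
      fix v f g assume v: "v \<in> V" and f: "f \<in> I" and g: "g \<in> I"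
      have "k v (aug_map F (lift f + lift g)) = h (scal (var v) (lift f + lift g))"
        using k v f g lift by (simp add: free_mod_add)
      also have "scal (var v) (lift f + lift g) = scal (var v) (lift f) + scal (var v) (lift g)"
        by (rule poly_mapping_eqI) (simp add: lookup_add distrib_left)
      finally show "k v (f + g) = k v f + k v g"
        using f g lift by (simp add: h aug_map_add k_def)
    next
      fix v c f assume v: "v \<in> V" and f: "f \<in> I"
      have "k v (aug_map F (scal (monom 0 c) (lift f))) = h (scal (var v) (scal (monom 0 c) (lift f)))"
        using k v f lift by (simp add: free_mod_scal monom_polys)
      also have "scal (var v) (scal (monom 0 c) (lift f)) = kscal c (scal (var v) (lift f))"
        by (rule poly_mapping_eqI) (simp add: lookup_kscal mult_ac)
      finally show "k v (monom 0 c * f) = c * k v f"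
        using f lift by (simp add: h aug_map_scal k_def)
    next
      fix v w g assume v: "v \<in> V" and w: "w \<in> V" and g: "g \<in> I"
      have "k v (aug_map F (scal (var w) (lift g))) = h (scal (var v) (scal (var w) (lift g)))"
        using k v w g lift by (simp add: free_mod_scal var_polys)
      also have "scal (var v) (scal (var w) (lift g)) = scal (var w) (scal (var v) (lift g))"
        by (rule poly_mapping_eqI) (simp add: mult_ac)
      also have "h \<dots> = k w (aug_map F (scal (var v) (lift g)))"
        using k v w g lift by (simp add: free_mod_scal var_polys)
      finally show "k v (var w * g) = k w (var v * g)"
        using g lift by (simp add: aug_map_scal)
    qed
    have z_mem: "z \<in> free_mod V (basis F 0)" using zZ by (simp add: Z_def)
    obtain u where u: "\<And>v. u v \<in> free_mod V (basis F 0)" "z = (\<Sum>v\<in>V. scal (var v) (u v))"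
      and u_homog: "\<And>\<delta> j v. homog \<delta> (Suc j) z \<Longrightarrow> homog \<delta> j (u v)"
      by (rule free_mod_var_decomp[OF V z_mem cz]) (rule that)
    note u = u u_homog[OF hz]
    have "mdeg t = j" if "t \<in> keys (aug_map F (u v))" for v t
      using that aug_map_hcomp[OF u(1), of j v] hcomp_homog[OF u(3)] by (simp add: keys_filt) (metis (mono_tags, lifting) keys_filt mem_Collect_eq)
    moreover have "aug_map F (u v) \<in> I" for v
      using u(1) aug_image by blast
    moreover have "(\<Sum>v\<in>V. var v * aug_map F (u v)) = aug_map F z"
      by (simp add: u(2) aug_map_sum aug_map_scal)
    moreover have "aug_map F z = 0" using zZ by (simp add: Z_def)
    ultimately have "(\<Sum>v\<in>V. k v (aug_map F (u v))) = 0"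
      by (intro crit[OF sym]) auto
    then have "h z = 0"
      using u(1) k by (simp add: u(2) h_sum)
    with h(4) show False by simp
  qed
  then obtain q where q: "z = (\<Sum>v\<in>V. scal (var v) (q v))" "\<forall>v\<in>V. q v \<in> Z"
    unfolding mZ_def by blast
  have "\<forall>v\<in>V. \<exists>x. x \<in> free_mod V (basis F 1) \<and> lin_ext (bdry F 0) x = q v"
  proof
    fix v assume "v \<in> V"
    then have "q v \<in> lin_ext (bdry F 0) ` free_mod V (basis F 1)"
      using q(2) unfolding Z_def exact0 by blast
    then show "\<exists>x. x \<in> free_mod V (basis F 1) \<and> lin_ext (bdry F 0) x = q v"
      by (elim imageE) auto
  qed
  from bchoice[OF this] obtain x
    where x: "\<And>v. v \<in> V \<Longrightarrow> x v \<in> free_mod V (basis F 1)" "\<And>v. v \<in> V \<Longrightarrow> lin_ext (bdry F 0) (x v) = q v"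
    by blast
  let ?d = "y - (\<Sum>v\<in>V. scal (var v) (x v))"
  have "?d \<in> {u\<in>free_mod V (basis F 1). lin_ext (bdry F 0) u = 0}"
    using x y(1) by (simp add: free_mod_diff free_mod_sum free_mod_scal var_polys lin_ext_diff lin_ext_sum
        lin_ext_scal z_def[symmetric] q(1))
  then obtain w where w: "w \<in> free_mod V (basis F 2)" "lin_ext (bdry F 1) w = ?d"
    using exact1 by (metis (no_types, lifting) imageE)
  have "a = const_part ?d"
    by (simp add: const_part_diff y(2) const_part_sum const_part_scal_var)
  then have a_eq: "a = tensor_bdry F 1 (const_part w)"
    by (simp add: w(2)[symmetric] tensor_bdry_const_part)
  \<comment> \<open>Exactness may have returned an inhomogeneous \<open>w\<close>, but only its part
    in degree \<open>Suc j\<close> can contribute to \<open>a\<close>.\<close>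
  define w' where "w' = filt (\<lambda>b. bdeg F 2 b = Suc j) (const_part w)"
  define w'' where "w'' = filt (\<lambda>b. bdeg F 2 b \<noteq> Suc j) (const_part w)"
  have split: "const_part w = w' + w''"
    by (rule poly_mapping_eqI) (simp add: w'_def w''_def lookup_add lookup_filt when_def)
  have kw: "keys (const_part w) \<subseteq> basis F 2"
    using w(1) keys_const_part[of w] unfolding free_mod_def by blast
  have "lookup a c = lookup (tensor_bdry F 1 w') c" for c
  proof (cases "c \<in> basis F 1 \<and> bdeg F 1 c = Suc j")
    case True
    then have "lookup (tensor_bdry F 1 w'') c = 0"
      using kw by (intro tensor_bdry_lookup) (auto simp: w''_def keys_filt)
    then show ?thesis
      unfolding a_eq split by (simp add: tensor_bdry_const lin_ext_add lookup_add)
  next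
    case False
    then have "lookup (tensor_bdry F 1 w') c = 0"
      using kw by (intro tensor_bdry_lookup) (auto simp: w'_def keys_filt)
    moreover have "lookup a c = 0"
      using False a(1,2) by (auto simp: in_keys_iff)
    ultimately show ?thesis by simp
  qed
  then have "a = tensor_bdry F 1 w'"
    by (rule poly_mapping_eqI)
  moreover have "w' \<in> tensor_comp F (Suc 1) (Suc j)"
    using kw by (auto simp: tensor_comp_def w'_def keys_filt)
  ultimately show "a \<in> tensor_boundaries F 1 (Suc j)"
    unfolding tensor_boundaries_def by blast
qed

text \<open>Preimages \<open>u v\<close> of the \<open>f v\<close> in \<open>F 0\<close> satisfy the
  relation only up to an element \<open>z\<close> of the kernel of the augmentation. The hypothesis
  allows correcting them by boundaries until the relation holds in \<open>F 0\<close> itself; then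
  \<open>symmetric_family_contract\<close> applies at each basis element.\<close>

private lemma boundary_imp_vanishing:
  assumes sub: "tensor_cycles F 1 (Suc j) \<subseteq> tensor_boundaries F 1 (Suc j)"
    and h: "symmetric_family V I h" and fI: "\<And>v. v \<in> V \<Longrightarrow> f v \<in> I"
    and deg: "\<And>v t. v \<in> V \<Longrightarrow> t \<in> keys (f v) \<Longrightarrow> mdeg t = j"
    and zero: "(\<Sum>v\<in>V. var v * f v) = 0"
  shows "(\<Sum>v\<in>V. h v (f v)) = 0"
proof -
  have "\<forall>v\<in>V. \<exists>u. u \<in> free_mod V (basis F 0) \<and> aug_map F u = f v"
    using fI aug_lift by simp
  from bchoice[OF this] obtain u0
    where u0: "\<And>v. v \<in> V \<Longrightarrow> u0 v \<in> free_mod V (basis F 0)" "\<And>v. v \<in> V \<Longrightarrow> aug_map F (u0 v) = f v"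
    by blast
  define u where "u v = hcomp (bdeg F 0) j (u0 v)" for v
  define z where "z = (\<Sum>v\<in>V. scal (var v) (u v))"
  have u: "u v \<in> free_mod V (basis F 0)" "aug_map F (u v) = f v" "homog (bdeg F 0) j (u v)" if "v \<in> V" for v
    using u0[OF that] deg[OF that] by (simp_all add: u_def hcomp_free_mod aug_map_hcomp filt_id homog_hcomp)
  have "homog (bdeg F 0) (Suc j) z"
    unfolding z_def by (intro homog_sum homog_scal[OF u(3)]) (auto simp: var_def)
  have "z \<in> {u\<in>free_mod V (basis F 0). aug_map F u = 0}"
    using u zero by (simp add: z_def free_mod_sum free_mod_scal var_polys aug_map_sum aug_map_scal)
  then obtain y0 where y0: "y0 \<in> free_mod V (basis F 1)" "lin_ext (bdry F 0) y0 = z"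
    using exact0 by (metis (no_types, lifting) imageE)
  define y where "y = hcomp (bdeg F 1) (Suc j) y0"
  have y: "y \<in> free_mod V (basis F 1)"
    using y0(1) by (simp add: y_def hcomp_free_mod)
  have yz: "lin_ext (bdry F 0) y = z"
    using hcomp_lin_ext[of y0 "basis F 1" "bdeg F 0" "bdeg F 1" "bdry F 0" "Suc j"] y0 bdry_homog_0
      \<open>homog (bdeg F 0) (Suc j) z\<close>
    by (simp add: hcomp_homog y_def free_mod_def)
  have "keys (const_part y) \<subseteq> {b\<in>basis F 1. bdeg F 1 b = Suc j}"
  proof
    fix b assume "b \<in> keys (const_part y)"
    then have "0 \<in> keys (lookup y b)" "b \<in> keys y"
      by (auto simp: in_keys_iff lookup_const_part)
    then show "b \<in> {b\<in>basis F 1. bdeg F 1 b = Suc j}"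
      using y homog_hcomp[of "bdeg F 1" "Suc j" y0] unfolding y_def[symmetric] homog_def free_mod_def
      by fastforce
  qed
  moreover have "const_part z = 0"
    by (simp add: z_def const_part_sum const_part_scal_var)
  ultimately have "const_part y \<in> tensor_cycles F 1 (Suc j)"
    by (simp add: tensor_cycles_1 tensor_comp_def tensor_bdry_const_part yz)
  then obtain w where w: "keys w \<subseteq> basis F 2" "const_part y = tensor_bdry F 1 w"
    using sub unfolding tensor_boundaries_def tensor_comp_def Suc_1 by blast
  define y' where "y' = lin_ext (bdry F 1) (const_emb w)"
  have y': "y' \<in> {u\<in>free_mod V (basis F 1). lin_ext (bdry F 0) u = 0}"
    using exact1 w(1) const_emb_free_mod unfolding y'_def by blast
  have "const_part (y - y') = 0"
    using w(2) tensor_bdry_const_part[of F 1 "const_emb w"] by (simp add: const_part_diff y'_def const_part_emb)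
  moreover have "y - y' \<in> free_mod V (basis F 1)"
    using y y' by (simp add: free_mod_diff)
  ultimately obtain g where g: "\<And>v. g v \<in> free_mod V (basis F 1)" "y - y' = (\<Sum>v\<in>V. scal (var v) (g v))"
    using free_mod_var_decomp[OF V] by metis
  \<comment> \<open>The corrected preimages: \<open>y - y'\<close> is a sum of variables times the
    \<open>g v\<close> and still maps to \<open>z\<close>, so subtracting the boundaries of the
    \<open>g v\<close> makes the weighted sum vanish.\<close>
  define x where "x v = u v - lin_ext (bdry F 0) (g v)" for v
  have "lin_ext (bdry F 0) (g v) \<in> {u\<in>free_mod V (basis F 0). aug_map F u = 0}" for v
    using exact0 g(1) by blast
  then have x: "x v \<in> free_mod V (basis F 0)" "aug_map F (x v) = f v" if "v \<in> V" for v
    using u[OF that] by (simp_all add: x_def free_mod_diff aug_map_diff)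
  have "z = lin_ext (bdry F 0) (y - y')"
    using y' by (simp add: lin_ext_diff yz)
  then have "(\<Sum>v\<in>V. scal (var v) (u v)) = (\<Sum>v\<in>V. scal (var v) (lin_ext (bdry F 0) (g v)))"
    by (simp add: g(2) lin_ext_sum lin_ext_scal z_def)
  then have "(\<Sum>v\<in>V. scal (var v) (x v)) = 0"
    by (intro poly_mapping_eqI) (simp add: x_def lookup_sum lookup_minus right_diff_distrib sum_subtractf poly_mapping_eq_iff fun_eq_iff)
  then have x_zero: "(\<Sum>v\<in>V. var v * lookup (x v) b) = 0" for b
    by (metis (mono_tags, lifting) lookup_scal lookup_sum lookup_zero sum.cong)
  let ?K = "\<Union>v\<in>V. keys (x v)"
  have K: "finite ?K" "?K \<subseteq> basis F 0"
    using V x(1) by (auto simp: free_mod_def)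
  have gI: "p * aug F b \<in> I" if "p \<in> polys V" "b \<in> basis F 0" for p b
    using that aug_mem I by (simp add: homogeneous_ideal_def)
  have "h v (f v) = (\<Sum>b\<in>?K. h v (lookup (x v) b * aug F b))" if v: "v \<in> V" for v
  proof -
    have "aug_map F (x v) = (\<Sum>b\<in>?K. lookup (x v) b * aug F b)"
      unfolding aug_map_def using K(1) v by (intro sum.mono_neutral_left) (auto simp: in_keys_iff)
    moreover have "h v (\<Sum>b\<in>?K. lookup (x v) b * aug F b) = (\<Sum>b\<in>?K. h v (lookup (x v) b * aug F b))"
      by (rule conjunct1[OF symmetric_family_sum[OF h I v]], rule gI)
        (use x(1)[OF v] K(2) in \<open>auto simp: free_mod_def\<close>)
    ultimately show ?thesis
      using x(2)[OF v] by simp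
  qed
  then have "(\<Sum>v\<in>V. h v (f v)) = (\<Sum>b\<in>?K. \<Sum>v\<in>V. h v (lookup (x v) b * aug F b))"
    by (simp add: sum.swap[of _ V])
  also have "\<dots> = 0"
  proof (rule sum.neutral, rule ballI)
    fix b assume "b \<in> ?K"
    then have "b \<in> basis F 0" using K(2) by blast
    moreover have "lookup (x v) b \<in> polys V" if "v \<in> V" for v
      using x(1)[OF that] by (simp add: free_mod_def)
    ultimately show "(\<Sum>v\<in>V. h v (lookup (x v) b * aug F b)) = 0"
      by (intro symmetric_family_contract[OF h I _ aug_mem x_zero])
  qed
  finally show ?thesis .
qed

lemma resolution_betti_one_zero_iff:
  "scal.dim (tensor_cycles F 1 (Suc j)) - scal.dim (tensor_boundaries F 1 (Suc j)) = 0 \<longleftrightarrow>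
     (\<forall>h f. symmetric_family V I h \<longrightarrow> (\<forall>v\<in>V. f v \<in> I \<and> (\<forall>t\<in>keys (f v). mdeg t = j)) \<longrightarrow>
        (\<Sum>v\<in>V. var v * f v) = 0 \<longrightarrow> (\<Sum>v\<in>V. h v (f v)) = 0)"
  (is "?L \<longleftrightarrow> ?R")
proof
  assume ?L
  then show ?R
    using boundary_imp_vanishing unfolding tensor_cycles_iff_boundaries by blast
next
  assume ?R
  then show ?L
    unfolding tensor_cycles_iff_boundaries by (intro vanishing_imp_boundary) blast
qed

end

text \<open>No resolution occurs on the right, so it does not matter which one \<open>SOME\<close>
  selects.\<close>

theorem betti_one_zero_iff:
  assumes "finite V" "homogeneous_ideal V I"
  shows "betti V I 1 (Suc j) = 0 \<longleftrightarrow>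
     (\<forall>h f. symmetric_family V I h \<longrightarrow> (\<forall>v\<in>V. f v \<in> I \<and> (\<forall>t\<in>keys (f v). mdeg t = j)) \<longrightarrow>
        (\<Sum>v\<in>V. var v * f v) = 0 \<longrightarrow> (\<Sum>v\<in>V. h v (f v)) = 0)"
  unfolding betti_def Let_def
  by (rule resolution_betti_one_zero_iff[OF assms someI_ex[OF graded_free_resolution_exists[OF assms]]])

section \<open>The fibres of a Hibi ideal\<close>

abbreviation unit_exp :: "'v \<Rightarrow> ('v \<Rightarrow>\<^sub>0 nat)" (\<open>\<some>\<close>) where
  "\<some> v \<equiv> Poly_Mapping.single v 1"

definition same_fibre :: "((nat \<times> nat) \<Rightarrow>\<^sub>0 nat) \<Rightarrow> ((nat \<times> nat) \<Rightarrow>\<^sub>0 nat) \<Rightarrow> bool" where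
  "same_fibre s t \<longleftrightarrow>
     (\<forall>i. wt (\<lambda>v. if fst v = i then 1 else 0) s = wt (\<lambda>v. if fst v = i then 1 else 0) t) \<and>
     (\<forall>i. wt (\<lambda>v. if snd v = i then 1 else 0) s = wt (\<lambda>v. if snd v = i then 1 else 0) t)"

lemma same_fibre_refl [simp]: "same_fibre t t"
  by (simp add: same_fibre_def)

lemma same_fibre_sym: "same_fibre s t \<Longrightarrow> same_fibre t s"
  by (simp add: same_fibre_def)

lemma same_fibre_trans: "same_fibre s t \<Longrightarrow> same_fibre t u \<Longrightarrow> same_fibre s u"
  by (simp add: same_fibre_def)

lemma same_fibre_add_left: "same_fibre (u + s) (u + t) \<longleftrightarrow> same_fibre s t"
  by (simp add: same_fibre_def wt_add)

lemma same_fibre_add_right: "same_fibre (s + u) (t + u) \<longleftrightarrow> same_fibre s t"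
  by (simp add: same_fibre_def wt_add)

lemma wt_indicator_pos: "0 < wt (\<lambda>v. if P v then 1 else 0) t \<longleftrightarrow> (\<exists>v\<in>keys t. P v)"
  unfolding neq0_conv[symmetric] wt_def by (auto simp: in_keys_iff)

lemma wt_fst_expand:
  assumes "finite A" "fst ` keys t \<subseteq> A"
  shows "wt (\<lambda>_. 1) t = (\<Sum>i\<in>A. wt (\<lambda>v. if fst v = i then 1 else 0) t)"
proof -
  have "(\<Sum>i\<in>A. wt (\<lambda>v. if fst v = i then 1 else 0) t) =
      (\<Sum>v\<in>keys t. \<Sum>i\<in>A. lookup t v * (if fst v = i then 1 else 0))"
    unfolding wt_def by (rule sum.swap)
  also have "\<dots> = wt (\<lambda>_. 1) t"
    unfolding wt_def using assms by (intro sum.cong refl) (auto simp: sum_distrib_left[symmetric])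
  finally show ?thesis by simp
qed

lemma same_fibre_mdeg: "same_fibre s t \<Longrightarrow> mdeg s = mdeg t"
  unfolding mdeg_wt
  using wt_fst_expand[of "fst ` (keys s \<union> keys t)" s] wt_fst_expand[of "fst ` (keys s \<union> keys t)" t]
  by (simp add: same_fibre_def image_mono)

section \<open>Uniqueness of the chain in a fibre\<close>

definition chain_monomial :: "('v::order \<Rightarrow>\<^sub>0 nat) \<Rightarrow> bool" where
  "chain_monomial t \<longleftrightarrow> (\<forall>a\<in>keys t. \<forall>b\<in>keys t. a \<le> b \<or> b \<le> a)"

lemma chain_monomial_top:
  assumes "chain_monomial t" "t \<noteq> 0"
  obtains v where "v \<in> keys t" "\<And>u. u \<in> keys t \<Longrightarrow> u \<le> v"
proof -
  obtain v where v: "v \<in> keys t" "\<forall>u\<in>keys t. v \<le> u \<longrightarrow> v = u"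
    using finite_has_maximal[of "keys t"] assms(2) by auto
  have "u \<le> v" if "u \<in> keys t" for u
    using v assms(1) that by (auto simp: chain_monomial_def)
  with v(1) show thesis by (rule that)
qed

text \<open>Each coordinate of \<open>v\<close> occurs in \<open>t\<close>, though perhaps at
  different elements; \<open>w\<close> lies above both of them, and the order is
  componentwise.\<close>

lemma same_fibre_le_top:
  assumes "same_fibre s t" "v \<in> keys s" "\<And>u. u \<in> keys t \<Longrightarrow> u \<le> w"
  shows "v \<le> w"
proof -
  have "(\<exists>u\<in>keys s. fst u = i) \<longleftrightarrow> (\<exists>u\<in>keys t. fst u = i)"
    "(\<exists>u\<in>keys s. snd u = i) \<longleftrightarrow> (\<exists>u\<in>keys t. snd u = i)" for i
    using assms(1) unfolding same_fibre_def wt_indicator_pos[symmetric] by simp_all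
  then obtain p q where "p \<in> keys t" "fst p = fst v" "q \<in> keys t" "snd q = snd v"
    using assms(2) by blast
  then show ?thesis
    using assms(3)[of p] assms(3)[of q] by (simp add: less_eq_prod_def)
qed

text \<open>\<open>same_fibre_le_top\<close> in both directions makes the two top elements equal;
  cancel them and induct on the degree.\<close>

lemma chain_monomial_unique:
  assumes "chain_monomial s" "chain_monomial t" "same_fibre s t"
  shows "s = t"
  using assms
proof (induction "mdeg s" arbitrary: s t)
  case 0
  then show ?case by (metis mdeg_eq_0_iff same_fibre_mdeg)
next
  case (Suc n)
  then have "mdeg t = Suc n" by (metis same_fibre_mdeg)
  with Suc have "s \<noteq> 0" "t \<noteq> 0" by auto
  obtain v where v: "v \<in> keys s" "\<And>u. u \<in> keys s \<Longrightarrow> u \<le> v"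
    by (rule chain_monomial_top[OF Suc.prems(1) \<open>s \<noteq> 0\<close>]) (rule that)
  obtain w where w: "w \<in> keys t" "\<And>u. u \<in> keys t \<Longrightarrow> u \<le> w"
    by (rule chain_monomial_top[OF Suc.prems(2) \<open>t \<noteq> 0\<close>]) (rule that)
  have "v \<le> w" "w \<le> v"
    using same_fibre_le_top[OF Suc.prems(3) v(1) w(2)]
      same_fibre_le_top[OF same_fibre_sym[OF Suc.prems(3)] w(1) v(2)] by auto
  then have vw: "v = w" by simp
  let ?s = "s - \<some> v" and ?t = "t - \<some> v"
  have s: "?s + \<some> v = s" and t: "?t + \<some> v = t"
    using v(1) w(1) vw by (simp_all add: minus_single_add)
  have "keys ?s \<subseteq> keys s" "keys ?t \<subseteq> keys t"
    by (auto simp: in_keys_iff lookup_minus)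
  then have "chain_monomial ?s" "chain_monomial ?t"
    using Suc.prems(1,2) unfolding chain_monomial_def by blast+
  moreover have "same_fibre ?s ?t"
    using Suc.prems(3) same_fibre_add_right[of ?s "\<some> v" ?t] s t by simp
  moreover have "n = mdeg ?s"
    using Suc.hyps(2) mdeg_add[of ?s "\<some> v"] unfolding s by simp
  ultimately have "?s = ?t"
    by (intro Suc.hyps(1))
  then have "?s + \<some> v = ?t + \<some> v" by (rule arg_cong)
  then show ?case unfolding s t .
qed

subsection \<open>Straightening\<close>

definition sublattice :: "'a::lattice set \<Rightarrow> bool" where
  "sublattice L \<longleftrightarrow> (\<forall>a\<in>L. \<forall>b\<in>L. inf a b \<in> L \<and> sup a b \<in> L)"

definition incomp :: "'a::order \<Rightarrow> 'a \<Rightarrow> bool" where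
  "incomp a b \<longleftrightarrow> \<not> a \<le> b \<and> \<not> b \<le> a"

text \<open>One rewriting step by a generator of the Hibi ideal with the incomparable product as
  leading term. The cofactor \<open>s\<close> is kept in \<open>L\<close> so that the step is a
  congruence inside the ring.\<close>

inductive straighten :: "'a::lattice set \<Rightarrow> ('a \<Rightarrow>\<^sub>0 nat) \<Rightarrow> ('a \<Rightarrow>\<^sub>0 nat) \<Rightarrow> bool" for L where
  "a \<in> L \<Longrightarrow> b \<in> L \<Longrightarrow> incomp a b \<Longrightarrow> keys s \<subseteq> L \<Longrightarrow>
     straighten L (s + (\<some> a + \<some> b)) (s + (\<some> (inf a b) + \<some> (sup a b)))"

lemma straighten_keys:
  assumes "sublattice L" "straighten L t t'"
  shows "keys t \<subseteq> L" "keys t' \<subseteq> L"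
  using assms(2,1) by (auto elim!: straighten.cases simp: keys_add_nat sublattice_def)

lemma straighten_same_fibre: "straighten L t t' \<Longrightarrow> same_fibre t t'"
proof (erule straighten.cases)
  fix a b s
  assume "t = s + (\<some> a + \<some> b)" "t' = s + (\<some> (inf a b) + \<some> (sup a b))"
  moreover have "same_fibre (\<some> a + \<some> b) (\<some> (inf a b) + \<some> (sup a b))"
    by (cases a; cases b) (auto simp: same_fibre_def wt_add inf_prod_def sup_prod_def inf_nat_def sup_nat_def)
  ultimately show ?thesis by (simp add: same_fibre_add_left)
qed

lemma straighten_exists:
  assumes "\<not> chain_monomial t" "keys t \<subseteq> L"
  shows "\<exists>t'. straighten L t t'"
proof -
  obtain a b where ab: "a \<in> keys t" "b \<in> keys t" "incomp a b"
    using assms(1) unfolding chain_monomial_def incomp_def by blast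
  then have "a \<noteq> b" by (auto simp: incomp_def)
  let ?s = "t - \<some> a - \<some> b"
  have "t = ?s + (\<some> a + \<some> b)"
    using ab(1,2) \<open>a \<noteq> b\<close>
    by (intro poly_mapping_eqI) (auto simp: lookup_add lookup_minus lookup_single when_def in_keys_iff)
  moreover have "keys ?s \<subseteq> L"
    using assms(2) by (auto simp: in_keys_iff lookup_minus)
  ultimately show ?thesis
    using ab assms(2) straighten.intros[of a L b ?s] by auto
qed

lemma straighten_not_chain:
  assumes "straighten L t t'"
  shows "\<not> chain_monomial t"
  using assms by (auto elim!: straighten.cases simp: chain_monomial_def incomp_def keys_add_nat)

lemma straighten_add:
  assumes "straighten L t t'" "keys u \<subseteq> L"
  shows "straighten L (t + u) (t' + u)"
  using assms(1)
proof (cases rule: straighten.cases)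
  case (1 a b s)
  then have "straighten L ((s + u) + (\<some> a + \<some> b)) ((s + u) + (\<some> (inf a b) + \<some> (sup a b)))"
    using assms(2) by (intro straighten.intros) (auto simp: keys_add_nat)
  with 1 show ?thesis by (simp add: ac_simps)
qed

text \<open>Truncated subtraction kills one of the two squares, so \<open>(i, j)\<close> has weight
  (i - j)^2. Passing from the antidiagonal to the diagonal corners of a rectangle with sides p and q
  lowers the sum by 2pq, so straightening terminates.\<close>

definition spread :: "((nat \<times> nat) \<Rightarrow>\<^sub>0 nat) \<Rightarrow> nat" where
  "spread t = wt (\<lambda>v. (fst v - snd v)\<^sup>2 + (snd v - fst v)\<^sup>2) t"

lemma straighten_spread:
  fixes t :: "(nat \<times> nat) \<Rightarrow>\<^sub>0 nat"
  assumes "straighten L t t'"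
  shows "spread t' < spread t"
proof -
  define g where "g x y = (x - y)\<^sup>2 + (y - x)\<^sup>2" for x y :: nat
  have sq: "int (g x y) = (int x - int y)\<^sup>2" for x y
    by (cases "x \<le> y") (simp_all add: g_def of_nat_diff power2_commute)
  have spread_eq: "spread t = wt (\<lambda>v. g (fst v) (snd v)) t" for t
    by (simp add: spread_def g_def)
  have less: "(int x - int y)\<^sup>2 + (int x' - int y')\<^sup>2 < (int x - int y')\<^sup>2 + (int x' - int y)\<^sup>2"
    if "x < x'" "y < y'" for x x' y y' :: nat
  proof -
    have "0 < (int x' - int x) * (int y' - int y)"
      using that by simp
    then show ?thesis
      by (simp add: power2_eq_square algebra_simps)
  qed
  have key: "spread (\<some> (inf a b) + \<some> (sup a b)) < spread (\<some> a + \<some> b)" if "incomp a b" for a b :: "nat \<times> nat"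
  proof -
    obtain x y' x' y where ab: "a = (x, y')" "b = (x', y)" by (cases a; cases b)
    have "x < x' \<and> y < y' \<or> x' < x \<and> y' < y"
      using that by (auto simp: ab incomp_def)
    then have "int (spread (\<some> (inf a b) + \<some> (sup a b))) < int (spread (\<some> a + \<some> b))"
    proof
      assume *: "x < x' \<and> y < y'"
      then have "inf a b = (x, y)" "sup a b = (x', y')"
        by (auto simp: ab inf_nat_def sup_nat_def)
      with less[of x x' y y'] * show ?thesis
        by (simp add: spread_eq wt_add sq ab)
    next
      assume *: "x' < x \<and> y' < y"
      then have "inf a b = (x', y')" "sup a b = (x, y)"
        by (auto simp: ab inf_nat_def sup_nat_def)
      with less[of x' x y' y] * show ?thesis
        by (simp add: spread_eq wt_add sq ab)
    qed
    then show ?thesis by simp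
  qed
  from assms show ?thesis
    by (cases rule: straighten.cases) (use key in \<open>simp add: spread_eq wt_add\<close>)
qed

lemma straighten_star:
  assumes "sublattice L" "(straighten L)\<^sup>*\<^sup>* t t'" "keys t \<subseteq> L"
  shows "keys t' \<subseteq> L \<and> same_fibre t t' \<and> spread t' \<le> spread (t :: (nat \<times> nat) \<Rightarrow>\<^sub>0 nat)"
  using assms(2,3)
proof (induction rule: rtranclp_induct)
  case (step u v)
  then show ?case
    using straighten_keys[OF assms(1) step(2)] straighten_same_fibre[OF step(2)] straighten_spread[OF step(2)]
      same_fibre_trans by fastforce
qed simp

lemma normal_form_exists:
  fixes t :: "(nat \<times> nat) \<Rightarrow>\<^sub>0 nat"
  assumes "sublattice L" "keys t \<subseteq> L"
  shows "\<exists>c. chain_monomial c \<and> (straighten L)\<^sup>*\<^sup>* t c"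
  using assms(2)
proof (induction "spread t" arbitrary: t rule: less_induct)
  case less
  show ?case
  proof (cases "chain_monomial t")
    case False
    then obtain t' where t': "straighten L t t'"
      using straighten_exists less.prems by blast
    with less.hyps[OF straighten_spread[OF t']] straighten_keys[OF assms(1) t']
    show ?thesis by (meson converse_rtranclp_into_rtranclp)
  qed blast
qed

definition normal_form :: "(nat \<times> nat) set \<Rightarrow> ((nat \<times> nat) \<Rightarrow>\<^sub>0 nat) \<Rightarrow> ((nat \<times> nat) \<Rightarrow>\<^sub>0 nat)" where
  "normal_form L t = (SOME c. chain_monomial c \<and> (straighten L)\<^sup>*\<^sup>* t c)"

lemma normal_form:
  assumes "sublattice L" "keys t \<subseteq> L"
  shows "chain_monomial (normal_form L t)" "(straighten L)\<^sup>*\<^sup>* t (normal_form L t)"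
    "keys (normal_form L t) \<subseteq> L" "same_fibre t (normal_form L t)"
proof -
  have *: "chain_monomial (normal_form L t) \<and> (straighten L)\<^sup>*\<^sup>* t (normal_form L t)"
    unfolding normal_form_def by (rule someI_ex[OF normal_form_exists[OF assms]])
  then show "chain_monomial (normal_form L t)" "(straighten L)\<^sup>*\<^sup>* t (normal_form L t)" by auto
  show "keys (normal_form L t) \<subseteq> L" "same_fibre t (normal_form L t)"
    using straighten_star[OF assms(1) _ assms(2)] * by blast+
qed

text \<open>Whatever chain \<open>SOME\<close> selects, it is the only chain in the fibre, so
  equality of normal forms needs no confluence argument.\<close>

lemma normal_form_eq:
  assumes "sublattice L" "keys s \<subseteq> L" "keys t \<subseteq> L" "same_fibre s t"
  shows "normal_form L s = normal_form L t"
  using normal_form[OF assms(1,2)] normal_form[OF assms(1,3)] assms(4)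
  by (intro chain_monomial_unique) (auto intro: same_fibre_trans same_fibre_sym)

subsection \<open>The Hibi ideal is toric\<close>

text \<open>The kernel of the toric map without mention of its target ring: testing with functions
  constant on fibres says that the coefficients of \<open>p\<close> add up to zero over each
  fibre.\<close>

definition fibrewise_zero :: "(nat \<times> nat) set \<Rightarrow> (nat \<times> nat, 'k::field) mpoly set" where
  "fibrewise_zero L = {p\<in>polys L. \<forall>\<psi>.
     (\<forall>s t. keys s \<subseteq> L \<longrightarrow> keys t \<subseteq> L \<longrightarrow> same_fibre s t \<longrightarrow> \<psi> s = \<psi> t) \<longrightarrow> ev \<psi> p = 0}"

lemma fibrewise_zeroD:
  assumes "p \<in> fibrewise_zero L"
    and "\<And>s t. keys s \<subseteq> L \<Longrightarrow> keys t \<subseteq> L \<Longrightarrow> same_fibre s t \<Longrightarrow> \<psi> s = \<psi> t"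
  shows "ev \<psi> p = 0"
proof -
  have "\<forall>\<psi>. (\<forall>s t. keys s \<subseteq> L \<longrightarrow> keys t \<subseteq> L \<longrightarrow> same_fibre s t \<longrightarrow> \<psi> s = \<psi> t) \<longrightarrow> ev \<psi> p = 0"
    using assms(1) unfolding fibrewise_zero_def mem_Collect_eq by (rule conjunct2)
  from this[THEN spec, of \<psi>] assms(2) show ?thesis by blast
qed

lemma fibrewise_zeroI:
  assumes "p \<in> polys L"
    and "\<And>\<psi>. (\<And>s t. keys s \<subseteq> L \<Longrightarrow> keys t \<subseteq> L \<Longrightarrow> same_fibre s t \<Longrightarrow> \<psi> s = \<psi> t) \<Longrightarrow> ev \<psi> p = 0"
  shows "p \<in> fibrewise_zero L"
  unfolding fibrewise_zero_def
proof (intro CollectI conjI allI impI)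
  show "p \<in> polys L" by (rule assms(1))
  fix \<psi> :: "_ \<Rightarrow> 'a"
  assume "\<forall>s t. keys s \<subseteq> L \<longrightarrow> keys t \<subseteq> L \<longrightarrow> same_fibre s t \<longrightarrow> \<psi> s = \<psi> t"
  then show "ev \<psi> p = 0" by (intro assms(2)) blast
qed

lemma fibrewise_zero_polys: "p \<in> fibrewise_zero L \<Longrightarrow> p \<in> polys L"
  unfolding fibrewise_zero_def mem_Collect_eq by (rule conjunct1)

lemma fibrewise_zero_mult:
  assumes "r \<in> polys L" "p \<in> fibrewise_zero L"
  shows "r * p \<in> fibrewise_zero L"
proof (rule fibrewise_zeroI)
  show "r * p \<in> polys L"
    using assms by (simp add: fibrewise_zero_polys polys_mult)
  fix \<psi> :: "(nat \<times> nat \<Rightarrow>\<^sub>0 nat) \<Rightarrow> 'a"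
  assume \<psi>: "\<And>s t. keys s \<subseteq> L \<Longrightarrow> keys t \<subseteq> L \<Longrightarrow> same_fibre s t \<Longrightarrow> \<psi> s = \<psi> t"
  have "ev (\<lambda>t. \<psi> (s + t)) p = 0" if "s \<in> keys r" for s
  proof (rule fibrewise_zeroD[OF assms(2)])
    fix u t :: "nat \<times> nat \<Rightarrow>\<^sub>0 nat"
    assume "keys u \<subseteq> L" "keys t \<subseteq> L" "same_fibre u t"
    moreover have "keys s \<subseteq> L" using that assms(1) by (auto simp: polys_def)
    ultimately show "\<psi> (s + u) = \<psi> (s + t)"
      by (intro \<psi>) (simp_all add: keys_add_nat same_fibre_add_left)
  qed
  then show "ev \<psi> (r * p) = 0"
    by (simp add: ev_mult)
qed

lemma fibrewise_zero_ideal: "ideal (fibrewise_zero L :: (nat \<times> nat, 'k::field) mpoly set) (poly_ring L)"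
proof -
  interpret R: cring "poly_ring L :: (nat \<times> nat, 'k) mpoly ring"
    by (rule poly_ring_cring)
  have carrier: "carrier (poly_ring L) = (polys L :: (nat \<times> nat, 'k) mpoly set)"
    by (simp add: poly_ring_def)
  show ?thesis
  proof (rule idealI)
    show "ring (poly_ring L :: (nat \<times> nat, 'k) mpoly ring)" by (rule R.ring_axioms)
    show "subgroup (fibrewise_zero L :: (nat \<times> nat, 'k) mpoly set) (add_monoid (poly_ring L))"
    proof
      fix x y :: "(nat \<times> nat, 'k) mpoly"
      assume x: "x \<in> fibrewise_zero L"
      then have xL: "x \<in> polys L" by (rule fibrewise_zero_polys)
      have inv_eq: "\<ominus>\<^bsub>poly_ring L\<^esub> x = - x"
        using xL by (intro R.minus_equality) (simp_all add: poly_ring_def polys_uminus)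
      have "- x \<in> fibrewise_zero L"
      proof (rule fibrewise_zeroI)
        fix \<psi> :: "_ \<Rightarrow> 'k"
        assume "\<And>s t. keys s \<subseteq> L \<Longrightarrow> keys t \<subseteq> L \<Longrightarrow> same_fibre s t \<Longrightarrow> \<psi> s = \<psi> t"
        from fibrewise_zeroD[OF x this] show "ev \<psi> (- x) = 0"
          by (simp add: ev_uminus)
      qed (rule polys_uminus[OF xL])
      then show "inv\<^bsub>add_monoid (poly_ring L)\<^esub> x \<in> fibrewise_zero L"
        unfolding inv_eq[unfolded a_inv_def] .
      assume y: "y \<in> fibrewise_zero L"
      have "x + y \<in> fibrewise_zero L"
      proof (rule fibrewise_zeroI)
        fix \<psi> :: "_ \<Rightarrow> 'k"
        assume "\<And>s t. keys s \<subseteq> L \<Longrightarrow> keys t \<subseteq> L \<Longrightarrow> same_fibre s t \<Longrightarrow> \<psi> s = \<psi> t"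
        from fibrewise_zeroD[OF x this] fibrewise_zeroD[OF y this] show "ev \<psi> (x + y) = 0"
          by (simp add: ev_add)
      qed (rule polys_add[OF xL fibrewise_zero_polys[OF y]])
      then show "x \<otimes>\<^bsub>add_monoid (poly_ring L)\<^esub> y \<in> fibrewise_zero L"
        by (simp add: poly_ring_def)
    next
      show "fibrewise_zero L \<subseteq> carrier (add_monoid (poly_ring L))"
        using fibrewise_zero_polys by (auto simp: poly_ring_def)
      have "0 \<in> fibrewise_zero L"
        by (rule fibrewise_zeroI) (simp_all add: polys_zero)
      then show "\<one>\<^bsub>add_monoid (poly_ring L)\<^esub> \<in> fibrewise_zero L"
        by (simp add: poly_ring_def)
    qed
    fix a x :: "(nat \<times> nat, 'k) mpoly"
    assume "a \<in> fibrewise_zero L" "x \<in> carrier (poly_ring L)"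
    then show "x \<otimes>\<^bsub>poly_ring L\<^esub> a \<in> fibrewise_zero L" "a \<otimes>\<^bsub>poly_ring L\<^esub> x \<in> fibrewise_zero L"
      by (simp_all add: poly_ring_def fibrewise_zero_mult mult.commute[of a])
  qed
qed

lemma monom_diff_fibrewise_zero:
  assumes "keys s \<subseteq> L" "keys t \<subseteq> L" "same_fibre s t"
  shows "monom s c - monom t c \<in> fibrewise_zero L"
proof (rule fibrewise_zeroI)
  show "monom s c - monom t c \<in> polys L"
    using assms by (intro polys_diff monom_polys)
qed (simp add: ev_diff assms)

lemma hibi_generator:
  "var a * var b - var (inf a b) * var (sup a b) =
     monom (\<some> a + \<some> b) 1 - monom (\<some> (inf a b) + \<some> (sup a b)) 1"
  by (simp add: var_monom monom_mult)

context
  fixes L :: "(nat \<times> nat) set"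
  assumes L: "sublattice L"
begin

private lemma ideal_facts:
  fixes I :: "(nat \<times> nat, 'k::field) mpoly set"
  assumes "I = hibi_ideal L"
  shows "ideal I (poly_ring L)"
    and "a \<in> L \<Longrightarrow> b \<in> L \<Longrightarrow> incomp a b \<Longrightarrow> var a * var b - var (inf a b) * var (sup a b) \<in> I"
proof -
  interpret R: cring "poly_ring L :: (nat \<times> nat, 'k) mpoly ring"
    by (rule poly_ring_cring)
  let ?S = "{var a * var b - var (inf a b) * var (sup a b) | a b.
        a \<in> L \<and> b \<in> L \<and> \<not> a \<le> b \<and> \<not> b \<le> a} :: (nat \<times> nat, 'k) mpoly set"
  have "?S \<subseteq> polys L"
  proof clarify
    fix a b
    assume "a \<in> L" "b \<in> L"
    moreover from this have "inf a b \<in> L" "sup a b \<in> L"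
      using L unfolding sublattice_def by blast+
    ultimately show "var a * var b - var (inf a b) * var (sup a b) \<in> polys L"
      by (intro polys_diff polys_mult var_polys)
  qed
  then have "?S \<subseteq> carrier (poly_ring L)"
    by (simp add: poly_ring_def)
  then have "ideal (Idl\<^bsub>poly_ring L\<^esub> ?S) (poly_ring L)" "?S \<subseteq> Idl\<^bsub>poly_ring L\<^esub> ?S"
    by (rule R.genideal_ideal, rule R.genideal_self)
  then show "ideal I (poly_ring L)"
    and "a \<in> L \<Longrightarrow> b \<in> L \<Longrightarrow> incomp a b \<Longrightarrow> var a * var b - var (inf a b) * var (sup a b) \<in> I"
    unfolding assms hibi_ideal_def incomp_def by blast+
qed

private lemma hibi_closed:
  fixes p q :: "(nat \<times> nat, 'k::field) mpoly"
  shows "p \<in> hibi_ideal L \<Longrightarrow> q \<in> hibi_ideal L \<Longrightarrow> p + q \<in> hibi_ideal L"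
    and "r \<in> polys L \<Longrightarrow> p \<in> hibi_ideal L \<Longrightarrow> r * p \<in> hibi_ideal L"
    and "(0 :: (nat \<times> nat, 'k) mpoly) \<in> hibi_ideal L"
proof -
  interpret ideal "hibi_ideal L :: (nat \<times> nat, 'k) mpoly set" "poly_ring L"
    by (rule ideal_facts(1)[OF refl])
  show "p \<in> hibi_ideal L \<Longrightarrow> q \<in> hibi_ideal L \<Longrightarrow> p + q \<in> hibi_ideal L"
    using additive_subgroup.a_closed[OF additive_subgroup_axioms, of p q] by (simp add: poly_ring_def)
  show "r \<in> polys L \<Longrightarrow> p \<in> hibi_ideal L \<Longrightarrow> r * p \<in> hibi_ideal L"
    using I_l_closed[of p r] by (simp add: poly_ring_def)
  show "(0 :: (nat \<times> nat, 'k) mpoly) \<in> hibi_ideal L"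
    using additive_subgroup.zero_closed[OF additive_subgroup_axioms] by (simp add: poly_ring_def)
qed

private lemma straighten_hibi:
  assumes "(straighten L)\<^sup>*\<^sup>* t t'"
  shows "monom t c - monom t' c \<in> (hibi_ideal L :: (nat \<times> nat, 'k::field) mpoly set)"
  using assms
proof (induction rule: rtranclp_induct)
  case base
  show ?case by (simp add: hibi_closed(3))
next
  case (step u v)
  from step(2) have "monom u c - monom v c \<in> (hibi_ideal L :: (nat \<times> nat, 'k) mpoly set)"
  proof (cases rule: straighten.cases)
    case (1 a b s)
    have "monom s c * (var a * var b - var (inf a b) * var (sup a b)) \<in> (hibi_ideal L :: (nat \<times> nat, 'k) mpoly set)"
      using 1 by (intro hibi_closed(2) ideal_facts(2)[OF refl] monom_polys)
    then show ?thesis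
      using 1 by (simp add: hibi_generator right_diff_distrib monom_mult)
  qed
  from hibi_closed(1)[OF step.IH this] show ?case by simp
qed

text \<open>The normal forms cancel: having a given chain as normal form is constant on fibres, so
  the coefficients of the monomials with that normal form add up to zero.\<close>

lemma fibrewise_zero_expand:
  fixes p :: "(nat \<times> nat, 'k::field) mpoly"
  assumes "p \<in> fibrewise_zero L"
  shows "p = (\<Sum>t\<in>keys p. monom t (lookup p t) - monom (normal_form L t) (lookup p t))"
proof -
  have pL: "keys t \<subseteq> L" if "t \<in> keys p" for t
    using fibrewise_zero_polys[OF assms] that by (auto simp: polys_def)
  have "(\<Sum>t\<in>keys p. monom (normal_form L t) (lookup p t)) = 0"
  proof (rule poly_mapping_eqI)
    fix c
    let ?\<psi> = "\<lambda>t. if normal_form L t = c then 1 else (0 :: 'k)"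
    have "ev ?\<psi> p = 0"
    proof (rule fibrewise_zeroD[OF assms])
      fix s t
      assume "keys s \<subseteq> L" "keys t \<subseteq> L" "same_fibre s t"
      from normal_form_eq[OF L this] show "?\<psi> s = ?\<psi> t" by simp
    qed
    then show "lookup (\<Sum>t\<in>keys p. monom (normal_form L t) (lookup p t)) c = lookup 0 c"
      by (simp add: lookup_sum lookup_monom ev_def when_def if_distrib cong: if_cong)
  qed
  then show ?thesis
    using monom_expand[of p] by (simp add: sum_subtractf)
qed

text \<open>The generators vanish fibrewise, and fibrewise zero polynomials form an ideal.
  Conversely, each summand of \<open>fibrewise_zero_expand\<close> telescopes along a straightening
  into multiples of generators.\<close>

theorem hibi_ideal_eq: "hibi_ideal L = (fibrewise_zero L :: (nat \<times> nat, 'k::field) mpoly set)"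
proof
  interpret R: cring "poly_ring L :: (nat \<times> nat, 'k) mpoly ring"
    by (rule poly_ring_cring)
  show "hibi_ideal L \<subseteq> (fibrewise_zero L :: (nat \<times> nat, 'k) mpoly set)"
    unfolding hibi_ideal_def
  proof (rule R.genideal_minimal[OF fibrewise_zero_ideal], clarify)
    fix a b :: "nat \<times> nat"
    assume ab: "a \<in> L" "b \<in> L" "\<not> a \<le> b" "\<not> b \<le> a"
    then have st: "straighten L (0 + (\<some> a + \<some> b)) (0 + (\<some> (inf a b) + \<some> (sup a b)))"
      by (intro straighten.intros) (simp_all add: incomp_def)
    from monom_diff_fibrewise_zero[OF straighten_keys[OF L st] straighten_same_fibre[OF st]]
    show "var a * var b - var (inf a b) * var (sup a b) \<in> (fibrewise_zero L :: (nat \<times> nat, 'k) mpoly set)"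
      by (simp add: hibi_generator)
  qed
  show "(fibrewise_zero L :: (nat \<times> nat, 'k) mpoly set) \<subseteq> hibi_ideal L"
  proof
    fix p :: "(nat \<times> nat, 'k) mpoly"
    assume p: "p \<in> fibrewise_zero L"
    have "(\<Sum>t\<in>A. monom t (lookup p t) - monom (normal_form L t) (lookup p t)) \<in> hibi_ideal L"
      if "finite A" "A \<subseteq> keys p" for A
      using that
    proof (induction A rule: finite_induct)
      case (insert t A)
      then have "keys t \<subseteq> L"
        using fibrewise_zero_polys[OF p] by (auto simp: polys_def)
      then have "monom t (lookup p t) - monom (normal_form L t) (lookup p t) \<in> hibi_ideal L"
        by (intro straighten_hibi normal_form(2) L)
      with insert show ?case by (simp add: hibi_closed(1))
    qed (simp add: hibi_closed(3))
    from this[of "keys p"] show "p \<in> hibi_ideal L"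
      using fibrewise_zero_expand[OF p] by simp
  qed
qed

lemma hibi_homogeneous_ideal: "homogeneous_ideal L (hibi_ideal L :: (nat \<times> nat, 'k::field) mpoly set)"
  unfolding homogeneous_ideal_def
proof (intro conjI ballI allI)
  show "(hibi_ideal L :: (nat \<times> nat, 'k) mpoly set) \<subseteq> polys L"
    unfolding hibi_ideal_eq using fibrewise_zero_polys by blast
  fix p :: "(nat \<times> nat, 'k) mpoly" and d
  assume "p \<in> hibi_ideal L"
  then have p: "p \<in> fibrewise_zero L" by (simp add: hibi_ideal_eq)
  have ev_filt: "ev \<psi> (filt P p) = ev (\<lambda>t. if P t then \<psi> t else 0) p" for \<psi> :: "_ \<Rightarrow> 'k" and P
    by (subst ev_superset[of "keys p"]) (auto simp: keys_filt lookup_filt ev_def when_def intro!: sum.cong)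
  have "filt (\<lambda>t. mdeg t = d) p \<in> fibrewise_zero L"
  proof (rule fibrewise_zeroI)
    show "filt (\<lambda>t. mdeg t = d) p \<in> polys L"
      using p by (simp add: fibrewise_zero_polys filt_polys)
    fix \<psi> :: "_ \<Rightarrow> 'k"
    assume \<psi>: "\<And>s t. keys s \<subseteq> L \<Longrightarrow> keys t \<subseteq> L \<Longrightarrow> same_fibre s t \<Longrightarrow> \<psi> s = \<psi> t"
    show "ev \<psi> (filt (\<lambda>t. mdeg t = d) p) = 0"
      unfolding ev_filt
    proof (rule fibrewise_zeroD[OF p])
      fix s t :: "nat \<times> nat \<Rightarrow>\<^sub>0 nat"
      assume st: "keys s \<subseteq> L" "keys t \<subseteq> L" "same_fibre s t"
      then show "(if mdeg s = d then \<psi> s else 0) = (if mdeg t = d then \<psi> t else 0)"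
        using \<psi>[OF st] same_fibre_mdeg[OF st(3)] by simp
    qed
  qed
  then show "filt (\<lambda>t. mdeg t = d) p \<in> hibi_ideal L"
    by (simp add: hibi_ideal_eq)
qed (simp_all add: hibi_closed)

end

section \<open>Potentials along the fibres\<close>

definition jump :: "('v \<Rightarrow> ('v, 'k::field) mpoly \<Rightarrow> 'k) \<Rightarrow> 'v \<Rightarrow> ('v \<Rightarrow>\<^sub>0 nat) \<Rightarrow> ('v \<Rightarrow>\<^sub>0 nat) \<Rightarrow> 'k" where
  "jump h v s t = h v (monom s 1 - monom t 1)"

text \<open>For a symmetric family the choice of the common variable does not matter, see \<open>edge_eq\<close> below.\<close>

definition edge :: "('v \<Rightarrow> ('v, 'k::field) mpoly \<Rightarrow> 'k) \<Rightarrow> ('v \<Rightarrow>\<^sub>0 nat) \<Rightarrow> ('v \<Rightarrow>\<^sub>0 nat) \<Rightarrow> 'k" where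
  "edge h s t = (let v = (SOME v. v \<in> keys s \<and> v \<in> keys t) in jump h v (s - \<some> v) (t - \<some> v))"

text \<open>A relation and not a function, because the sum could depend on the straightening path.
  That it does not from degree 4 on is \<open>total_unique\<close>, and the value is then the
  potential.\<close>

inductive total ::
  "'v::lattice set \<Rightarrow> ('v \<Rightarrow> ('v, 'k::field) mpoly \<Rightarrow> 'k) \<Rightarrow> ('v \<Rightarrow>\<^sub>0 nat) \<Rightarrow> 'k \<Rightarrow> bool"
  for L h where
  total_chain: "chain_monomial t \<Longrightarrow> total L h t 0"
| total_step: "straighten L t t' \<Longrightarrow> total L h t' x \<Longrightarrow> total L h t (edge h t t' + x)"

text \<open>The four points of the first clause put the comparison square of \<open>cone\<close>
  into \<open>L\<close>; one point mixed the other way serves as the cone point.\<close>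

definition crossing ::
  "(nat \<times> nat) set \<Rightarrow> nat \<times> nat \<Rightarrow> nat \<times> nat \<Rightarrow> nat \<times> nat \<Rightarrow> nat \<times> nat \<Rightarrow> bool" where
  "crossing L a b c d \<longleftrightarrow>
     (\<forall>u\<in>{fst c, fst d}. \<forall>w\<in>{snd a, snd b}. (u, w) \<in> L) \<and>
     (\<exists>u\<in>{fst a, fst b}. \<exists>w\<in>{snd c, snd d}. (u, w) \<in> L)"

context
  fixes L :: "(nat \<times> nat) set" and h :: "nat \<times> nat \<Rightarrow> (nat \<times> nat, 'k::field) mpoly \<Rightarrow> 'k"
  assumes L: "sublattice L" and h: "symmetric_family L (hibi_ideal L) h"
begin

private lemma diff_mem:
  "keys s \<subseteq> L \<Longrightarrow> keys t \<subseteq> L \<Longrightarrow> same_fibre s t \<Longrightarrow>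
    monom s c - monom t c \<in> (hibi_ideal L :: (nat \<times> nat, 'k) mpoly set)"
  by (simp add: hibi_ideal_eq[OF L] monom_diff_fibrewise_zero)

private lemma jump_add:
  assumes "v \<in> L" "keys s \<subseteq> L" "keys t \<subseteq> L" "keys u \<subseteq> L" "same_fibre s t" "same_fibre t u"
  shows "jump h v s t + jump h v t u = jump h v s u"
proof -
  have "h v ((monom s 1 - monom t 1) + (monom t 1 - monom u 1)) = jump h v s t + jump h v t u"
    using h assms diff_mem[of s t 1] diff_mem[of t u 1] unfolding symmetric_family_def jump_def by blast
  moreover have "(monom s 1 - monom t 1) + (monom t 1 - monom u 1) = (monom s 1 - monom u 1 :: (nat \<times> nat, 'k) mpoly)"
    by simp
  ultimately show ?thesis
    by (simp add: jump_def)
qed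

private lemma jump_swap:
  assumes "v \<in> L" "w \<in> L" "keys s \<subseteq> L" "keys t \<subseteq> L" "same_fibre s t"
  shows "jump h v (s + \<some> w) (t + \<some> w) = jump h w (s + \<some> v) (t + \<some> v)"
proof -
  have *: "var w * (monom s 1 - monom t 1) = (monom (s + \<some> w) 1 - monom (t + \<some> w) 1 :: (nat \<times> nat, 'k) mpoly)" for w
    by (simp add: var_monom right_diff_distrib monom_mult add.commute)
  have "h v (var w * (monom s 1 - monom t 1)) = h w (var v * (monom s 1 - monom t 1))"
    using h assms diff_mem[of s t 1] unfolding symmetric_family_def by blast
  then show ?thesis unfolding jump_def * .
qed

private lemma minus_unit_keys: "keys t \<subseteq> L \<Longrightarrow> keys (t - \<some> v) \<subseteq> L"
  by (auto simp: in_keys_iff lookup_minus)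

private lemma minus_unit_same_fibre:
  assumes "same_fibre s t" "v \<in> keys s" "v \<in> keys t"
  shows "same_fibre (s - \<some> v) (t - \<some> v)"
  using assms same_fibre_add_right[of "s - \<some> v" "\<some> v" "t - \<some> v"] by (simp add: minus_single_add)

text \<open>Two different common variables can both be divided out; the remaining difference lies in
  the ideal, and \<open>jump_swap\<close> trades one variable for the other.\<close>

private lemma edge_eq:
  assumes "keys s \<subseteq> L" "keys t \<subseteq> L" "same_fibre s t" "v \<in> keys s" "v \<in> keys t"
  shows "edge h s t = jump h v (s - \<some> v) (t - \<some> v)"
proof -
  define w where "w = (SOME v. v \<in> keys s \<and> v \<in> keys t)"
  have w: "w \<in> keys s" "w \<in> keys t"
    using someI[of "\<lambda>v. v \<in> keys s \<and> v \<in> keys t" v] assms(4,5) by (simp_all add: w_def)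
  have "jump h w (s - \<some> w) (t - \<some> w) = jump h v (s - \<some> v) (t - \<some> v)"
  proof (cases "w = v")
    case False
    let ?r = "\<lambda>u. u - \<some> v - \<some> w"
    have dec: "?r u + \<some> w = u - \<some> v" "?r u + \<some> v = u - \<some> w" if "v \<in> keys u" "w \<in> keys u" for u
      using that False
      by (auto intro!: poly_mapping_eqI simp: lookup_add lookup_minus lookup_single when_def in_keys_iff)
    have "same_fibre (?r s) (?r t)"
      using minus_unit_same_fibre[OF assms(3-5)] dec(1) assms(4,5) w
      by (metis same_fibre_add_right)
    then have "jump h v (?r s + \<some> w) (?r t + \<some> w) = jump h w (?r s + \<some> v) (?r t + \<some> v)"
      using assms w by (intro jump_swap minus_unit_keys) auto
    then show ?thesis
      using dec assms(4,5) w by simp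
  qed simp
  then show ?thesis
    by (simp add: edge_def w_def Let_def)
qed

text \<open>All three edges can be computed with the same \<open>v\<close> and become values of the
  one additive map \<open>h v\<close>. Variables shared only pairwise would give values of different
  maps.\<close>

private lemma edge_trans:
  assumes "keys s \<subseteq> L" "keys t \<subseteq> L" "keys u \<subseteq> L" "same_fibre s t" "same_fibre t u"
    and "v \<in> keys s" "v \<in> keys t" "v \<in> keys u"
  shows "edge h s t + edge h t u = edge h s u"
  using assms jump_add[of v "s - \<some> v" "t - \<some> v" "u - \<some> v"] edge_eq[of s t v] edge_eq[of t u v] edge_eq[of s u v]
    minus_unit_same_fibre minus_unit_keys same_fibre_trans[OF assms(4,5)]
  by auto

private lemma edge_self:
  assumes "keys t \<subseteq> L" "v \<in> keys t"
  shows "edge h t t = 0"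
proof -
  have "edge h t t + edge h t t = edge h t t + 0"
    unfolding add_0_right by (rule edge_trans[of t t t v]) (use assms in simp_all)
  then show ?thesis by (rule add_left_imp_eq)
qed

text \<open>The variable \<open>(x', Y')\<close> is a cone point: the square of monomials \<open>t0, t1, t3, t2\<close> is compared
  with the square \<open>T0, T1, T3, T2\<close> of monomials that are all divisible by this variable.\<close>

private lemma cone:
  assumes R: "(x, y) \<in> L" "(x, y') \<in> L" "(x', y) \<in> L" "(x', y') \<in> L"
    and R': "(X, Y) \<in> L" "(X, Y') \<in> L" "(X', Y) \<in> L" "(X', Y') \<in> L"
    and cross: "(X, y) \<in> L" "(X, y') \<in> L" "(X', y) \<in> L" "(X', y') \<in> L" "(x', Y') \<in> L"
  defines "A \<equiv> \<some> (x, y') + \<some> (x', y)" and "D \<equiv> \<some> (x, y) + \<some> (x', y')"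
    and "A' \<equiv> \<some> (X, Y') + \<some> (X', Y)" and "D' \<equiv> \<some> (X, Y) + \<some> (X', Y')"
  shows "edge h (A + A') (D + A') + edge h (D + A') (D + D') =
    edge h (A + A') (A + D') + edge h (A + D') (D + D')"
proof -
  define t0 t1 t2 t3 where t: "t0 = A + A'" "t1 = D + A'" "t2 = A + D'" "t3 = D + D'"
  \<comment> \<open>Each \<open>T\<close> arises from its \<open>t\<close> by exchanging the second
    coordinates of two factors so that \<open>(x', Y')\<close> appears; the other two factors
    survive and link \<open>t\<close> to \<open>T\<close>.\<close>
  define T0 where "T0 = \<some> (x', Y') + \<some> (x, y') + \<some> (X', Y) + \<some> (X, y)"
  define T1 where "T1 = \<some> (x', Y') + \<some> (x, y) + \<some> (X', Y) + \<some> (X, y')"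
  define T2 where "T2 = \<some> (x', Y') + \<some> (x, y') + \<some> (X, Y) + \<some> (X', y)"
  define T3 where "T3 = \<some> (x', Y') + \<some> (x, y) + \<some> (X, Y) + \<some> (X', y')"
  note defs = t A_def D_def A'_def D'_def T0_def T1_def T2_def T3_def
  define ok where "ok t \<longleftrightarrow> keys t \<subseteq> L \<and> same_fibre t0 t" for t
  have ok: "ok t0" "ok t1" "ok t2" "ok t3" "ok T0" "ok T1" "ok T2" "ok T3"
    using R R' cross by (simp_all add: ok_def defs keys_add_nat same_fibre_def wt_add add_ac)
  have fib: "same_fibre a b" if "ok a" "ok b" for a b
    using that unfolding ok_def by (blast intro: same_fibre_trans same_fibre_sym)
  have trans: "edge h a b + edge h b c = edge h a c"
    if "ok a" "ok b" "ok c" "v \<in> keys a" "v \<in> keys b" "v \<in> keys c" for a b c v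
    by (rule edge_trans[of a b c v]) (use that fib in \<open>simp_all add: ok_def\<close>)
  have path: "edge h a d = edge h a b + edge h b c + edge h c d"
    if "ok a" "ok b" "ok c" "ok d" "v \<in> keys a" "v \<in> keys b" "v \<in> keys c" "v \<in> keys d" for a b c d v
    using trans[OF that(1-3,5-7)] trans[OF that(1,3,4,5,7,8)] by simp
  \<comment> \<open>Every side is rerouted through the \<open>T\<close> square, the named variable
    dividing all four monomials of the detour. The spokes at the middle corners cancel by
    \<open>z1\<close> and \<open>z2\<close>, and the \<open>T\<close> square closes because
    \<open>(x', Y')\<close> divides all its corners.\<close>
  have e01: "edge h t0 t1 = edge h t0 T0 + edge h T0 T1 + edge h T1 t1"
    by (rule path[OF ok(1) ok(5) ok(6) ok(2), of "(X', Y)"]) (simp_all add: defs keys_add_nat)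
  have e13: "edge h t1 t3 = edge h t1 T1 + edge h T1 T3 + edge h T3 t3"
    by (rule path[OF ok(2) ok(6) ok(8) ok(4), of "(x, y)"]) (simp_all add: defs keys_add_nat)
  have e02: "edge h t0 t2 = edge h t0 T0 + edge h T0 T2 + edge h T2 t2"
    by (rule path[OF ok(1) ok(5) ok(7) ok(3), of "(x, y')"]) (simp_all add: defs keys_add_nat)
  have e23: "edge h t2 t3 = edge h t2 T2 + edge h T2 T3 + edge h T3 t3"
    by (rule path[OF ok(3) ok(7) ok(8) ok(4), of "(X, Y)"]) (simp_all add: defs keys_add_nat)
  have z1: "edge h T1 t1 + edge h t1 T1 = 0"
  proof -
    have v: "(x, y) \<in> keys T1" "(x, y) \<in> keys t1" by (simp_all add: defs keys_add_nat)
    show ?thesis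
      using trans[OF ok(6) ok(2) ok(6) v(1) v(2) v(1)] edge_self[OF _ v(1)] ok(6) by (simp add: ok_def)
  qed
  have z2: "edge h T2 t2 + edge h t2 T2 = 0"
  proof -
    have v: "(X, Y) \<in> keys T2" "(X, Y) \<in> keys t2" by (simp_all add: defs keys_add_nat)
    show ?thesis
      using trans[OF ok(7) ok(3) ok(7) v(1) v(2) v(1)] edge_self[OF _ v(1)] ok(7) by (simp add: ok_def)
  qed
  have T013: "edge h T0 T1 + edge h T1 T3 = edge h T0 T3"
    by (rule trans[OF ok(5) ok(6) ok(8), of "(x', Y')"]) (simp_all add: defs keys_add_nat)
  have T023: "edge h T0 T2 + edge h T2 T3 = edge h T0 T3"
    by (rule trans[OF ok(5) ok(7) ok(8), of "(x', Y')"]) (simp_all add: defs keys_add_nat)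
  have "edge h t0 t1 + edge h t1 t3 =
      edge h t0 T0 + (edge h T0 T1 + edge h T1 T3) + edge h T3 t3 + (edge h T1 t1 + edge h t1 T1)"
    unfolding e01 e13 by (simp only: add_ac)
  also have "\<dots> = edge h t0 T0 + (edge h T0 T2 + edge h T2 T3) + edge h T3 t3 + (edge h T2 t2 + edge h t2 T2)"
    by (simp only: z1 z2 T013 T023)
  also have "\<dots> = edge h t0 t2 + edge h t2 t3"
    unfolding e02 e23 by (simp only: add_ac)
  finally have "edge h t0 t1 + edge h t1 t3 = edge h t0 t2 + edge h t2 t3" .
  then show ?thesis by (simp add: t)
qed

private abbreviation anti :: "nat \<times> nat \<Rightarrow> nat \<times> nat \<Rightarrow> (nat \<times> nat \<Rightarrow>\<^sub>0 nat)" where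
  "anti a b \<equiv> \<some> a + \<some> b"

private abbreviation diag :: "nat \<times> nat \<Rightarrow> nat \<times> nat \<Rightarrow> (nat \<times> nat \<Rightarrow>\<^sub>0 nat)" where
  "diag a b \<equiv> \<some> (inf a b) + \<some> (sup a b)"

private definition square :: "nat \<times> nat \<Rightarrow> nat \<times> nat \<Rightarrow> nat \<times> nat \<Rightarrow> nat \<times> nat \<Rightarrow> bool" where
  "square a b c d \<longleftrightarrow>
     edge h (anti a b + anti c d) (diag a b + anti c d) + edge h (diag a b + anti c d) (diag a b + diag c d) =
     edge h (anti a b + anti c d) (anti a b + diag c d) + edge h (anti a b + diag c d) (diag a b + diag c d)"

private lemma diag_eq:
  assumes "incomp a b"
  shows "diag a b = \<some> (fst a, snd b) + \<some> (fst b, snd a)"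
proof -
  have "fst a < fst b \<and> snd b < snd a \<or> fst b < fst a \<and> snd a < snd b"
    using assms by (cases a; cases b) (auto simp: incomp_def)
  then show ?thesis
    by (cases a; cases b) (auto simp: inf_nat_def sup_nat_def add.commute)
qed

text \<open>This is \<open>cone\<close> with cone point \<open>(fst b, snd c)\<close>; the other
  possible cone points reduce to it by exchanging \<open>a\<close> with \<open>b\<close> or
  \<open>c\<close> with \<open>d\<close>.\<close>

private lemma crossing_square_aux:
  assumes "a \<in> L" "b \<in> L" "c \<in> L" "d \<in> L" "incomp a b" "incomp c d"
    and "\<forall>u\<in>{fst c, fst d}. \<forall>w\<in>{snd a, snd b}. (u, w) \<in> L"
    and "(fst b, snd c) \<in> L"
  shows "square a b c d"
proof -
  have L': "(fst a, snd b) \<in> L" "(fst b, snd a) \<in> L" "(fst c, snd d) \<in> L" "(fst d, snd c) \<in> L"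
  proof -
    have *: "(fst a, snd b) \<in> L \<and> (fst b, snd a) \<in> L" if "a \<in> L" "b \<in> L" "incomp a b" for a b
    proof -
      have "keys (diag a b) \<subseteq> L" using L that by (simp add: keys_add_nat sublattice_def)
      then show ?thesis using diag_eq[OF that(3)] by (simp add: keys_add_nat)
    qed
    show "(fst a, snd b) \<in> L" "(fst b, snd a) \<in> L" "(fst c, snd d) \<in> L" "(fst d, snd c) \<in> L"
      using * assms by blast+
  qed
  have "edge h (anti a b + anti c d) ((\<some> (fst a, snd b) + \<some> (fst b, snd a)) + anti c d) +
      edge h ((\<some> (fst a, snd b) + \<some> (fst b, snd a)) + anti c d)
        ((\<some> (fst a, snd b) + \<some> (fst b, snd a)) + (\<some> (fst c, snd d) + \<some> (fst d, snd c))) =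
      edge h (anti a b + anti c d) (anti a b + (\<some> (fst c, snd d) + \<some> (fst d, snd c))) +
      edge h (anti a b + (\<some> (fst c, snd d) + \<some> (fst d, snd c)))
        ((\<some> (fst a, snd b) + \<some> (fst b, snd a)) + (\<some> (fst c, snd d) + \<some> (fst d, snd c)))"
    using cone[of "fst a" "snd b" "snd a" "fst b" "fst c" "snd d" "snd c" "fst d"] assms L' by simp
  then show ?thesis
    unfolding square_def diag_eq[OF assms(5)] diag_eq[OF assms(6)] .
qed

private lemma crossing_square:
  assumes "a \<in> L" "b \<in> L" "c \<in> L" "d \<in> L" "incomp a b" "incomp c d" "crossing L a b c d"
  shows "square a b c d"
proof -
  have sym: "square b a c d \<Longrightarrow> square a b c d" "square a b d c \<Longrightarrow> square a b c d" for a b c d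
    by (simp_all add: square_def inf_commute sup_commute add.commute)
  have ic: "incomp b a" "incomp d c"
    using assms(5,6) by (auto simp: incomp_def)
  obtain u w where "u \<in> {fst a, fst b}" "w \<in> {snd c, snd d}" "(u, w) \<in> L"
    using assms(7) by (auto simp: crossing_def)
  then consider "(fst b, snd c) \<in> L" | "(fst a, snd c) \<in> L" | "(fst b, snd d) \<in> L" | "(fst a, snd d) \<in> L"
    by blast
  moreover have all: "\<forall>u\<in>{fst c, fst d}. \<forall>w\<in>{snd a, snd b}. (u, w) \<in> L"
    using assms(7) by (simp add: crossing_def)
  ultimately show ?thesis
  proof cases
    case 1
    with assms all show ?thesis by (intro crossing_square_aux)
  next
    case 2
    with assms all ic have "square b a c d" by (intro crossing_square_aux) auto
    then show ?thesis by (rule sym)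
  next
    case 3
    with assms all ic have "square a b d c" by (intro crossing_square_aux) auto
    then show ?thesis by (rule sym)
  next
    case 4
    with assms all ic have "square b a d c" by (intro crossing_square_aux) auto
    then show ?thesis by (rule sym(1)[OF sym(2)])
  qed
qed

text \<open>A straightening of \<open>s\<close> times \<open>v\<close> that never touches this
  factor \<open>v\<close> has edges that all share \<open>v\<close> and telescope into one. The
  uniqueness hypothesis identifies \<open>x\<close> with the sum along this particular path.\<close>

private lemma total_along:
  assumes "(straighten L)\<^sup>*\<^sup>* s c" "keys s \<subseteq> L" "v \<in> L" "4 \<le> mdeg (s + \<some> v)"
    and "\<And>u. spread u \<le> spread (s + \<some> v) \<Longrightarrow> keys u \<subseteq> L \<Longrightarrow> 4 \<le> mdeg u \<Longrightarrow> \<exists>!x. total L h u x"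
    and "total L h (s + \<some> v) x" "total L h (c + \<some> v) y"
  shows "x = edge h (s + \<some> v) (c + \<some> v) + y"
  using assms(1,2,4-6)
proof (induction arbitrary: x rule: converse_rtranclp_induct)
  case base
  have "keys (c + \<some> v) \<subseteq> L" using base.prems(1) assms(3) by (simp add: keys_add_nat)
  then have "\<exists>!x. total L h (c + \<some> v) x" using base.prems by blast
  then have "x = y" using base.prems(4) assms(7) by blast
  moreover have "edge h (c + \<some> v) (c + \<some> v) = 0"
    by (rule edge_self[of _ v]) (use \<open>keys (c + \<some> v) \<subseteq> L\<close> in \<open>simp_all add: keys_add_nat\<close>)
  ultimately show ?case by simp
next
  case (step s s1)
  have keys: "keys (s + \<some> v) \<subseteq> L" "keys s1 \<subseteq> L" "keys (s1 + \<some> v) \<subseteq> L"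
    using step.prems(1) straighten_keys[OF L step.hyps(1)] assms(3) by (simp_all add: keys_add_nat)
  have st: "straighten L (s + \<some> v) (s1 + \<some> v)"
    using step.hyps(1) assms(3) by (intro straighten_add) simp_all
  note less = straighten_spread[OF st] and fib = straighten_same_fibre[OF st]
  have deg: "4 \<le> mdeg (s1 + \<some> v)"
    using step.prems(2) same_fibre_mdeg[OF fib] by simp
  obtain x1 where x1: "total L h (s1 + \<some> v) x1"
    using step.prems(3)[OF less_imp_le[OF less] keys(3) deg] by blast
  have "x = edge h (s + \<some> v) (s1 + \<some> v) + x1"
    using step.prems(3)[OF order_refl keys(1) step.prems(2)] step.prems(4) total_step[OF st x1] by blast
  moreover have "x1 = edge h (s1 + \<some> v) (c + \<some> v) + y"
    using less by (intro step.IH keys deg x1 step.prems(3)) auto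
  moreover have "edge h (s + \<some> v) (s1 + \<some> v) + edge h (s1 + \<some> v) (c + \<some> v) = edge h (s + \<some> v) (c + \<some> v)"
    using straighten_star[OF L step.hyps(2) keys(2)] fib keys assms(3)
    by (intro edge_trans[of _ _ _ v]) (auto simp: keys_add_nat same_fibre_add_right)
  ultimately show ?case by (simp add: add.assoc[symmetric])
qed

section \<open>Path independence and the potential\<close>

context
  assumes cross: "\<And>a b c d. a \<in> L \<Longrightarrow> b \<in> L \<Longrightarrow> c \<in> L \<Longrightarrow> d \<in> L \<Longrightarrow> incomp a b \<Longrightarrow> incomp c d \<Longrightarrow>
    crossing L a b c d \<or> crossing L c d a b"
begin

private lemma square_all:
  assumes "a \<in> L" "b \<in> L" "c \<in> L" "d \<in> L" "incomp a b" "incomp c d"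
  shows "square a b c d"
proof -
  have swap: "square c d a b \<Longrightarrow> square a b c d"
    unfolding square_def by (simp only: add.commute[of "anti c d"] add.commute[of "diag c d"])
  from cross[OF assms] show ?thesis
  proof
    assume "crossing L a b c d"
    then show ?thesis by (rule crossing_square[OF assms])
  next
    assume "crossing L c d a b"
    then show ?thesis by (rule swap[OF crossing_square[OF assms(3,4,1,2,6,5)]])
  qed
qed

text \<open>Newman's lemma for the sums, by induction on \<open>spread\<close>: any two first steps
  must give equal totals. If their cofactors share a variable, the results meet over it; if not, the
  monomial is a product of two incomparable pairs and the square closes.\<close>

private lemma total_unique:
  assumes "keys t \<subseteq> L" "4 \<le> mdeg t"
  shows "\<exists>!x. total L h t x"
  using assms
proof (induction "spread t" arbitrary: t rule: less_induct)
  case less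
  show ?case
  proof (cases "chain_monomial t")
    case True
    have "x = 0" if "total L h t x" for x
      using that
    proof (cases rule: total.cases)
      case (total_step t' x')
      with True straighten_not_chain show ?thesis by blast
    qed
    with total_chain[OF True] show ?thesis by blast
  next
    case False
    have IH: "\<exists>!x. total L h u x" if "straighten L t t1" "spread u \<le> spread t1" "keys u \<subseteq> L" "4 \<le> mdeg u" for t1 u
      using less.hyps[of u] straighten_spread[OF that(1)] that by simp
    have unique: "edge h t t1 + x1 = edge h t t2 + x2"
      if st: "straighten L t t1" "straighten L t t2" and x: "total L h t1 x1" "total L h t2 x2" for t1 t2 x1 x2
    proof -
      obtain a b s1 where 1: "t = s1 + anti a b" "t1 = s1 + diag a b" "a \<in> L" "b \<in> L" "incomp a b" "keys s1 \<subseteq> L"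
        using st(1) by (cases rule: straighten.cases) blast
      obtain c d s2 where 2: "t = s2 + anti c d" "t2 = s2 + diag c d" "c \<in> L" "d \<in> L" "incomp c d" "keys s2 \<subseteq> L"
        using st(2) by (cases rule: straighten.cases) blast
      have keys: "keys t1 \<subseteq> L" "keys t2 \<subseteq> L"
        using straighten_keys[OF L] st by blast+
      have fib: "same_fibre t t1" "same_fibre t t2"
        using straighten_same_fibre st by blast+
      have deg: "4 \<le> mdeg t1" "4 \<le> mdeg t2"
        using less.prems(2) same_fibre_mdeg fib by metis+
      show ?thesis
      proof (cases "keys s1 \<inter> keys s2 = {}")
        case False
        then obtain v where v: "v \<in> keys s1" "v \<in> keys s2" by blast
        have vL: "v \<in> L" using v 1 by blast
        define u u1 u2 where u: "u = t - \<some> v" "u1 = (s1 - \<some> v) + diag a b" "u2 = (s2 - \<some> v) + diag c d"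
        have u_v: "u + \<some> v = t" "u1 + \<some> v = t1" "u2 + \<some> v = t2"
        proof -
          show "u + \<some> v = t"
            using v 1 by (simp add: u minus_single_add keys_add_nat)
          have "(s1 - \<some> v) + diag a b + \<some> v = ((s1 - \<some> v) + \<some> v) + diag a b"
            by (simp only: add_ac)
          then show "u1 + \<some> v = t1"
            using v by (simp add: u 1 minus_single_add)
          have "(s2 - \<some> v) + diag c d + \<some> v = ((s2 - \<some> v) + \<some> v) + diag c d"
            by (simp only: add_ac)
          then show "u2 + \<some> v = t2"
            using v by (simp add: u 2 minus_single_add)
        qed
        have ku: "keys u1 \<subseteq> L" "keys u2 \<subseteq> L"
          using keys u_v by (auto simp: keys_add_nat)
        have "same_fibre (u1 + \<some> v) (u2 + \<some> v)"
          unfolding u_v using fib same_fibre_sym same_fibre_trans by blast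
        then have "same_fibre u1 u2"
          by (simp only: same_fibre_add_right)
        then have nf: "normal_form L u1 = normal_form L u2"
          by (rule normal_form_eq[OF L ku])
        \<comment> \<open>Both quotients by \<open>v\<close> straighten to the same chain
          \<open>c\<close>. The meeting point \<open>c + \<some> v\<close> need not be a chain, but
          every monomial on the two routes keeps the factor \<open>v\<close>.\<close>
        define c where "c = normal_form L u1"
        have c: "(straighten L)\<^sup>*\<^sup>* u1 c" "(straighten L)\<^sup>*\<^sup>* u2 c" "keys (c + \<some> v) \<subseteq> L" "same_fibre t1 (c + \<some> v)"
          "spread (c + \<some> v) \<le> spread t1"
          unfolding c_def using normal_form[OF L ku(1)] normal_form[OF L ku(2)] nf vL
            straighten_star[OF L normal_form(2)[OF L ku(1)] ku(1)]
          by (auto simp: keys_add_nat u_v(2)[symmetric] same_fibre_add_right spread_def wt_add)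
        have "4 \<le> mdeg (c + \<some> v)"
          using deg(1) same_fibre_mdeg[OF c(4)] by simp
        then obtain z where z: "total L h (c + \<some> v) z"
          using IH[OF st(1) c(5,3)] by blast
        have x1: "x1 = edge h (u1 + \<some> v) (c + \<some> v) + z"
          by (rule total_along[OF c(1) ku(1) vL]) (use deg x z IH[OF st(1)] in \<open>simp_all add: u_v\<close>)
        have x2: "x2 = edge h (u2 + \<some> v) (c + \<some> v) + z"
          by (rule total_along[OF c(2) ku(2) vL]) (use deg x z IH[OF st(2)] in \<open>simp_all add: u_v\<close>)
        have vk: "v \<in> keys t" "v \<in> keys t1" "v \<in> keys t2" "v \<in> keys (c + \<some> v)"
          using v 1 2 by (auto simp: keys_add_nat)
        have "same_fibre t2 (c + \<some> v)"
          using c(4) fib same_fibre_sym same_fibre_trans by blast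
        then have "edge h t t1 + edge h t1 (c + \<some> v) = edge h t t2 + edge h t2 (c + \<some> v)"
          using edge_trans[of t t1 "c + \<some> v" v] edge_trans[of t t2 "c + \<some> v" v] keys less.prems(1) c fib vk by simp
        then show ?thesis
          unfolding x1 x2 u_v by (simp add: add.assoc[symmetric])
      next
        case True
        \<comment> \<open>Variables of \<open>s1\<close> do not occur in \<open>s2\<close>, so they
          must come from the pair \<open>c\<close>, \<open>d\<close>. As \<open>s1\<close> has
          degree at least 2, it is all of that pair; cancelling it leaves \<open>s2\<close> as the
          pair \<open>a\<close>, \<open>b\<close>, and the degree is exactly 4.\<close>
        have "lookup s1 u \<le> lookup (anti c d) u" for u
        proof (cases "u \<in> keys s1")
          case True
          with \<open>keys s1 \<inter> keys s2 = {}\<close> have "lookup s2 u = 0" by (auto simp: in_keys_iff)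
          moreover have "lookup (s1 + anti a b) u = lookup (s2 + anti c d) u"
            using 1(1) 2(1) by simp
          ultimately show ?thesis by (simp add: lookup_add)
        qed (simp add: in_keys_iff)
        then have split: "anti c d = s1 + (anti c d - s1)"
          by (intro poly_mapping_eqI) (simp add: lookup_add lookup_minus)
        have "mdeg t = mdeg s1 + 2"
          using 1 by (simp add: mdeg_add)
        then have "2 \<le> mdeg s1" using less.prems(2) by simp
        moreover have "mdeg s1 + mdeg (anti c d - s1) = 2"
          using arg_cong[OF split, of mdeg] by (simp only: mdeg_add mdeg_single)
        ultimately have "anti c d - s1 = 0"
          by (simp add: mdeg_eq_0_iff[symmetric])
        then have s1: "s1 = anti c d" using split by simp
        have s2: "s2 = anti a b"
        proof -
          have "anti c d + s2 = anti c d + anti a b"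
            using 1(1) 2(1) s1 by (simp add: add.commute)
          then show ?thesis by (rule add_left_imp_eq)
        qed
        define t3 where "t3 = diag a b + diag c d"
        have t: "t = anti a b + anti c d" "t1 = diag a b + anti c d" "t2 = anti a b + diag c d"
          using 1 2 s1 s2 by (simp_all add: add.commute)
        have kd: "keys (diag a b) \<subseteq> L" "keys (diag c d) \<subseteq> L"
          using L 1 2 by (simp_all add: keys_add_nat sublattice_def)
        have st3: "straighten L t1 t3" "straighten L t2 t3"
        proof -
          show "straighten L t1 t3"
            unfolding t t3_def by (rule straighten.intros[OF 2(3,4,5) kd(1)])
          have "straighten L (diag c d + anti a b) (diag c d + diag a b)"
            by (rule straighten.intros[OF 1(3,4,5) kd(2)])
          then show "straighten L t2 t3"
            unfolding t t3_def by (simp only: add.commute[of "diag c d"])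
        qed
        have k3: "keys t3 \<subseteq> L" using kd unfolding t3_def by (simp only: keys_add_nat[of "diag a b"]) simp
        have "4 \<le> mdeg t3"
          using deg(1) same_fibre_mdeg[OF straighten_same_fibre[OF st3(1)]] by simp
        then obtain z where z: "total L h t3 z"
          using IH[OF st(1) _ k3] straighten_spread[OF st3(1)] by auto
        have "x1 = edge h t1 t3 + z"
          using IH[OF st(1) order_refl keys(1) deg(1)] x(1) total_step[OF st3(1) z] by blast
        moreover have "x2 = edge h t2 t3 + z"
          using IH[OF st(2) order_refl keys(2) deg(2)] x(2) total_step[OF st3(2) z] by blast
        moreover have "edge h t t1 + edge h t1 t3 = edge h t t2 + edge h t2 t3"
          using square_all[of a b c d] 1 2 unfolding square_def t t3_def by simp
        ultimately show ?thesis by (simp add: add.assoc[symmetric])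
      qed
    qed
    obtain t1 where t1: "straighten L t t1"
      using straighten_exists False less.prems(1) by blast
    have k1: "keys t1 \<subseteq> L" and d1: "4 \<le> mdeg t1"
      using straighten_keys[OF L t1] same_fibre_mdeg[OF straighten_same_fibre[OF t1]] less.prems(2) by simp_all
    obtain x1 where x1: "total L h t1 x1"
      using IH[OF t1 order_refl k1 d1] by blast
    show ?thesis
    proof (rule ex1I)
      show "total L h t (edge h t t1 + x1)"
        using t1 x1 by (rule total_step)
      fix y assume "total L h t y"
      then show "y = edge h t t1 + x1"
        using False unique[OF _ t1 _ x1] by (auto elim: total.cases)
    qed
  qed
qed

private definition potential :: "(nat \<times> nat \<Rightarrow>\<^sub>0 nat) \<Rightarrow> 'k" where
  "potential t = (THE x. total L h t x)"

text \<open>\<open>s\<close> and \<open>s'\<close> straighten to the same chain \<open>c\<close>,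
  and \<open>total_along\<close> compares each of them, multiplied by \<open>v\<close>, with
  \<open>c\<close> times \<open>v\<close>. The gain is that one potential serves all
  \<open>v\<close>.\<close>

private lemma jump_potential:
  assumes "v \<in> L" "keys s \<subseteq> L" "keys s' \<subseteq> L" "same_fibre s s'" "3 \<le> mdeg s"
  shows "jump h v s s' = potential (s + \<some> v) - potential (s' + \<some> v)"
proof -
  define c where "c = normal_form L s"
  have total: "total L h t (potential t)" if "keys t \<subseteq> L" "4 \<le> mdeg t" for t
    unfolding potential_def by (rule theI'[OF total_unique[OF that]])
  have along: "potential (u + \<some> v) = jump h v u c + potential (c + \<some> v)"
    if u: "(straighten L)\<^sup>*\<^sup>* u c" "keys u \<subseteq> L" "3 \<le> mdeg u" for u
  proof -
    have c: "keys c \<subseteq> L" "same_fibre u c"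
      using straighten_star[OF L u(1,2)] by auto
    have k: "keys (u + \<some> v) \<subseteq> L" "keys (c + \<some> v) \<subseteq> L"
      using c u assms(1) by (simp_all add: keys_add_nat)
    have d: "4 \<le> mdeg (u + \<some> v)" "4 \<le> mdeg (c + \<some> v)"
      using u(3) same_fibre_mdeg[OF c(2)] by (simp_all add: mdeg_add)
    have "potential (u + \<some> v) = edge h (u + \<some> v) (c + \<some> v) + potential (c + \<some> v)"
      by (rule total_along[OF u(1,2) assms(1) d(1) total_unique total[OF k(1) d(1)] total[OF k(2) d(2)]])
    moreover have "edge h (u + \<some> v) (c + \<some> v) = jump h v u c"
      using edge_eq[of "u + \<some> v" "c + \<some> v" v] k c by (simp add: keys_add_nat same_fibre_add_right)
    ultimately show ?thesis by simp
  qed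
  have "normal_form L s' = c"
    unfolding c_def using normal_form_eq[OF L assms(2,3,4)] by simp
  then have sc: "(straighten L)\<^sup>*\<^sup>* s c" "(straighten L)\<^sup>*\<^sup>* s' c" "keys c \<subseteq> L" "same_fibre s' c"
    using normal_form[OF L assms(2)] normal_form[OF L assms(3)] by (auto simp: c_def)
  moreover have "3 \<le> mdeg s'"
    using assms(5) same_fibre_mdeg[OF assms(4)] by simp
  moreover have "jump h v s s' + jump h v s' c = jump h v s c"
    using assms sc by (intro jump_add)
  ultimately show ?thesis
    using along[of s] along[of s'] assms by (simp add: algebra_simps)
qed

lemma symmetric_family_vanishing:
  assumes f: "\<And>v. v \<in> L \<Longrightarrow> f v \<in> hibi_ideal L" and deg: "\<And>v t. v \<in> L \<Longrightarrow> t \<in> keys (f v) \<Longrightarrow> 3 \<le> mdeg t"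
    and zero: "(\<Sum>v\<in>L. var v * f v) = 0"
  shows "(\<Sum>v\<in>L. h v (f v)) = 0"
proof -
  have "h v (f v) = ev (\<lambda>s. potential (\<some> v + s)) (f v)" if v: "v \<in> L" for v
  proof -
    let ?nf = "normal_form L"
    have fz: "f v \<in> fibrewise_zero L"
      using f[OF v] by (simp add: hibi_ideal_eq[OF L])
    have kL: "keys s \<subseteq> L" if "s \<in> keys (f v)" for s
      using that fibrewise_zero_polys[OF fz] by (auto simp: polys_def)
    have one: "h v (monom s c - monom (?nf s) c) = c * (potential (\<some> v + s) - potential (\<some> v + ?nf s))"
      if s: "s \<in> keys (f v)" for s c
    proof -
      note nf = normal_form[OF L kL[OF s]]
      have "h v (monom 0 c * (monom s 1 - monom (?nf s) 1)) = c * jump h v s (?nf s)"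
        using h v diff_mem[OF kL[OF s] nf(3,4)] unfolding symmetric_family_def jump_def by blast
      moreover have "jump h v s (?nf s) = potential (s + \<some> v) - potential (?nf s + \<some> v)"
        by (rule jump_potential[OF v kL[OF s] nf(3,4) deg[OF v s]])
      ultimately show ?thesis
        by (simp add: right_diff_distrib monom_mult add.commute)
    qed
    have "h v (f v) = h v (\<Sum>s\<in>keys (f v). monom s (lookup (f v) s) - monom (?nf s) (lookup (f v) s))"
      using fibrewise_zero_expand[OF L fz] by simp
    also have "\<dots> = (\<Sum>s\<in>keys (f v). h v (monom s (lookup (f v) s) - monom (?nf s) (lookup (f v) s)))"
    proof (intro conjunct1[OF symmetric_family_sum[OF h hibi_homogeneous_ideal[OF L] v]])
      fix s assume "s \<in> keys (f v)"
      from kL[OF this] normal_form(3,4)[OF L kL[OF this]]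
      show "monom s (lookup (f v) s) - monom (?nf s) (lookup (f v) s) \<in> hibi_ideal L"
        by (rule diff_mem)
    qed
    also have "\<dots> = ev (\<lambda>s. potential (\<some> v + s) - potential (\<some> v + ?nf s)) (f v)"
      by (simp add: one ev_def)
    also have "\<dots> = ev (\<lambda>s. potential (\<some> v + s)) (f v) - ev (\<lambda>s. potential (\<some> v + ?nf s)) (f v)"
      by (rule ev_fun_diff)
    \<comment> \<open>The normal form is constant on fibres, and \<open>f v\<close> vanishes
      fibrewise.\<close>
    also have "ev (\<lambda>s. potential (\<some> v + ?nf s)) (f v) = 0"
    proof (rule fibrewise_zeroD[OF fz])
      fix s t :: "nat \<times> nat \<Rightarrow>\<^sub>0 nat"
      assume "keys s \<subseteq> L" "keys t \<subseteq> L" "same_fibre s t"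
      from normal_form_eq[OF L this] show "potential (\<some> v + ?nf s) = potential (\<some> v + ?nf t)" by simp
    qed
    finally show ?thesis by simp
  qed
  then have "(\<Sum>v\<in>L. h v (f v)) = (\<Sum>v\<in>L. ev (\<lambda>s. potential (\<some> v + s)) (f v))"
    by simp
  also have "\<dots> = ev potential (\<Sum>v\<in>L. var v * f v)"
    by (simp add: ev_sum var_monom ev_monom_mult)
  finally show ?thesis by (simp add: zero)
qed

end

end

section \<open>Planar distributive lattices with linear relations\<close>

text \<open>Along the chain the coordinate sum rises by exactly one per step, so it takes every
  value between those of \<open>a\<close> and \<open>b\<close>.\<close>

lemma planar_between:
  assumes L: "planar_distributive_lattice L" and ab: "a \<in> L" "b \<in> L" "a \<le> b"
    and d: "fst a + snd a \<le> d" "d \<le> fst b + snd b"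
  shows "\<exists>c\<in>L. a \<le> c \<and> c \<le> b \<and> fst c + snd c = d"
proof -
  obtain t x where x: "x 0 = a" "x t = b" "\<forall>s\<le>t. x s \<in> L"
    "\<forall>s<t. x s < x (Suc s) \<and> fst (x (Suc s)) + snd (x (Suc s)) = fst (x s) + snd (x s) + 1"
    using L ab unfolding planar_distributive_lattice_def by blast
  have up: "a \<le> x s \<and> fst (x s) + snd (x s) = fst a + snd a + s" if "s \<le> t" for s
    using that
  proof (induction s)
    case (Suc s)
    then have "x s < x (Suc s)" "fst (x (Suc s)) + snd (x (Suc s)) = fst (x s) + snd (x s) + 1"
      using x(4) by auto
    moreover have "a \<le> x s" "fst (x s) + snd (x s) = fst a + snd a + s"
      using Suc by auto
    ultimately show ?case by (simp add: order.trans[OF _ less_imp_le])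
  qed (simp add: x)
  have down: "x (t - s) \<le> b" for s
  proof (induction s)
    case (Suc s)
    show ?case
    proof (cases "s < t")
      case True
      then have "x (t - Suc s) < x (Suc (t - Suc s))" "Suc (t - Suc s) = t - s"
        using x(4) by auto
      with Suc show ?thesis by (metis less_imp_le order.trans)
    qed (use Suc in simp)
  qed (simp add: x)
  let ?s = "d - (fst a + snd a)"
  have "?s \<le> t"
    using up[of t] d x(2) by simp
  then show ?thesis
    using up[of ?s] down[of "t - ?s"] x(3) d by (intro bexI[of _ "x ?s"]) auto
qed

lemma crossing_commute: "crossing L a b c d \<Longrightarrow> crossing L b a c d" "crossing L a b c d \<Longrightarrow> crossing L a b d c"
  by (auto simp: crossing_def)

text \<open>\<open>crossing\<close> is symmetric within each pair, so \<open>a\<close> and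
  \<open>c\<close> may be taken as the upper left members.\<close>

lemma crossing_if_oriented:
  assumes "\<And>a b c d. a \<in> L \<Longrightarrow> b \<in> L \<Longrightarrow> c \<in> L \<Longrightarrow> d \<in> L \<Longrightarrow> fst a < fst b \<Longrightarrow> snd b < snd a \<Longrightarrow>
      fst c < fst d \<Longrightarrow> snd d < snd c \<Longrightarrow> crossing L a b c d \<or> crossing L c d a b"
    and "a \<in> L" "b \<in> L" "c \<in> L" "d \<in> L" "incomp a b" "incomp c d"
  shows "crossing L a b c d \<or> crossing L c d a b"
proof -
  have "fst a < fst b \<and> snd b < snd a \<or> fst b < fst a \<and> snd a < snd b"
    "fst c < fst d \<and> snd d < snd c \<or> fst d < fst c \<and> snd c < snd d"
    using assms(6,7) by (auto simp: incomp_def less_eq_prod_def not_le)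
  then show ?thesis
    using assms(1)[of a b c d] assms(1)[of b a c d] assms(1)[of a b d c] assms(1)[of b a d c] assms(2-5)
      crossing_commute by meson
qed

text \<open>The product of the antidiagonal pairs of the two corner squares, hence of the leading
  terms of the two corner generators.\<close>

definition corner_monomial :: "nat \<Rightarrow> nat \<Rightarrow> (nat \<times> nat \<Rightarrow>\<^sub>0 nat)" where
  "corner_monomial m n = (\<some> (0, 1) + \<some> (1, 0)) + (\<some> (m - 1, n) + \<some> (m, n - 1))"

lemma wt_indicator_unique:
  assumes "wt (\<lambda>v. if P v then 1 else 0) t = 1" "x \<in> keys t" "y \<in> keys t" "P x" "P y"
  shows "x = y"
proof (rule ccontr)
  assume "x \<noteq> y"
  have "(\<Sum>v\<in>{x, y}. lookup t v * (if P v then 1 else 0)) \<le> wt (\<lambda>v. if P v then 1 else 0) t"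
    unfolding wt_def using assms by (intro sum_mono2) auto
  moreover have "0 < lookup t x" "0 < lookup t y"
    using assms by (auto simp: in_keys_iff)
  ultimately show False
    using assms \<open>x \<noteq> y\<close> by simp
qed

lemma card_keys_le_mdeg: "card (keys t) \<le> mdeg t"
proof -
  have "(\<Sum>v\<in>keys t. 1) \<le> (\<Sum>v\<in>keys t. lookup t v)"
    by (rule sum_mono) (simp add: in_keys_iff)
  then show ?thesis by (simp add: mdeg_def)
qed

context
  fixes m n :: nat and L :: "(nat \<times> nat) set"
  assumes m: "m \<ge> 2" and n: "n \<ge> 2"
    and planar: "planar_distributive_lattice L"
    and box: "L \<subseteq> {(0, 0)..(m, n)}"
    and sw: "{(0, 0), (1, 0), (0, 1), (1, 1)} \<subseteq> L"
    and ne: "{(m - 1, n - 1), (m, n - 1), (m - 1, n), (m, n)} \<subseteq> L"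
begin

section \<open>Shape of the lattice, and sufficiency of (i) and (ii)\<close>

private lemma lattice: "sublattice L" and finite: "finite L"
  using planar unfolding planar_distributive_lattice_def sublattice_def by blast+

private lemma box_le: "(i, j) \<in> L \<Longrightarrow> i \<le> m \<and> j \<le> n"
  using box by auto

private lemma inf_mem: "(i, j) \<in> L \<Longrightarrow> (k, l) \<in> L \<Longrightarrow> (min i k, min j l) \<in> L"
  and sup_mem: "(i, j) \<in> L \<Longrightarrow> (k, l) \<in> L \<Longrightarrow> (max i k, max j l) \<in> L"
  using lattice unfolding sublattice_def by (force simp: inf_nat_def sup_nat_def)+

private lemma min_facts: "min 1 (m - 1) = 1" "min 1 (n - 1) = 1" "min m (m - 1) = m - 1" "min n (n - 1) = n - 1"
  using m n by (auto simp: min_def)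

text \<open>An element between two points of one column lies in that column, so
  \<open>planar_between\<close> leaves no gaps.\<close>

private lemma column_mem:
  assumes "(i, j) \<in> L" "(i, l) \<in> L" "j \<le> k" "k \<le> l"
  shows "(i, k) \<in> L"
proof -
  obtain c where "c \<in> L" "(i, j) \<le> c" "c \<le> (i, l)" "fst c + snd c = i + k"
    using planar_between[OF planar assms(1,2), of "i + k"] assms(3,4) by auto
  then show ?thesis by (cases c) auto
qed

private lemma row_mem:
  assumes "(i, j) \<in> L" "(l, j) \<in> L" "i \<le> k" "k \<le> l"
  shows "(k, j) \<in> L"
proof -
  obtain c where "c \<in> L" "(i, j) \<le> c" "c \<le> (l, j)" "fst c + snd c = k + j"
    using planar_between[OF planar assms(1,2), of "k + j"] assms(3,4) by auto
  then show ?thesis by (cases c) auto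
qed

text \<open>With \<open>(m, 0)\<close> the bottom row and the right column are full, so
  \<open>L\<close> is closed under steps right and down inside the box. With
  \<open>(1, n - 1)\<close>, points can be missing only in column 0 and row
  \<open>n\<close>.\<close>

private lemma crossing_south_east:
  assumes "(m, 0) \<in> L" "(1, n - 1) \<in> L"
    and "a \<in> L" "b \<in> L" "c \<in> L" "d \<in> L" "fst a < fst b" "snd b < snd a" "fst c < fst d" "snd d < snd c"
  shows "crossing L a b c d \<or> crossing L c d a b"
proof -
  have closed: "(i', j') \<in> L" if "(i, j) \<in> L" "i \<le> i'" "i' \<le> m" "j' \<le> j" for i j i' j'
  proof -
    have "(i', 0) \<in> L" "(m, j') \<in> L"
      using row_mem[of 0 0 m i'] column_mem[of m 0 n j'] assms(1) sw ne that box_le[OF that(1)] by auto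
    from inf_mem[OF sup_mem[OF that(1) this(1)] this(2)] that show ?thesis by simp
  qed
  obtain x1 y2 x2 y1 X1 Y2 X2 Y1 where ab: "a = (x1, y2)" "b = (x2, y1)" "c = (X1, Y2)" "d = (X2, Y1)"
    by (cases a; cases b; cases c; cases d)
  have ord: "x1 < x2" "y1 < y2" "X1 < X2" "Y1 < Y2" "x2 \<le> m" "X2 \<le> m" "y2 \<le> n" "Y2 \<le> n"
    using assms(3-) box_le by (auto simp: ab)
  have inner: "(i, j) \<in> L" if "1 \<le> i" "i \<le> m" "j \<le> n - 1" for i j
    using closed[OF assms(2)] that by simp
  \<comment> \<open>The upper left mixed points are the critical ones. If neither is covered by
    \<open>inner\<close>, then one of them equals \<open>a\<close> or \<open>c\<close>, or
    \<open>a\<close> or \<open>c\<close> is the corner \<open>(0, n)\<close> and \<open>L\<close> is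
    the whole box.\<close>
  have "(X1, y2) \<in> L \<or> (x1, Y2) \<in> L"
  proof (cases "(1 \<le> X1 \<and> y2 \<le> n - 1) \<or> (1 \<le> x1 \<and> Y2 \<le> n - 1)")
    case True
    then show ?thesis using inner ord by auto
  next
    case False
    then have "X1 = 0 \<or> y2 = n" "x1 = 0 \<or> Y2 = n"
      using ord by auto
    then show ?thesis
      using assms(3,5) closed[of 0 n X1 y2] ord by (auto simp: ab)
  qed
  moreover have "crossing L a b c d" if "(X1, y2) \<in> L"
    using closed[OF that] inner[of x2 Y1] ord by (auto simp: crossing_def ab)
  moreover have "crossing L c d a b" if "(x1, Y2) \<in> L"
    using closed[OF that] inner[of X2 y1] ord by (auto simp: crossing_def ab)
  ultimately show ?thesis by blast
qed

text \<open>The transpose of \<open>crossing_south_east\<close>: \<open>L\<close> is closed under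
  steps left and up, and only row 0 and column \<open>m\<close> can be incomplete.\<close>

private lemma crossing_north_west:
  assumes "(0, n) \<in> L" "(m - 1, 1) \<in> L"
    and "a \<in> L" "b \<in> L" "c \<in> L" "d \<in> L" "fst a < fst b" "snd b < snd a" "fst c < fst d" "snd d < snd c"
  shows "crossing L a b c d \<or> crossing L c d a b"
proof -
  have closed: "(i', j') \<in> L" if "(i, j) \<in> L" "i' \<le> i" "j \<le> j'" "j' \<le> n" for i j i' j'
  proof -
    have "(0, j') \<in> L" "(i', n) \<in> L"
      using column_mem[of 0 0 n j'] row_mem[of 0 n m i'] assms(1) sw ne that box_le[OF that(1)] by auto
    from inf_mem[OF sup_mem[OF that(1) this(1)] this(2)] that show ?thesis by simp
  qed
  obtain x1 y2 x2 y1 X1 Y2 X2 Y1 where ab: "a = (x1, y2)" "b = (x2, y1)" "c = (X1, Y2)" "d = (X2, Y1)"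
    by (cases a; cases b; cases c; cases d)
  have ord: "x1 < x2" "y1 < y2" "X1 < X2" "Y1 < Y2" "x2 \<le> m" "X2 \<le> m" "y2 \<le> n" "Y2 \<le> n"
    using assms(3-) box_le by (auto simp: ab)
  have inner: "(i, j) \<in> L" if "i \<le> m - 1" "1 \<le> j" "j \<le> n" for i j
    using closed[OF assms(2)] that by simp
  have "(X2, y1) \<in> L \<or> (x2, Y1) \<in> L"
  proof (cases "(1 \<le> y1 \<and> X2 \<le> m - 1) \<or> (1 \<le> Y1 \<and> x2 \<le> m - 1)")
    case True
    then show ?thesis using inner ord by auto
  next
    case False
    then have "y1 = 0 \<or> X2 = m" "Y1 = 0 \<or> x2 = m"
      using ord by auto
    then show ?thesis
      using assms(4,6) closed[of m 0 X2 y1] ord by (auto simp: ab)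
  qed
  moreover have "crossing L a b c d" if "(X2, y1) \<in> L"
    using closed[OF that] inner[of x1 Y2] ord by (auto simp: crossing_def ab)
  moreover have "crossing L c d a b" if "(x2, Y1) \<in> L"
    using closed[OF that] inner[of X1 y2] ord by (auto simp: crossing_def ab)
  ultimately show ?thesis by blast
qed

private lemma linearly_related_if:
  assumes "(m, 0) \<in> L \<or> (0, n) \<in> L" "(1, n - 1) \<in> L" "(m - 1, 1) \<in> L"
  shows "linearly_related L (hibi_ideal L :: (nat \<times> nat, 'k::field) mpoly set)"
proof -
  have cross: "crossing L a b c d \<or> crossing L c d a b"
    if "a \<in> L" "b \<in> L" "c \<in> L" "d \<in> L" "incomp a b" "incomp c d" for a b c d
    using assms(1)
  proof
    assume "(m, 0) \<in> L"
    from crossing_if_oriented[OF crossing_south_east[OF this assms(2)] that] show ?thesis .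
  next
    assume "(0, n) \<in> L"
    from crossing_if_oriented[OF crossing_north_west[OF this assms(3)] that] show ?thesis .
  qed
  have "betti L (hibi_ideal L :: (nat \<times> nat, 'k) mpoly set) 1 j = 0" if j4: "4 \<le> j" for j
  proof -
    obtain j' where j: "j = Suc j'" "3 \<le> j'" using j4 by (cases j) auto
    show ?thesis
      unfolding j(1) betti_one_zero_iff[OF finite hibi_homogeneous_ideal[OF lattice]]
    proof (intro allI impI)
      fix h :: "nat \<times> nat \<Rightarrow> (nat \<times> nat, 'k) mpoly \<Rightarrow> 'k" and f :: "nat \<times> nat \<Rightarrow> (nat \<times> nat, 'k) mpoly"
      assume h: "symmetric_family L (hibi_ideal L) h"
        and f: "\<forall>v\<in>L. f v \<in> hibi_ideal L \<and> (\<forall>t\<in>keys (f v). mdeg t = j')"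
        and zero: "(\<Sum>v\<in>L. var v * f v) = 0"
      show "(\<Sum>v\<in>L. h v (f v)) = 0"
        by (rule symmetric_family_vanishing[OF lattice h cross _ _ zero]) (use f j in auto)
    qed
  qed
  then show ?thesis by (simp add: linearly_related_def)
qed

section \<open>Necessity: the fibre of the corner monomial\<close>

private abbreviation (input) fibre :: "(nat \<times> nat \<Rightarrow>\<^sub>0 nat) \<Rightarrow> bool" where
  "fibre t \<equiv> keys t \<subseteq> L \<and> same_fibre t (corner_monomial m n)"

text \<open>The first coordinates 0 and \<open>m\<close> and the second coordinates 0 and
  \<open>n\<close> occur exactly once each in the corner monomial, even if \<open>m = 2\<close> or
  \<open>n = 2\<close>, when the coordinate 1 occurs twice.\<close>

private lemma fibre_unique:
  assumes "fibre t" "x \<in> keys t" "y \<in> keys t"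
    and "fst x = 0 \<and> fst y = 0 \<or> fst x = m \<and> fst y = m \<or> snd x = 0 \<and> snd y = 0 \<or> snd x = n \<and> snd y = n"
  shows "x = y"
proof -
  have one: "wt (\<lambda>v. if fst v = 0 then 1 else 0) t = 1" "wt (\<lambda>v. if fst v = m then 1 else 0) t = 1"
    "wt (\<lambda>v. if snd v = 0 then 1 else 0) t = 1" "wt (\<lambda>v. if snd v = n then 1 else 0) t = 1"
    using assms(1) m n by (auto simp: same_fibre_def corner_monomial_def wt_add)
  note u = one[THEN wt_indicator_unique, OF assms(2,3)]
  from assms(4) show ?thesis
    by (elim disjE conjE) (rule u, assumption+)+
qed

private lemma fibre_exists:
  assumes "fibre t" "i \<in> {0, 1, m - 1, m}" "j \<in> {0, 1, n - 1, n}"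
  shows "\<exists>x\<in>keys t. fst x = i" "\<exists>x\<in>keys t. snd x = j"
  using assms unfolding same_fibre_def wt_indicator_pos[symmetric]
  by (auto simp: corner_monomial_def wt_add)

private lemma fibre_coordinates:
  assumes "fibre t" "x \<in> keys t"
  shows "fst x \<in> {0, 1, m - 1, m}" "snd x \<in> {0, 1, n - 1, n}"
proof -
  have "(\<exists>y\<in>keys t. fst y = i) \<longleftrightarrow> (\<exists>y\<in>keys (corner_monomial m n). fst y = i)"
    "(\<exists>y\<in>keys t. snd y = i) \<longleftrightarrow> (\<exists>y\<in>keys (corner_monomial m n). snd y = i)" for i
    using assms(1) unfolding same_fibre_def wt_indicator_pos[symmetric] by simp_all
  then have "\<exists>y\<in>keys (corner_monomial m n). fst y = fst x" "\<exists>y\<in>keys (corner_monomial m n). snd y = snd x"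
    using assms(2) by blast+
  then show "fst x \<in> {0, 1, m - 1, m}" "snd x \<in> {0, 1, n - 1, n}"
    by (auto simp: corner_monomial_def keys_add_nat)
qed

text \<open>If \<open>(1, n - 1)\<close> is missing, so are \<open>(0, n - 1)\<close>,
  \<open>(1, n)\<close> and \<open>(0, n)\<close>, by joins and meets with vertices of the corner
  squares. A factor \<open>(m, 0)\<close> would use up the second coordinate 0, leaving only the
  second coordinate 1 for the factors with first coordinates 0 and 1; but it occurs just once. The
  case of \<open>(m - 1, 1)\<close> is the transpose.\<close>

private lemma fibre_avoids_corners:
  assumes "\<not> (((m, 0) \<in> L \<or> (0, n) \<in> L) \<and> (1, n - 1) \<in> L \<and> (m - 1, 1) \<in> L)" and t: "fibre t"
  shows "(m, 0) \<notin> keys t \<and> (0, n) \<notin> keys t"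
proof -
  consider "(m, 0) \<notin> L" "(0, n) \<notin> L" | "(1, n - 1) \<notin> L" | "(m - 1, 1) \<notin> L"
    using assms(1) by blast
  then show ?thesis
  proof cases
    case 1
    with t show ?thesis by blast
  next
    case 2
    \<comment> \<open>For \<open>m = 2\<close> or \<open>n = 2\<close> the point
      \<open>(1, n - 1)\<close> is a vertex of a corner square.\<close>
    have "m \<noteq> 2" "n \<noteq> 2" using 2 sw ne by (auto simp: One_nat_def)
    then have mn: "m \<ge> 3" "n \<ge> 3" using m n by auto
    have out: "(0, n - 1) \<notin> L" "(1, n) \<notin> L" "(0, n) \<notin> L"
      using sup_mem[of 0 "n - 1" 1 0] inf_mem[of 1 n "m - 1" "n - 1"] inf_mem[of 0 n "m - 1" "n - 1"]
        2 sw ne mn by (auto simp: min_facts)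
    moreover have "(m, 0) \<notin> keys t"
    proof
      assume m0: "(m, 0) \<in> keys t"
      have one: "wt (\<lambda>v. if snd v = 1 then 1 else 0) t = 1"
        using t mn by (auto simp: same_fibre_def corner_monomial_def wt_add)
      obtain p q where p: "p \<in> keys t" "fst p = 0" and q: "q \<in> keys t" "fst q = 1"
        using fibre_exists(1)[OF t, of 0 0] fibre_exists(1)[OF t, of 1 0] by auto
      have "x = (m, 0)" if "x \<in> keys t" "snd x = 0" for x
        using fibre_unique[OF t that(1) m0] that(2) by simp
      then have "snd p \<noteq> 0" "snd q \<noteq> 0"
        using p q mn by fastforce+
      moreover have "snd p \<notin> {n - 1, n}" "snd q \<notin> {n - 1, n}"
        using p q t 2 out by (cases p; cases q; auto)+
      ultimately have "snd p = 1" "snd q = 1"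
        using fibre_coordinates(2)[OF t p(1)] fibre_coordinates(2)[OF t q(1)] by auto
      with wt_indicator_unique[OF one p(1) q(1)] p q show False by simp
    qed
    ultimately show ?thesis using t by blast
  next
    case 3
    have "m \<noteq> 2" "n \<noteq> 2" using 3 sw ne by (auto simp: One_nat_def)
    then have mn: "m \<ge> 3" "n \<ge> 3" using m n by auto
    have out: "(m - 1, 0) \<notin> L" "(m, 1) \<notin> L" "(m, 0) \<notin> L"
      using sup_mem[of "m - 1" 0 0 1] inf_mem[of m 1 "m - 1" "n - 1"] inf_mem[of m 0 "m - 1" "n - 1"]
        3 sw ne mn by (auto simp: min_facts)
    moreover have "(0, n) \<notin> keys t"
    proof
      assume n0: "(0, n) \<in> keys t"
      have one: "wt (\<lambda>v. if fst v = 1 then 1 else 0) t = 1"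
        using t mn by (auto simp: same_fibre_def corner_monomial_def wt_add)
      obtain p q where p: "p \<in> keys t" "snd p = 0" and q: "q \<in> keys t" "snd q = 1"
        using fibre_exists(2)[OF t, of 0 0] fibre_exists(2)[OF t, of 0 1] by auto
      have "x = (0, n)" if "x \<in> keys t" "fst x = 0" for x
        using fibre_unique[OF t that(1) n0] that(2) by simp
      then have "fst p \<noteq> 0" "fst q \<noteq> 0"
        using p q mn by fastforce+
      moreover have "fst p \<notin> {m - 1, m}" "fst q \<notin> {m - 1, m}"
        using p q t 3 out by (cases p; cases q; auto)+
      ultimately have "fst p = 1" "fst q = 1"
        using fibre_coordinates(1)[OF t p(1)] fibre_coordinates(1)[OF t q(1)] by auto
      with wt_indicator_unique[OF one p(1) q(1)] p q show False by simp
    qed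
    ultimately show ?thesis using t by blast
  qed
qed

text \<open>If a fibre monomial avoids \<open>(m, 0)\<close> and \<open>(0, n)\<close> as well, its
  four extreme coordinates sit in four different factors, and these are all its factors.\<close>

private definition inner_pairing :: "(nat \<times> nat \<Rightarrow>\<^sub>0 nat) \<Rightarrow> bool" where
  "inner_pairing t \<longleftrightarrow> (0, 0) \<notin> keys t \<and> (m, n) \<notin> keys t"

private definition low :: "nat \<times> nat \<Rightarrow> bool" where
  "low v \<longleftrightarrow> fst v = 0 \<or> snd v = 0"

text \<open>The shared low \<open>v\<close> is not \<open>(0, 0)\<close> and occupies a coordinate 0
  in \<open>t'\<close>, which excludes \<open>(0, 0)\<close> from \<open>t'\<close>. In
  \<open>t\<close> every factor carries an extreme coordinate, so the shared \<open>w\<close>, not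
  being low, carries \<open>m\<close> or \<open>n\<close> and excludes \<open>(m, n)\<close> in the
  same way.\<close>

private lemma inner_pairing_transfer:
  assumes avoid: "\<And>t. fibre t \<Longrightarrow> (m, 0) \<notin> keys t \<and> (0, n) \<notin> keys t"
    and t: "fibre t" "inner_pairing t" and t': "fibre t'"
    and v: "v \<in> keys t" "v \<in> keys t'" "low v" and w: "w \<in> keys t" "w \<in> keys t'" "\<not> low w"
  shows "inner_pairing t'"
proof -
  have "(0, 0) \<notin> keys t'"
    using fibre_unique[OF t' _ v(2), of "(0, 0)"] v t(2) by (auto simp: low_def inner_pairing_def)
  moreover have "(m, n) \<notin> keys t'"
  proof
    assume mn: "(m, n) \<in> keys t'"
    obtain p q r s where p: "p \<in> keys t" "fst p = 0" and q: "q \<in> keys t" "snd q = 0"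
      and r: "r \<in> keys t" "fst r = m" and s: "s \<in> keys t" "snd s = n"
      using fibre_exists[OF t(1), of 0 0] fibre_exists[OF t(1), of m n] by auto
    have "p \<noteq> q" "p \<noteq> r" "p \<noteq> s" "q \<noteq> r" "q \<noteq> s" "r \<noteq> s"
      using p q r s t(2) avoid[OF t(1)] m n unfolding inner_pairing_def
      by (cases p; cases q; cases r; cases s; auto)+
    then have "card {p, q, r, s} = 4" by simp
    moreover have "card (keys t) \<le> 4"
      using card_keys_le_mdeg[of t] same_fibre_mdeg[of t "corner_monomial m n"] t(1)
      by (simp add: corner_monomial_def mdeg_add)
    ultimately have "{p, q, r, s} = keys t"
      using p q r s by (intro card_seteq) auto
    then have "w \<in> {p, q, r, s}" using w(1) by simp
    moreover have "w \<noteq> p" "w \<noteq> q" using p q w(3) by (auto simp: low_def)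
    ultimately have "w = r \<or> w = s" by blast
    then have "w = (m, n)"
      using fibre_unique[OF t' w(2) mn] r s by auto
    with w(1) t(2) show False by (simp add: inner_pairing_def)
  qed
  ultimately show ?thesis by (simp add: inner_pairing_def)
qed

text \<open>The Koszul relation of the two corner squares is a cycle of length four through the monomials
  \<open>(A + A'), (D + A'), (D + D'), (A + D')\<close>; only the first of them is an inner pairing.\<close>

private lemma not_linearly_related:
  assumes avoid: "\<And>t. fibre t \<Longrightarrow> (m, 0) \<notin> keys t \<and> (0, n) \<notin> keys t"
  shows "\<not> linearly_related L (hibi_ideal L :: (nat \<times> nat, 'k::field) mpoly set)"
proof
  assume "linearly_related L (hibi_ideal L :: (nat \<times> nat, 'k) mpoly set)"
  then have "betti L (hibi_ideal L :: (nat \<times> nat, 'k) mpoly set) 1 4 = 0"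
    by (simp add: linearly_related_def)
  moreover have "(4::nat) = Suc 3" by simp
  ultimately have crit: "\<forall>h f. symmetric_family L (hibi_ideal L :: (nat \<times> nat, 'k) mpoly set) h \<longrightarrow>
      (\<forall>v\<in>L. f v \<in> hibi_ideal L \<and> (\<forall>t\<in>keys (f v). mdeg t = 3)) \<longrightarrow>
      (\<Sum>v\<in>L. var v * f v) = 0 \<longrightarrow> (\<Sum>v\<in>L. h v (f v)) = 0"
    by (simp only: betti_one_zero_iff[OF finite hibi_homogeneous_ideal[OF lattice]])
  \<comment> \<open>\<open>h v\<close> sees inner monomials for low \<open>v\<close> only. Symmetry
    is clear if both or none of \<open>v\<close>, \<open>w\<close> are low. Otherwise
    \<open>inner_pairing_transfer\<close> makes being inner constant among fibre monomials divisible
    by both, and \<open>g\<close> vanishes fibrewise.\<close>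
  define \<phi> :: "nat \<times> nat \<Rightarrow> (nat \<times> nat \<Rightarrow>\<^sub>0 nat) \<Rightarrow> 'k"
    where "\<phi> v t = (if fibre t \<and> inner_pairing t \<and> low v then 1 else 0)" for v t
  define h where "h v g = ev (\<lambda>s. \<phi> v (\<some> v + s)) g" for v and g :: "(nat \<times> nat, 'k) mpoly"
  have sym: "symmetric_family L (hibi_ideal L) h"
    unfolding symmetric_family_def
  proof (intro conjI ballI allI)
    fix v w g assume v: "v \<in> L" and w: "w \<in> L" and "g \<in> (hibi_ideal L :: (nat \<times> nat, 'k) mpoly set)"
    then have g: "g \<in> fibrewise_zero L" by (simp add: hibi_ideal_eq[OF lattice])
    have "ev (\<lambda>s. \<phi> v (\<some> v + (\<some> w + s)) - \<phi> w (\<some> w + (\<some> v + s))) g = 0"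
    proof (rule fibrewise_zeroD[OF g])
      fix s s' :: "nat \<times> nat \<Rightarrow>\<^sub>0 nat"
      assume s: "keys s \<subseteq> L" "keys s' \<subseteq> L" "same_fibre s s'"
      define t t' where t: "t = \<some> v + (\<some> w + s)" "t' = \<some> v + (\<some> w + s')"
      have swap: "\<some> w + (\<some> v + s) = t" "\<some> w + (\<some> v + s') = t'"
        by (simp_all only: t add.left_commute)
      have fib: "fibre t \<longleftrightarrow> fibre t'"
        using s v w unfolding t
        by (auto simp: keys_add_nat same_fibre_def wt_add)
      have k: "v \<in> keys t" "v \<in> keys t'" "w \<in> keys t" "w \<in> keys t'"
        by (simp_all add: t keys_add_nat)
      have ip: "inner_pairing t \<longleftrightarrow> inner_pairing t'" if "fibre t" "low v \<noteq> low w"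
      proof (cases "low v")
        case True
        with that fib k show ?thesis
          using inner_pairing_transfer[OF avoid, of t t' v w] inner_pairing_transfer[OF avoid, of t' t v w] by blast
      next
        case False
        with that fib k show ?thesis
          using inner_pairing_transfer[OF avoid, of t t' w v] inner_pairing_transfer[OF avoid, of t' t w v] by blast
      qed
      have "\<phi> v t - \<phi> w t = \<phi> v t' - \<phi> w t'"
      proof (cases "low v = low w")
        case True
        then have "\<phi> v u = \<phi> w u" for u by (simp add: \<phi>_def)
        then show ?thesis by simp
      next
        case False
        have "\<phi> u t = \<phi> u t'" for u
        proof (cases "fibre t")
          case True
          with fib ip[OF True False] have "fibre t'" "inner_pairing t = inner_pairing t'" by blast+
          with True show ?thesis by (simp add: \<phi>_def)
        next
          case no: False
          with fib have "\<not> fibre t'" by blast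
          with no show ?thesis unfolding \<phi>_def by presburger
        qed
        then show ?thesis by simp
      qed
      then show "\<phi> v (\<some> v + (\<some> w + s)) - \<phi> w (\<some> w + (\<some> v + s)) = \<phi> v (\<some> v + (\<some> w + s')) - \<phi> w (\<some> w + (\<some> v + s'))"
        unfolding swap t[symmetric] .
    qed
    then show "h v (var w * g) = h w (var v * g)"
      by (simp add: h_def var_monom ev_monom_mult ev_fun_diff)
  qed (simp_all add: h_def ev_add ev_monom_mult)
  have h_diff: "h v (monom s 1 - monom t 1) = \<phi> v (\<some> v + s) - \<phi> v (\<some> v + t)" for v s t
    by (simp add: h_def ev_diff)
  define A D A' D' :: "nat \<times> nat \<Rightarrow>\<^sub>0 nat" where
    "A = \<some> (0, 1) + \<some> (1, 0)" "D = \<some> (0, 0) + \<some> (1, 1)"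
    "A' = \<some> (m - 1, n) + \<some> (m, n - 1)" "D' = \<some> (m, n) + \<some> (m - 1, n - 1)"
  note defs = this
  \<comment> \<open>Each nonzero \<open>f v\<close> is one side of the square divided by a variable
    \<open>v\<close> that both ends contain. Of the four variables only \<open>(0, 0)\<close> and
    \<open>(0, 1)\<close> are low.\<close>
  define f :: "nat \<times> nat \<Rightarrow> (nat \<times> nat, 'k) mpoly" where
    "f v = (if v = (m - 1, n) then monom (A + \<some> (m, n - 1)) 1 - monom (D + \<some> (m, n - 1)) 1
      else if v = (0, 0) then monom (\<some> (1, 1) + A') 1 - monom (\<some> (1, 1) + D') 1
      else if v = (m, n) then monom (D + \<some> (m - 1, n - 1)) 1 - monom (A + \<some> (m - 1, n - 1)) 1
      else if v = (0, 1) then monom (\<some> (1, 0) + D') 1 - monom (\<some> (1, 0) + A') 1 else 0)" for v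
  let ?S = "{(m - 1, n), (0, 0), (m, n), (0, 1)}"
  have S: "?S \<subseteq> L" using sw ne by auto
  have ne4: "(m - 1, n) \<noteq> (0, 0)" "(m - 1, n) \<noteq> (m, n)" "(m - 1, n) \<noteq> (0, 1)" "(0, 0) \<noteq> (m, n)"
    "(m, n) \<noteq> (0, 1)"
    using m n by auto
  have fS: "f (m - 1, n) = monom (A + \<some> (m, n - 1)) 1 - monom (D + \<some> (m, n - 1)) 1"
    "f (0, 0) = monom (\<some> (1, 1) + A') 1 - monom (\<some> (1, 1) + D') 1"
    "f (m, n) = monom (D + \<some> (m - 1, n - 1)) 1 - monom (A + \<some> (m - 1, n - 1)) 1"
    "f (0, 1) = monom (\<some> (1, 0) + D') 1 - monom (\<some> (1, 0) + A') 1"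
    using m n by (auto simp: f_def)
  have f0: "f v = 0" if "v \<notin> ?S" for v
    using that by (auto simp: f_def)
  have sum_S: "(\<Sum>v\<in>L. g v) = g (m - 1, n) + g (0, 0) + g (m, n) + g (0, 1)"
    if "\<And>v. v \<notin> ?S \<Longrightarrow> g v = 0" for g :: "nat \<times> nat \<Rightarrow> 'b::comm_monoid_add"
  proof -
    have "(\<Sum>v\<in>L. g v) = (\<Sum>v\<in>?S. g v)"
      using S finite that by (intro sum.mono_neutral_right) auto
    then show ?thesis using ne4 by (simp add: add.assoc)
  qed
  have keysL: "keys A \<subseteq> L" "keys D \<subseteq> L" "keys A' \<subseteq> L" "keys D' \<subseteq> L"
    using sw ne by (auto simp: defs keys_add_nat)
  have fib: "same_fibre A D" "same_fibre D A" "same_fibre A' D'" "same_fibre D' A'"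
    by (auto simp: defs same_fibre_def wt_add)
  have deg: "mdeg A = 2" "mdeg D = 2" "mdeg A' = 2" "mdeg D' = 2"
    by (simp_all add: defs mdeg_add)
  have diff: "monom s 1 - monom t 1 \<in> (hibi_ideal L :: (nat \<times> nat, 'k) mpoly set) \<and>
      (\<forall>u\<in>keys (monom s 1 - monom t 1 :: (nat \<times> nat, 'k) mpoly). mdeg u = 3)"
    if "keys s \<subseteq> L" "keys t \<subseteq> L" "same_fibre s t" "mdeg s = 3" "mdeg t = 3" for s t
  proof -
    have "keys (monom s 1 - monom t 1 :: (nat \<times> nat, 'k) mpoly) \<subseteq> {s, t}"
      by (auto simp: in_keys_iff lookup_minus lookup_monom when_def split: if_splits)
    then show ?thesis
      using that by (auto simp: hibi_ideal_eq[OF lattice] monom_diff_fibrewise_zero)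
  qed
  let ?Q = "\<lambda>g :: (nat \<times> nat, 'k) mpoly. g \<in> hibi_ideal L \<and> (\<forall>t\<in>keys g. mdeg t = 3)"
  have "?Q (f v)" for v
  proof -
    note simps = keys_add_nat same_fibre_add_left same_fibre_add_right mdeg_add
    have "?Q (f (m - 1, n))"
      unfolding fS by (rule diff) (use keysL fib deg ne in \<open>simp_all add: simps\<close>)
    moreover have "?Q (f (0, 0))"
      unfolding fS by (rule diff) (use keysL fib deg sw in \<open>simp_all add: simps\<close>)
    moreover have "?Q (f (m, n))"
      unfolding fS by (rule diff) (use keysL fib deg ne in \<open>simp_all add: simps\<close>)
    moreover have "?Q (f (0, 1))"
      unfolding fS by (rule diff) (use keysL fib deg sw in \<open>simp_all add: simps\<close>)
    ultimately have S: "?Q (f v)" if "v \<in> ?S" for v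
      using that by blast
    have "homogeneous_ideal L (hibi_ideal L :: (nat \<times> nat, 'k) mpoly set)"
      by (rule hibi_homogeneous_ideal[OF lattice])
    then have "0 \<in> (hibi_ideal L :: (nat \<times> nat, 'k) mpoly set)"
      by (simp add: homogeneous_ideal_def)
    then have "?Q (f v)" if "v \<notin> ?S" for v
      by (simp add: f0[OF that])
    with S show ?thesis by blast
  qed
  moreover have "(\<Sum>v\<in>L. var v * f v) = 0"
  proof -
    have "(\<Sum>v\<in>L. var v * f v) = var (m - 1, n) * f (m - 1, n) + var (0, 0) * f (0, 0) +
        var (m, n) * f (m, n) + var (0, 1) * f (0, 1)"
      by (rule sum_S) (simp add: f0)
    also have "\<dots> = (monom (A + A') 1 - monom (D + A') 1) + (monom (D + A') 1 - monom (D + D') 1) +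
        (monom (D + D') 1 - monom (A + D') 1) + (monom (A + D') 1 - monom (A + A') 1)"
    proof -
      have e: "\<some> (m - 1, n) + (B + \<some> (m, n - 1)) = B + A'" "\<some> (m, n) + (B + \<some> (m - 1, n - 1)) = B + D'"
        "\<some> (0, 0) + (\<some> (1, 1) + B) = D + B" "\<some> (0, 1) + (\<some> (1, 0) + B) = A + B" for B
        by (simp_all only: defs add_ac)
      show ?thesis
        by (simp only: fS var_monom right_diff_distrib monom_mult e mult_1)
    qed
    also have "\<dots> = 0" by simp
    finally show ?thesis .
  qed
  ultimately have "(\<Sum>v\<in>L. h v (f v)) = 0"
    using crit[THEN spec[of _ h], THEN spec[of _ f]] sym by blast
  moreover have "(\<Sum>v\<in>L. h v (f v)) = h (m - 1, n) (f (m - 1, n)) + h (0, 0) (f (0, 0)) +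
      h (m, n) (f (m, n)) + h (0, 1) (f (0, 1))"
    by (rule sum_S) (simp add: f0 h_def)
  moreover have "h (m - 1, n) (f (m - 1, n)) = 0" "h (m, n) (f (m, n)) = 0"
    using m n by (simp_all add: fS h_diff \<phi>_def low_def)
  moreover have "h (0, 0) (f (0, 0)) = 0"
    by (simp add: fS h_diff \<phi>_def inner_pairing_def keys_add_nat)
  \<comment> \<open>Only this side is divided by a low variable and has an inner end, namely
    \<open>A + A'\<close>. The sign comes from its orientation, which runs from
    \<open>A + D'\<close> to \<open>A + A'\<close>.\<close>
  moreover have "h (0, 1) (f (0, 1)) = - 1"
  proof -
    have "\<phi> (0, 1) (\<some> (0, 1) + (\<some> (1, 0) + D')) = 0"
      by (simp add: \<phi>_def inner_pairing_def keys_add_nat defs)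
    moreover have "\<phi> (0, 1) (\<some> (0, 1) + (\<some> (1, 0) + A')) = 1"
    proof -
      have "\<some> (0, 1) + (\<some> (1, 0) + A') = corner_monomial m n"
        by (simp only: corner_monomial_def defs add.assoc)
      moreover have "fibre (corner_monomial m n)"
        using sw ne by (auto simp: corner_monomial_def keys_add_nat)
      moreover have "inner_pairing (corner_monomial m n)"
        using m n by (auto simp: corner_monomial_def inner_pairing_def keys_add_nat)
      ultimately show ?thesis by (simp add: \<phi>_def low_def)
    qed
    ultimately show ?thesis by (simp add: fS h_diff)
  qed
  ultimately show False by simp
qed

lemma planar_linearly_related_iff:
  "linearly_related L (hibi_ideal L :: (nat \<times> nat, 'k::field) mpoly set) \<longleftrightarrow>
    ((m, 0) \<in> L \<or> (0, n) \<in> L) \<and> (1, n - 1) \<in> L \<and> (m - 1, 1) \<in> L"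
  using linearly_related_if not_linearly_related fibre_avoids_corners by blast

end

theorem theorem3p12:
  fixes m n :: nat and L :: "(nat \<times> nat) set"
  assumes "m \<ge> 2" and "n \<ge> 2"
    and "planar_distributive_lattice L"
    and "simple_lattice L"
    and "L \<subseteq> {(0, 0)..(m, n)}"
    and "\<And>a b. L \<subseteq> {a..b} \<Longrightarrow> {(0, 0)..(m, n)} \<subseteq> {a..b}"
    and "{(0, 0), (1, 0), (0, 1), (1, 1)} \<subseteq> L"
    and "{(m - 1, n - 1), (m, n - 1), (m - 1, n), (m, n)} \<subseteq> L"
  shows "linearly_related L (hibi_ideal L :: (nat \<times> nat, 'k::field) mpoly set) \<longleftrightarrow>
    ((m, 0) \<in> L \<or> (0, n) \<in> L) \<and> (1, n - 1) \<in> L \<and> (m - 1, 1) \<in> L"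
  using planar_linearly_related_iff[OF assms(1,2,3,5,7,8)] .

end
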